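(* Let $\hat U=\bigcup_{k=1}^6\bigcup_{\ell=1}^6 V_{k,\ell}\times V^*_{0,k,\ell}$, let $\hat T(z,w)=\left(\frac1z-b_1(z),\frac1w-b_1(z)\right)$ on $\hat U$ (defined almost everywhere), and let $\hat\mu$ be the measure on $\hat U$ given by $$d\hat\mu=C_0\,\frac{d(\lambda\times\lambda)(z,w)}{|z-w|^4},$$ where $\lambda$ is Lebesgue measure on $\mathbb C$ and $C_0$ is the normalizing constant making $\hat\mu$ a probability measure. Then $(\hat U,\hat T,\hat\mu)$ is a representation of the natural extension of $T$ (with respect to the absolutely continuous $T$-invariant probability measure $\mu$ on $U$ whose density is $h(z)=C_0\int_{V^*_{0,k,\ell}}\frac{d\lambda(w)}{|z-w|^4}$ for $z\in V_{k,\ell}$).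
   Context: Natural extension of $(U,T,\mu)$: the (unique up to isomorphism) invertible minimal measure-preserving extension, here with factor map the projection to the first coordinate $\pi(z,w)=z$; that is, $\hat T$ preserves $\hat\mu$, is invertible almost everywhere, $\pi\circ\hat T=T\circ\pi$, $\pi_*\hat\mu=\mu$, and the $\sigma$-algebra of $\hat U$ is generated mod null sets by $\hat T^n\pi^{-1}(\mathcal B_U)$, $n\ge0$. Let $\zeta=\frac{1+\sqrt{-3}}2$, $\eta=\frac{3+\sqrt{-3}}2$, $\mathfrak o(\sqrt{-3})=\mathbb Z+\mathbb Z\zeta$, $\mathcal J=\eta\cdot\mathfrak o(\sqrt{-3})$. $U$ is the fundamental domain of $\mathbb C/\mathcal J$ consisting of the open regular hexagon with vertices $\zeta^k$ ($0\le k\le 5$), together with the three open sides $\{t\zeta+(1-t)(-\overline\zeta):0<t<1\}$, $\{t(-\zeta)+(1-t)(-1):0<t<1\}$, $\{t+(1-t)\overline\zeta:0<t<1\}$ and the two vertices $-\zeta,\overline\zeta$. For $z\in\mathbb C$, $[z]$ is the unique $a\in\mathcal J$ with $z\in a+U$. The map $T:U\to U$ is $T(z)=\frac1z-[\frac1z]$ for $z\ne0$, $T(0)=0$; $b_1(z)=[1/z]$ for $z\neq 0$. Write $z=x+yi$, $r=\frac{\sqrt3}3$. Put $V_{1,1}=\{z\in U:|z-\frac13\overline\eta|<r,\ |z-\frac13\sqrt{-3}|<r\}$, $V_{2,1}=\{z\in U:|z-\frac23\eta|>r,\ |z-\frac13\sqrt{-3}|>r,\ x>0,\ y>0\}$,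 $V_{3,1}=\{z\in U:|z-\frac23\eta|>r,\ |z-\frac13\overline\eta|>r,\ y>0,\ y<\sqrt3x\}$, $V_{4,1}=\{z\in U:|z-\frac13\overline\eta|<r,\ |z-\frac23\eta|<r\}$, $V_{5,1}=\{z\in U:|z-\frac23\eta|<r,\ |z-\frac13\sqrt{-3}|<r\}$, $V_{6,1}=\{z\in U:|z-\frac13\overline\eta|>r,\ |z-\frac13\sqrt{-3}|>r,\ x>0,\ y>0\}$, and $V_{k,\ell}=\zeta^{\ell-1}V_{k,1}$ for $1\le k,\ell\le6$; these partition $U$ up to a null set. Put $V^*_{0,1,1}=\{|z|>1,\ |z-\frac{\sqrt{-3}}2|>\frac12,\ |z-\frac\eta2|>\frac12,\ |z-\frac{\overline\eta}2|>\frac12\}$, $V^*_{0,2,1}=\{|z|>1,\ |z-\frac\eta2|>\frac12,\ |z-\frac{\overline\eta}2|>\frac12\}$, $V^*_{0,3,1}=\{|z|>1,\ |z-\frac{\sqrt{-3}}2|>\frac12,\ |z-\frac\eta2|>\frac12\}$, $V^*_{0,4,1}=\{|z|>1,\ |z-\eta|>1,\ |z-\frac{\overline\eta}2|>\frac12\}$, $V^*_{0,5,1}=\{|z|>1,\ |z-\eta|>1,\ |z-\frac{\sqrt{-3}}2|>\frac12\}$, $V^*_{0,6,1}=\{|z|>1,\ |z-\eta|>1\}$ (all subsets of $\mathbb C$), and $V^*_{0,k,\ell}=\zeta^{\ell-1}V^*_{0,k,1}$. *)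

theory Defs
  imports "HOL-Probability.Probability"
begin

(* (M, S) with factor map p is a natural extension of (N, T).  S need only be defined and
   invertible on a set X of full measure; the requirements on S are expressed on X.
   The last clause is minimality: the forward images S^n(p^{-1}(C)), C measurable in N,
   generate the measurable sets of M up to null sets. *)
definition natural_extension ::
  "'a measure \<Rightarrow> ('a \<Rightarrow> 'a) \<Rightarrow> 'b measure \<Rightarrow> ('b \<Rightarrow> 'b) \<Rightarrow> ('b \<Rightarrow> 'a) \<Rightarrow> bool" where
  "natural_extension N T M S p \<longleftrightarrow>
     prob_space N \<and> T \<in> measurable N N \<and> distr N N T = N \<and>
     prob_space M \<and> p \<in> measurable M N \<and> distr M N p = N \<and>
     (\<exists>X \<in> sets M. (AE x in M. x \<in> X) \<and>
        bij_betw S X X \<and>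
        S \<in> measurable (restrict_space M X) (restrict_space M X) \<and>
        the_inv_into X S \<in> measurable (restrict_space M X) (restrict_space M X) \<and>
        distr (restrict_space M X) (restrict_space M X) S = restrict_space M X \<and>
        (\<forall>x \<in> X. p (S x) = T (p x)) \<and>
        (\<forall>A \<in> sets M. \<exists>B \<in> sigma_sets X {(S ^^ n) ` (p -` C \<inter> X) | n C. C \<in> sets N}.
            (A - B) \<union> (B - A) \<in> null_sets M))"

definition sqrtm3 :: complex where "sqrtm3 = \<i> * of_real (sqrt 3)"

definition zeta :: complex where "zeta = (1 + sqrtm3) / 2"

definition eta :: complex where "eta = (3 + sqrtm3) / 2"

definition eisenstein_ints :: "complex set" where
  "eisenstein_ints = {of_int m + of_int n * zeta | m n. True}"

definition ideal_J :: "complex set" where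
  "ideal_J = (\<lambda>a. eta * a) ` eisenstein_ints"

definition dom_U :: "complex set" where
  "dom_U = interior (convex hull {zeta ^ k | k. k \<le> 5})
     \<union> open_segment zeta (- cnj zeta)
     \<union> open_segment (- zeta) (- 1)
     \<union> open_segment 1 (cnj zeta)
     \<union> {- zeta, cnj zeta}"

definition bracket :: "complex \<Rightarrow> complex" where
  "bracket z = (THE a. a \<in> ideal_J \<and> z \<in> (\<lambda>u. a + u) ` dom_U)"

(* only meaningful for z \<noteq> 0 *)
definition b1 :: "complex \<Rightarrow> complex" where
  "b1 z = bracket (1 / z)"

definition map_T :: "complex \<Rightarrow> complex" where
  "map_T z = (if z = 0 then 0 else 1 / z - bracket (1 / z))"

definition rad :: real where "rad = sqrt 3 / 3"

definition V1 :: "nat \<Rightarrow> complex set" where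
  "V1 k = {z \<in> dom_U.
     if k = 1 then cmod (z - cnj eta / 3) < rad \<and> cmod (z - sqrtm3 / 3) < rad
     else if k = 2 then cmod (z - 2 * eta / 3) > rad \<and> cmod (z - sqrtm3 / 3) > rad
                        \<and> Re z > 0 \<and> Im z > 0
     else if k = 3 then cmod (z - 2 * eta / 3) > rad \<and> cmod (z - cnj eta / 3) > rad
                        \<and> Im z > 0 \<and> Im z < sqrt 3 * Re z
     else if k = 4 then cmod (z - cnj eta / 3) < rad \<and> cmod (z - 2 * eta / 3) < rad
     else if k = 5 then cmod (z - 2 * eta / 3) < rad \<and> cmod (z - sqrtm3 / 3) < rad
     else if k = 6 then cmod (z - cnj eta / 3) > rad \<and> cmod (z - sqrtm3 / 3) > rad
                        \<and> Re z > 0 \<and> Im z > 0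
     else False}"

definition V :: "nat \<Rightarrow> nat \<Rightarrow> complex set" where
  "V k l = (\<lambda>z. zeta ^ (l - 1) * z) ` V1 k"

definition Vstar1 :: "nat \<Rightarrow> complex set" where
  "Vstar1 k = {z. cmod z > 1 \<and>
     (if k = 1 then cmod (z - sqrtm3 / 2) > 1 / 2 \<and> cmod (z - eta / 2) > 1 / 2
                    \<and> cmod (z - cnj eta / 2) > 1 / 2
      else if k = 2 then cmod (z - eta / 2) > 1 / 2 \<and> cmod (z - cnj eta / 2) > 1 / 2
      else if k = 3 then cmod (z - sqrtm3 / 2) > 1 / 2 \<and> cmod (z - eta / 2) > 1 / 2
      else if k = 4 then cmod (z - eta) > 1 \<and> cmod (z - cnj eta / 2) > 1 / 2
      else if k = 5 then cmod (z - eta) > 1 \<and> cmod (z - sqrtm3 / 2) > 1 / 2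
      else if k = 6 then cmod (z - eta) > 1
      else False)}"

definition Vstar :: "nat \<Rightarrow> nat \<Rightarrow> complex set" where
  "Vstar k l = (\<lambda>w. zeta ^ (l - 1) * w) ` Vstar1 k"

definition hat_U :: "(complex \<times> complex) set" where
  "hat_U = (\<Union>k\<in>{1..6}. \<Union>l\<in>{1..6}. V k l \<times> Vstar k l)"

definition hat_T :: "complex \<times> complex \<Rightarrow> complex \<times> complex" where
  "hat_T = (\<lambda>(z, w). (1 / z - b1 z, 1 / w - b1 z))"

(* C0 is the reciprocal of the total mass; were that mass infinite, C0 would be 0 and
   hat_mu would not be a probability measure. *)
definition C0 :: ennreal where
  "C0 = 1 / (\<integral>\<^sup>+ (z, w). ennreal (1 / cmod (z - w) ^ 4)
               \<partial>restrict_space (lborel \<Otimes>\<^sub>M lborel) hat_U)"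

definition hat_mu :: "(complex \<times> complex) measure" where
  "hat_mu = density (restrict_space (lborel \<Otimes>\<^sub>M lborel) hat_U)
              (\<lambda>(z, w). C0 * ennreal (1 / cmod (z - w) ^ 4))"

(* The cells V k l (1 \<le> k, l \<le> 6) are pairwise disjoint, so on V k l only the (k, l) summand
   survives; on the null set of points of dom_U outside all cells, dens_h is 0. *)
definition dens_h :: "complex \<Rightarrow> ennreal" where
  "dens_h z = (\<Sum>k\<in>{1..6}. \<Sum>l\<in>{1..6}.
     indicator (V k l) z *
       (C0 * (\<integral>\<^sup>+ w. ennreal (1 / cmod (z - w) ^ 4) \<partial>restrict_space lborel (Vstar k l))))"

definition mu :: "complex measure" where
  "mu = density (restrict_space lborel dom_U) dens_h"

end

theory Submission
  imports Defs
begin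

text \<open>
  Off a null set that is stable under all maps involved, \<open>hat_U\<close> is described by conditions in six
  directions, one for each shortest vector \<open>e\<close> of the lattice \<open>ideal_J\<close>: depending on whether \<open>z\<close> lies
  in none, in one or in both of two discs attached to \<open>e\<close>, the fibre variable \<open>w\<close> outside the unit disc
  has to avoid no further, a small or a large disc attached to \<open>e\<close>. This description and its image
  under inversion are both fundamental domains for the diagonal translations by \<open>ideal_J\<close> of one and
  the same set, so inversion followed by the translation that brings \<open>z\<close> back to the hexagon is a bijection of \<open>hat_U\<close>.
  The measure \<open>|z - w|^-4\<close> is invariant under Moebius maps acting diagonally, hence under \<open>hat_T\<close>; its
  mass is finite because the domain meets the diagonal only in tangential cusps at the vertices.
  For minimality, \<open>w\<close> is the continued fraction built from the past digits of \<open>z\<close>. It converges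
  because the product of the \<open>|w_k|\<close> diverges: were it bounded, the \<open>w_k\<close> would approach the
  vertices of the hexagon, near which the map is expanding.
\<close>

text \<open>The set tiled by the two domains is never named; what matters is how each selects a
  translate of a pair \<open>(u, v)\<close>. \<open>stair\<close> moves by the ideal point whose
  hexagon contains \<open>u\<close>, \<open>costair\<close> by the ideal point nearest to
  \<open>u\<close> among those at distance less than 1 from \<open>v\<close>. Unit discs about two
  ideal points meet only if the centres are adjacent, so candidates compete only with neighbours,
  and this is why conditions in six separate directions suffice. The obstacle to both finiteness and
  minimality is the vertices of the hexagon. They lie on the unit circle, so neither
  \<open>1 - |z|\<close> nor \<open>|w| - 1\<close> has a positive lower bound. In the mass estimate
  cell 1 stays away from the circle; cells 2, 3 and 6 are themselves cusps; for cells 4 and 5 the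
  cell fills an angle and the fibre is the cusp, so the order of integration is reversed. No planar
  Jacobian determinant is computed: inversion is reduced to \<open>1 / x\<close> on the line by
  passing to slopes, and rotation to three shears.\<close>

section \<open>Coordinates on the Eisenstein lattice\<close>

text \<open>The coordinates \<open>al\<close>, \<open>be\<close> have the Eisenstein integers as their integer points, and the values
  \<open>ev e\<close> at the six shortest vectors \<open>e\<close> of the ideal are \<open>al\<close>, \<open>be\<close>, \<open>al - be\<close> up to sign.\<close>

definition al :: "complex \<Rightarrow> real" where "al z = Re z + Im z / sqrt 3"

definition be :: "complex \<Rightarrow> real" where "be z = 2 * Im z / sqrt 3"

abbreviation sq :: "complex \<Rightarrow> real" where "sq z \<equiv> (cmod z)\<^sup>2"

definition nbrs :: "complex set" where "nbrs = {e \<in> ideal_J. sq e = 3}"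

text \<open>The factor 2/3 gives \<open>ev e e = 2\<close> for a neighbour, so
  \<open>ev e z = 1\<close> is the perpendicular bisector of \<open>0\<close> and \<open>e\<close>,
  which carries a side of the hexagon. Circles centred on the line through \<open>0\<close> and
  \<open>e\<close> become equations in \<open>sq z\<close> and \<open>ev e z\<close> alone.\<close>

definition ev :: "complex \<Rightarrow> complex \<Rightarrow> real" where "ev e z = 2 / 3 * Re (cnj e * z)"

lemma al_simps [simp]:
  "al (z + w) = al z + al w" "al (z - w) = al z - al w" "al (- z) = - al z" "al 0 = 0" "al 1 = 1"
  "al (of_real r * z) = r * al z" "al (z / of_real r) = al z / r"
  "al (of_int i) = of_int i" "al (z / numeral v) = al z / numeral v" "al (numeral v * z) = numeral v * al z"
  by (simp_all add: al_def add_divide_distrib diff_divide_distrib distrib_left)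

lemma be_simps [simp]:
  "be (z + w) = be z + be w" "be (z - w) = be z - be w" "be (- z) = - be z" "be 0 = 0" "be 1 = 0"
  "be (of_real r * z) = r * be z" "be (z / of_real r) = be z / r"
  "be (of_int i) = 0" "be (z / numeral v) = be z / numeral v" "be (numeral v * z) = numeral v * be z"
  by (simp_all add: be_def add_divide_distrib diff_divide_distrib distrib_left mult.left_commute)

lemma Re_Im_albe: "Re z = al z - be z / 2" "Im z = sqrt 3 / 2 * be z"
  by (simp_all add: al_def be_def)

lemma albe_eqI: "al z = al w \<Longrightarrow> be z = be w \<Longrightarrow> z = w"
  by (simp add: complex_eq_iff Re_Im_albe)

lemma albe_cnj [simp]: "al (cnj z) = al z - be z" "be (cnj z) = - be z"
  by (simp_all add: al_def be_def)

lemma albe_zeta [simp]: "al zeta = 1" "be zeta = 1"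
  by (simp_all add: al_def be_def zeta_def sqrtm3_def)

lemma albe_eta [simp]: "al eta = 2" "be eta = 1"
  by (simp_all add: al_def be_def eta_def sqrtm3_def)

lemma albe_sqrtm3 [simp]: "al sqrtm3 = 1" "be sqrtm3 = 2"
  by (simp_all add: al_def be_def sqrtm3_def)

lemma albe_mult: "al (z * w) = al z * al w - be z * be w" "be (z * w) = al z * be w + be z * al w - be z * be w"
proof -
  have s: "sqrt 3 * (sqrt 3 * x) = 3 * x" for x :: real by (simp flip: mult.assoc)
  show "al (z * w) = al z * al w - be z * be w" "be (z * w) = al z * be w + be z * al w - be z * be w"
    by (simp_all add: al_def be_def field_simps s)
qed

lemma albe_zeta_mult [simp]: "al (zeta * z) = al z - be z" "be (zeta * z) = al z"
  by (simp_all add: albe_mult)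

lemma sq_albe: "sq z = (al z)\<^sup>2 - al z * be z + (be z)\<^sup>2"
proof -
  have "sq z = (Re z)\<^sup>2 + (Im z)\<^sup>2" by (simp add: cmod_power2)
  also have "\<dots> = (al z)\<^sup>2 - al z * be z + (be z)\<^sup>2"
    unfolding Re_Im_albe by (simp add: power2_eq_square field_simps)
  finally show ?thesis .
qed

lemma ideal_J_iff: "z \<in> ideal_J \<longleftrightarrow> (\<exists>m n::int. al z = of_int m \<and> be z = of_int n \<and> 3 dvd m + n)"
proof
  assume "z \<in> ideal_J"
  then obtain m n :: int where z: "z = eta * (of_int m + of_int n * zeta)"
    by (auto simp: ideal_J_def eisenstein_ints_def)
  have "al z = of_int (2 * m + n)" "be z = of_int (m + 2 * n)"
    unfolding z by (simp_all add: albe_mult)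
  moreover have "3 dvd (2 * m + n) + (m + 2 * n)" by presburger
  ultimately show "\<exists>m n::int. al z = of_int m \<and> be z = of_int n \<and> 3 dvd m + n" by blast
next
  assume "\<exists>m n::int. al z = of_int m \<and> be z = of_int n \<and> 3 dvd m + n"
  then obtain m n :: int where *: "al z = of_int m" "be z = of_int n" "3 dvd m + n" by blast
  from \<open>3 dvd m + n\<close> obtain i where i: "m + n = 3 * i" by blast
  define k l where "k = m - i" and "l = n - i"
  have mn: "m = 2 * k + l" "n = k + 2 * l" using i by (auto simp: k_def l_def)
  have "z = eta * (of_int k + of_int l * zeta)"
    by (rule albe_eqI) (simp_all add: albe_mult * mn)
  then show "z \<in> ideal_J" by (auto simp: ideal_J_def eisenstein_ints_def)
qed

lemma ideal_J_uminus: "a \<in> ideal_J \<Longrightarrow> - a \<in> ideal_J"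
  by (auto simp: ideal_J_iff) (metis add_uminus_conv_diff dvd_minus_iff minus_add_distrib of_int_minus)

lemma ideal_J_add: "a \<in> ideal_J \<Longrightarrow> b \<in> ideal_J \<Longrightarrow> a + b \<in> ideal_J"
proof (unfold ideal_J_iff, elim exE conjE)
  fix m n m' n' :: int
  assume "al a = real_of_int m" "be a = real_of_int n" "al b = real_of_int m'" "be b = real_of_int n'" "3 dvd m + n" "3 dvd m' + n'"
  then show "\<exists>m n::int. al (a + b) = of_int m \<and> be (a + b) = of_int n \<and> 3 dvd m + n"
    by (intro exI[of _ "m + m'"] exI[of _ "n + n'"]) (simp, presburger)
qed

lemma ideal_J_diff: "a \<in> ideal_J \<Longrightarrow> b \<in> ideal_J \<Longrightarrow> a - b \<in> ideal_J"
  using ideal_J_add[of a "- b"] ideal_J_uminus[of b] by simp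

lemma ideal_J_zeta: "a \<in> ideal_J \<Longrightarrow> zeta * a \<in> ideal_J"
proof (unfold ideal_J_iff, elim exE conjE)
  fix m n :: int
  assume "al a = real_of_int m" "be a = real_of_int n" "3 dvd m + n"
  then show "\<exists>m n::int. al (zeta * a) = of_int m \<and> be (zeta * a) = of_int n \<and> 3 dvd m + n"
    by (intro exI[of _ "m - n"] exI[of _ "m"]) (simp, presburger)
qed

lemma countable_ideal_J: "countable ideal_J"
proof -
  have "eisenstein_ints = (\<lambda>(m, n). of_int m + of_int n * zeta) ` (UNIV :: (int \<times> int) set)"
    by (auto simp: eisenstein_ints_def)
  then have "countable eisenstein_ints" by (metis countableI_type countable_image)
  then show ?thesis unfolding ideal_J_def by simp
qed

text \<open>The norm equals \<open>(m + n)^2 - 3 * m * n\<close>, hence is a multiple of 3 on the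
  ideal; below 6 only 0 and 3 remain.\<close>

lemma ideal_J_small:
  assumes "a \<in> ideal_J" "sq a < 6"
  shows "a = 0 \<or> a \<in> nbrs"
proof -
  from assms(1) obtain m n :: int where *: "al a = m" "be a = n" and d: "3 dvd m + n"
    by (auto simp: ideal_J_iff)
  have "real_of_int (m\<^sup>2 - m * n + n\<^sup>2) = sq a" by (simp add: sq_albe *)
  with assms(2) have lt: "m\<^sup>2 - m * n + n\<^sup>2 < 6" by linarith
  obtain i where i: "m + n = 3 * i" using d by blast
  have "m\<^sup>2 - m * n + n\<^sup>2 = (m + n)\<^sup>2 - 3 * (m * n)" by (simp add: power2_eq_square algebra_simps)
  also have "\<dots> = 3 * (3 * i\<^sup>2 - m * n)" unfolding i by (simp add: power2_eq_square algebra_simps)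
  finally have eq: "m\<^sup>2 - m * n + n\<^sup>2 = 3 * (3 * i\<^sup>2 - m * n)" .
  have "0 \<le> sq a" by simp
  then have "0 \<le> m\<^sup>2 - m * n + n\<^sup>2" using \<open>real_of_int _ = sq a\<close> by linarith
  then have "m\<^sup>2 - m * n + n\<^sup>2 = 0 \<or> m\<^sup>2 - m * n + n\<^sup>2 = 3" using lt eq by presburger
  then have "sq a = 0 \<or> sq a = 3" using \<open>real_of_int _ = sq a\<close> by (metis of_int_0 of_int_numeral)
  then show ?thesis using assms(1) by (auto simp: nbrs_def)
qed

lemma ev_albe: "ev e z = ((2 * al e - be e) * al z + (2 * be e - al e) * be z) / 3"
proof -
  have "Re (cnj e * z) = Re e * Re z + Im e * Im z" by simp
  then show ?thesis unfolding ev_def Re_Im_albe by (simp add: field_simps)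
qed

lemma nbrs_coords:
  assumes "e \<in> nbrs"
  shows "al e = 2 \<and> be e = 1 \<or> al e = 1 \<and> be e = 2 \<or> al e = -1 \<and> be e = 1 \<or>
    al e = -2 \<and> be e = -1 \<or> al e = -1 \<and> be e = -2 \<or> al e = 1 \<and> be e = -1"
proof -
  from assms obtain m n :: int where *: "al e = m" "be e = n" and d: "3 dvd m + n" and s: "sq e = 3"
    by (auto simp: nbrs_def ideal_J_iff)
  have "real_of_int (m\<^sup>2 - m * n + n\<^sup>2) = 3" using s by (simp add: sq_albe *)
  then have s3: "m\<^sup>2 - m * n + n\<^sup>2 = 3" by linarith
  have "3 * m\<^sup>2 + (2 * n - m)\<^sup>2 = 12" "3 * n\<^sup>2 + (2 * m - n)\<^sup>2 = 12"
    using s3 by (auto simp: power2_eq_square algebra_simps)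
  moreover have "0 \<le> (2 * n - m)\<^sup>2" "0 \<le> (2 * m - n)\<^sup>2" by simp_all
  ultimately have "m\<^sup>2 \<le> 4" "n\<^sup>2 \<le> 4" by linarith+
  then have "\<bar>m\<bar> \<le> 2" "\<bar>n\<bar> \<le> 2" using abs_le_square_iff[of m 2] abs_le_square_iff[of n 2] by simp_all
  then have "m \<in> {-2,-1,0,1,2}" "n \<in> {-2,-1,0,1,2}" by auto
  then have "m = 2 \<and> n = 1 \<or> m = 1 \<and> n = 2 \<or> m = -1 \<and> n = 1 \<or>
    m = -2 \<and> n = -1 \<or> m = -1 \<and> n = -2 \<or> m = 1 \<and> n = -1"
    using s3 d by (elim insertE emptyE; hypsubst; simp)
  then show ?thesis using * by auto
qed

lemma nbrsI:
  assumes "al e = 2 \<and> be e = 1 \<or> al e = 1 \<and> be e = 2 \<or> al e = -1 \<and> be e = 1 \<or>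
    al e = -2 \<and> be e = -1 \<or> al e = -1 \<and> be e = -2 \<or> al e = 1 \<and> be e = -1"
  shows "e \<in> nbrs"
  unfolding nbrs_def ideal_J_iff mem_Collect_eq sq_albe
proof
  show "\<exists>m n. al e = real_of_int m \<and> be e = real_of_int n \<and> 3 dvd m + n"
    by (rule exI[of _ "\<lfloor>al e\<rfloor>"], rule exI[of _ "\<lfloor>be e\<rfloor>"])
      (use assms in \<open>auto simp: floor_minus\<close>)
qed (use assms in \<open>auto simp: power2_eq_square\<close>)

lemma nbrs_ev_cases:
  assumes "e \<in> nbrs"
  shows "ev e = al \<or> ev e = be \<or> ev e = (\<lambda>z. be z - al z) \<or> ev e = (\<lambda>z. - al z) \<or> ev e = (\<lambda>z. - be z) \<or> ev e = (\<lambda>z. al z - be z)"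
  using nbrs_coords[OF assms] by (auto simp: ev_albe fun_eq_iff)

lemma ex_albe: "\<exists>z. al z = a \<and> be z = b"
  by (rule exI[of _ "Complex (a - b/2) (sqrt 3 / 2 * b)"]) (simp add: al_def be_def)

lemma ev_simps [simp]:
  "ev e (z + w) = ev e z + ev e w" "ev e (z - w) = ev e z - ev e w" "ev e (- z) = - ev e z"
  "ev (- e) z = - ev e z" "ev e 0 = 0"
  by (simp_all add: ev_def algebra_simps)

lemma ev_self: "e \<in> nbrs \<Longrightarrow> ev e e = 2"
  by (simp add: ev_def nbrs_def cmod_power2) (simp add: power2_eq_square)

lemma nbrs_J: "e \<in> nbrs \<Longrightarrow> e \<in> ideal_J" by (simp add: nbrs_def)

lemma nbrs_uminus: "e \<in> nbrs \<Longrightarrow> - e \<in> nbrs"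
  by (simp add: nbrs_def ideal_J_uminus)

lemma zeta_norm [simp]: "cmod zeta = 1"
proof -
  have "sq zeta = 1" by (simp add: sq_albe)
  then show ?thesis by (simp add: power2_eq_1_iff) (use norm_ge_zero[of zeta] in linarith)
qed

lemma nbrs_zeta: "e \<in> nbrs \<Longrightarrow> zeta * e \<in> nbrs"
  by (simp add: nbrs_def ideal_J_zeta norm_mult)

lemma sq_diff_nbr:
  assumes "e \<in> nbrs" shows "sq (z - e) = sq z - 3 * ev e z + 3"
proof -
  have "sq e = 3" using assms by (simp add: nbrs_def)
  then show ?thesis unfolding cmod_power2 ev_def by (simp add: power2_eq_square algebra_simps)
qed

lemma nbrs_ev_le:
  assumes "e \<in> nbrs" "e' \<in> nbrs" "e' \<noteq> e"
  shows "ev e e' \<le> 1"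
proof -
  have "\<not> (al e = al e' \<and> be e = be e')" using assms(3) albe_eqI by metis
  then show ?thesis using nbrs_coords[OF assms(1)] nbrs_coords[OF assms(2)] by (auto simp: ev_albe)
qed

lemma ev_cs: assumes "e \<in> nbrs" shows "\<bar>ev e z\<bar> \<le> 2 / 3 * sqrt 3 * cmod z"
proof -
  have "sqrt (sq e) = sqrt 3" using assms by (simp only: nbrs_def mem_Collect_eq)
  then have "cmod e = sqrt 3" by simp
  then have "\<bar>Re (cnj e * z)\<bar> \<le> sqrt 3 * cmod z"
    using abs_Re_le_cmod[of "cnj e * z"] by (simp add: norm_mult)
  then show ?thesis by (simp add: ev_def)
qed

section \<open>The open hexagon and its rotations\<close>

definition hexagon :: "complex set" where "hexagon = {z. \<forall>e\<in>nbrs. ev e z < 1}"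

text \<open>Trades a quantifier over neighbours for six explicit linear forms; \<open>P\<close> is
  applied to \<open>ev e\<close> because the conditions in question see \<open>e\<close> only
  through this form.\<close>

lemma all_nbrs_iff:
  assumes "\<And>e. e \<in> nbrs \<Longrightarrow> Q e \<longleftrightarrow> P (ev e)"
  shows "(\<forall>e\<in>nbrs. Q e) \<longleftrightarrow> P al \<and> P be \<and> P (\<lambda>z. be z - al z) \<and> P (\<lambda>z. - al z) \<and> P (\<lambda>z. - be z) \<and> P (\<lambda>z. al z - be z)"
proof
  assume *: "\<forall>e\<in>nbrs. Q e"
  have P: "P g" if "al e = 2 \<and> be e = 1 \<or> al e = 1 \<and> be e = 2 \<or> al e = -1 \<and> be e = 1 \<or>
    al e = -2 \<and> be e = -1 \<or> al e = -1 \<and> be e = -2 \<or> al e = 1 \<and> be e = -1" "ev e = g" for g e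
    using * nbrsI[OF that(1)] assms[of e] that(2) by auto
  obtain e1 where e1: "al e1 = 2 \<and> be e1 = 1" using ex_albe by metis
  obtain e2 where e2: "al e2 = 1 \<and> be e2 = 2" using ex_albe by metis
  obtain e3 where e3: "al e3 = -1 \<and> be e3 = 1" using ex_albe by metis
  obtain e4 where e4: "al e4 = -2 \<and> be e4 = -1" using ex_albe by metis
  obtain e5 where e5: "al e5 = -1 \<and> be e5 = -2" using ex_albe by metis
  obtain e6 where e6: "al e6 = 1 \<and> be e6 = -1" using ex_albe by metis
  show "P al \<and> P be \<and> P (\<lambda>z. be z - al z) \<and> P (\<lambda>z. - al z) \<and> P (\<lambda>z. - be z) \<and> P (\<lambda>z. al z - be z)"
    using P[of e1] P[of e2] P[of e3] P[of e4] P[of e5] P[of e6] e1 e2 e3 e4 e5 e6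
    by (simp add: ev_albe fun_eq_iff)
next
  assume *: "P al \<and> P be \<and> P (\<lambda>z. be z - al z) \<and> P (\<lambda>z. - al z) \<and> P (\<lambda>z. - be z) \<and> P (\<lambda>z. al z - be z)"
  show "\<forall>e\<in>nbrs. Q e"
  proof
    fix e assume e: "e \<in> nbrs"
    show "Q e" unfolding assms[OF e] using nbrs_ev_cases[OF e] * by (elim disjE) simp_all
  qed
qed

lemma ex_nbrs_iff:
  "(\<exists>e\<in>nbrs. P (ev e)) \<longleftrightarrow> P al \<or> P be \<or> P (\<lambda>z. be z - al z) \<or> P (\<lambda>z. - al z) \<or> P (\<lambda>z. - be z) \<or> P (\<lambda>z. al z - be z)"
  using all_nbrs_iff[of "\<lambda>e. \<not> P (ev e)" "\<lambda>g. \<not> P g"] by blast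

lemma hexagon_iff: "z \<in> hexagon \<longleftrightarrow> \<bar>al z\<bar> < 1 \<and> \<bar>be z\<bar> < 1 \<and> \<bar>al z - be z\<bar> < 1"
  unfolding hexagon_def mem_Collect_eq
  by (subst all_nbrs_iff[of _ "\<lambda>g. g z < 1"]) auto

text \<open>The norm form is one of the three squares plus a nonpositive product:
  \<open>a * b\<close> if the signs differ, otherwise \<open>a * (a - b)\<close> or
  \<open>b * (b - a)\<close>, depending on which modulus is smaller.\<close>

lemma sq_le_max:
  fixes a b :: real
  assumes "\<bar>a\<bar> \<le> M" "\<bar>b\<bar> \<le> M" "\<bar>a - b\<bar> \<le> M"
  shows "a\<^sup>2 - a * b + b\<^sup>2 \<le> M\<^sup>2"
proof -
  have sq: "x\<^sup>2 \<le> M\<^sup>2" if "\<bar>x\<bar> \<le> M" for x :: real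
    using that abs_le_square_iff[of x M] by simp
  have "a * b \<le> 0 \<longrightarrow> a\<^sup>2 - a * b + b\<^sup>2 = (a - b)\<^sup>2 + a * b" by (simp add: power2_eq_square algebra_simps)
  moreover have "a\<^sup>2 - a * b + b\<^sup>2 = a\<^sup>2 + b * (b - a)" "a\<^sup>2 - a * b + b\<^sup>2 = b\<^sup>2 + a * (a - b)"
    by (simp_all add: power2_eq_square algebra_simps)
  moreover have "a * b \<ge> 0 \<longrightarrow> a * (a - b) \<le> 0 \<or> b * (b - a) \<le> 0"
    by (auto simp: zero_le_mult_iff mult_le_0_iff)
  ultimately show ?thesis using sq[OF assms(1)] sq[OF assms(2)] sq[OF assms(3)] by linarith
qed

text \<open>The six discs about \<open>e / 3\<close> whose boundary passes through \<open>0\<close>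
  cover the punctured hexagon: if \<open>M < 1\<close> is the largest value of
  \<open>ev e z\<close>, then \<open>sq z \<le> M^2 < M\<close>. Since \<open>costair\<close>
  excludes these discs, it keeps a nonzero \<open>u\<close> out of the hexagon.\<close>

lemma hexagon_ex_disc:
  assumes "z \<in> hexagon" "z \<noteq> 0"
  shows "\<exists>e\<in>nbrs. sq z < ev e z"
proof -
  define M where "M = max \<bar>al z\<bar> (max \<bar>be z\<bar> \<bar>al z - be z\<bar>)"
  have M: "\<bar>al z\<bar> \<le> M" "\<bar>be z\<bar> \<le> M" "\<bar>al z - be z\<bar> \<le> M" "M < 1" "M = \<bar>al z\<bar> \<or> M = \<bar>be z\<bar> \<or> M = \<bar>al z - be z\<bar>"
    using assms(1) unfolding M_def hexagon_iff by (auto simp: max_def)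
  have "M \<noteq> 0" using M assms(2) albe_eqI[of z 0] by auto
  then have "0 < M" using M by linarith
  have "sq z \<le> M\<^sup>2" unfolding sq_albe by (rule sq_le_max) (use M in auto)
  also have "\<dots> < M" using \<open>0 < M\<close> \<open>M < 1\<close> by (simp add: power2_eq_square)
  finally have "sq z < M" .
  then show ?thesis using M(5) by (subst ex_nbrs_iff[of "\<lambda>g. sq z < g z"]) auto
qed

lemma albe_eq_iff: "z = w \<longleftrightarrow> al z = al w \<and> be z = be w"
  using albe_eqI by blast

lemma nbrs_rotate:
  assumes "e \<in> nbrs"
  obtains k where "e = zeta ^ k * eta"
proof -
  have c: "al (zeta ^ 0 * eta) = 2 \<and> be (zeta ^ 0 * eta) = 1" "al (zeta ^ 1 * eta) = 1 \<and> be (zeta ^ 1 * eta) = 2"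
    "al (zeta ^ 2 * eta) = -1 \<and> be (zeta ^ 2 * eta) = 1" "al (zeta ^ 3 * eta) = -2 \<and> be (zeta ^ 3 * eta) = -1"
    "al (zeta ^ 4 * eta) = -1 \<and> be (zeta ^ 4 * eta) = -2" "al (zeta ^ 5 * eta) = 1 \<and> be (zeta ^ 5 * eta) = -1"
    by (simp_all add: numeral_eq_Suc mult.assoc)
  have "e = zeta ^ 0 * eta \<or> e = zeta ^ 1 * eta \<or> e = zeta ^ 2 * eta \<or> e = zeta ^ 3 * eta \<or> e = zeta ^ 4 * eta \<or> e = zeta ^ 5 * eta"
    using nbrs_coords[OF assms] unfolding albe_eq_iff by (simp only: c)
  then show ?thesis using that by blast
qed

lemma ev_zeta [simp]: "ev (zeta * e) (zeta * z) = ev e z"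
  by (simp add: ev_albe algebra_simps)

lemma ev_zeta_power [simp]: "ev (zeta ^ k * e) (zeta ^ k * z) = ev e z"
  by (induction k) (simp_all add: mult.assoc)

lemma cmod_zeta_power [simp]: "cmod (zeta ^ k * z) = cmod z"
  by (simp add: norm_mult norm_power)

lemma hexagon_zeta [simp]: "zeta * z \<in> hexagon \<longleftrightarrow> z \<in> hexagon"
  by (auto simp: hexagon_iff)

lemma hexagon_zeta_power [simp]: "zeta ^ k * z \<in> hexagon \<longleftrightarrow> z \<in> hexagon"
  by (induction k) (simp_all add: mult.assoc)

lemma zeta_nz [simp]: "zeta \<noteq> 0" using zeta_norm by force

lemma zeta_power_6: "zeta ^ 6 = 1"
  by (rule albe_eqI) (simp_all add: numeral_eq_Suc)

lemma zeta_power_5: "zeta ^ 5 * (zeta * z) = z"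
  using zeta_power_6 by (simp add: numeral_eq_Suc mult.assoc)

lemma ideal_J_zeta_power: "zeta ^ k * a \<in> ideal_J \<longleftrightarrow> a \<in> ideal_J"
proof -
  have *: "zeta * a \<in> ideal_J \<longleftrightarrow> a \<in> ideal_J" for a
  proof
    assume *: "zeta * a \<in> ideal_J"
    have "zeta ^ j * b \<in> ideal_J" if "b \<in> ideal_J" for b j
      using that by (induction j) (simp_all add: mult.assoc ideal_J_zeta)
    from this[OF *, of 5] show "a \<in> ideal_J" by (simp add: zeta_power_5)
  qed (rule ideal_J_zeta)
  show ?thesis by (induction k) (simp_all add: mult.assoc *)
qed

section \<open>Relative position of the discs, the bisectors and the translated hexagons\<close>

lemma disc_range:
  fixes a b :: real
  assumes "a\<^sup>2 - a * b + b\<^sup>2 < a"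
  shows "0 < a" "a < 4/3" "- 1/3 < b" "b < 1" "- 1/3 < a - b" "a - b < 1"
proof -
  define q where "q = a\<^sup>2 - a * b + b\<^sup>2"
  \<comment> \<open>Each square vanishes where the corresponding form \<open>a\<close>,
    \<open>b\<close> or \<open>a - b\<close> is extremal, so the resulting bounds are the exact
    extents of the disc.\<close>
  have "0 \<le> (a - 2 * b)\<^sup>2" "0 \<le> (2 * a - b - 1)\<^sup>2" "0 \<le> (a + b - 1)\<^sup>2" by simp_all
  then have *: "3 * (a * a) \<le> 4 * q" "3 * (b * b) - 2 * b - 1 \<le> 4 * (q - a)"
     "3 * ((a - b) * (a - b)) - 2 * (a - b) - 1 \<le> 4 * (q - a)"
    by (simp_all add: q_def power2_eq_square algebra_simps)
  have qa: "q < a" using assms by (simp add: q_def)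
  have sq0: "0 \<le> a * a" by simp
  show a: "0 < a" using *(1) qa sq0 by linarith
  have "a * (3 * a - 4) < 0" using *(1) qa by (simp add: algebra_simps)
  with a show "a < 4/3" by (simp add: mult_less_0_iff)
  have "(3 * b + 1) * (b - 1) < 0" using *(2) qa by (simp add: algebra_simps)
  then show "- 1/3 < b" "b < 1" by (auto simp: mult_less_0_iff)
  have "(3 * (a - b) + 1) * ((a - b) - 1) < 0" using *(3) qa by (simp add: algebra_simps)
  then show "- 1/3 < a - b" "a - b < 1" by (auto simp: mult_less_0_iff)
qed

text \<open>After a rotation to \<open>e = eta\<close>, the extents of the disc and of the hexagon
  confine the coordinates of \<open>b\<close> to a small box, in which divisibility of
  \<open>m + n\<close> by 3 leaves only those of \<open>0\<close> and \<open>eta\<close>.\<close>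

lemma small_disc_hexagon:
  assumes "e \<in> nbrs" "b \<in> ideal_J" "u - b \<in> hexagon" "sq u < ev e u"
  shows "b = 0 \<or> b = e"
proof -
  obtain k where k: "e = zeta ^ k * eta" using nbrs_rotate assms(1) by blast
  define u' b' where "u' = u / zeta ^ k" and "b' = b / zeta ^ k"
  have ub: "u = zeta ^ k * u'" "b = zeta ^ k * b'" by (simp_all add: u'_def b'_def)
  have b': "b' \<in> ideal_J" using assms(2) by (simp add: ub ideal_J_zeta_power)
  have h: "u' - b' \<in> hexagon" using assms(3) by (simp add: ub flip: right_diff_distrib)
  have "ev eta u' = al u'" by (simp add: ev_albe)
  then have s: "sq u' < al u'" using assms(4) unfolding k ub by (simp only: ev_zeta_power cmod_zeta_power)
  obtain m n :: int where mn: "al b' = m" "be b' = n" "3 dvd m + n" using b' by (auto simp: ideal_J_iff)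
  note r = disc_range[OF s[unfolded sq_albe]]
  have "real_of_int m < 3" "real_of_int m > -1" "real_of_int n < 2" "real_of_int n > -2"
    "real_of_int (m - n) < 2" "real_of_int (m - n) > -2"
    using h r by (auto simp: hexagon_iff mn abs_less_iff)
  then have "m < 3" "m > -1" "n < 2" "n > -2" "m - n < 2" "m - n > -2" by linarith+
  then have "m = 0 \<and> n = 0 \<or> m = 2 \<and> n = 1" using mn(3) by presburger
  then have "b' = 0 \<or> b' = eta" using mn by (auto intro!: albe_eqI)
  then show ?thesis by (auto simp: ub k)
qed

text \<open>The point reflection taking \<open>u\<close> to \<open>e - u\<close> exchanges the discs
  about \<open>e / 3\<close> and \<open>2 * e / 3\<close> as well as the hexagons about
  \<open>0\<close> and \<open>e\<close>.\<close>

lemma far_disc_hexagon: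
  assumes e: "e \<in> nbrs" and "b \<in> ideal_J" "u - b \<in> hexagon" "sq u + 1 < 2 * ev e u"
  shows "b = 0 \<or> b = e"
proof -
  have "e - b = 0 \<or> e - b = e"
  proof (rule small_disc_hexagon[OF e])
    show "e - b \<in> ideal_J" using assms by (simp add: ideal_J_diff nbrs_J)
    have "- (u - b) \<in> hexagon" using assms(3) by (simp only: hexagon_iff al_simps be_simps) linarith
    then show "(e - u) - (e - b) \<in> hexagon" by simp
    have "sq (e - u) = sq (u - e)" by (simp add: norm_minus_commute)
    then show "sq (e - u) < ev e (e - u)" using assms(4) by (simp add: sq_diff_nbr e ev_self)
  qed
  then show ?thesis by auto
qed

text \<open>The hypothesis places \<open>v\<close> in the unit disc about \<open>e\<close>, the
  negated conclusion in the disc of radius 1/2 about \<open>e' / 2\<close>. Because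
  \<open>ev e e' \<le> 1\<close>, the centres are at least 3/2 apart, the sum of the radii.\<close>

lemma lens_disjoint:
  assumes "e \<in> nbrs" "e' \<in> nbrs" "e' \<noteq> e" "sq v + 2 < 3 * ev e v"
  shows "3 * ev e' v \<le> 2 * sq v + 1"
proof (rule ccontr)
  assume "\<not> 3 * ev e' v \<le> 2 * sq v + 1"
  then have *: "2 * sq v + 1 < 3 * ev e' v" by simp
  have "sq (v - e) < 1" using assms(1,4) by (simp add: sq_diff_nbr)
  then have 1: "cmod (v - e) < 1" by (simp add: power_less_one_iff)
  have s3: "sq e' = 3" "sq e = 3" using assms by (auto simp: nbrs_def)
  have "sq (2 * v - e') = 4 * sq v - 6 * ev e' v + 3"
    using s3 unfolding cmod_power2 ev_def by (simp add: power2_eq_square algebra_simps)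
  also have "\<dots> < 1" using * by simp
  finally have 2: "cmod (2 * v - e') < 1" by (simp add: power_less_one_iff)
  have "ev e e' \<le> 1" using nbrs_ev_le assms by blast
  then have "Re (cnj e * e') \<le> 3 / 2" by (simp add: ev_def)
  moreover have "sq (2 * e - e') = 4 * sq e - 4 * Re (cnj e * e') + sq e'"
    unfolding cmod_power2 by (simp add: power2_eq_square algebra_simps)
  ultimately have "sq (2 * e - e') \<ge> 3\<^sup>2" using s3 by simp
  then have "cmod (2 * e - e') \<ge> 3" by (metis norm_ge_zero power2_le_imp_le)
  moreover have "cmod (2 * e - e') \<le> cmod (2 * v - e') + 2 * cmod (v - e)"
  proof -
    have "2 * e - e' = (2 * v - e') - 2 * (v - e)" by (simp add: algebra_simps)
    then have "cmod (2 * e - e') \<le> cmod (2 * v - e') + cmod (2 * (v - e))" by (metis norm_triangle_ineq4)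
    then show ?thesis by (simp only: norm_mult norm_numeral)
  qed
  ultimately show False using 1 2 by linarith
qed

text \<open>In units of \<open>ev e\<close> the disc about \<open>e' / 3\<close> extends by 2/3 on
  either side of its centre, and the centre has value at least -1/3 unless
  \<open>e' = - e\<close>.\<close>

lemma disc_side:
  assumes "e \<in> nbrs" "e' \<in> nbrs" "e' \<noteq> - e" "sq x < ev e' x"
  shows "- 1 < ev e x"
proof -
  have s3: "sq e' = 3" using assms by (auto simp: nbrs_def)
  have "sq (3 * x - e') = 9 * sq x - 9 * ev e' x + 3"
    using s3 unfolding cmod_power2 ev_def by (simp add: power2_eq_square algebra_simps)
  also have "\<dots> < (sqrt 3)\<^sup>2" using assms(4) by simp
  finally have "cmod (3 * x - e') < sqrt 3" by (rule power_less_imp_less_base) simp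
  then have "2 / 3 * sqrt 3 * cmod (3 * x - e') < 2 / 3 * sqrt 3 * sqrt 3" by (intro mult_strict_left_mono) simp_all
  then have "\<bar>ev e (3 * x - e')\<bar> < 2" using ev_cs[OF assms(1), of "3 * x - e'"] by simp
  moreover have "ev e (3 * x - e') = 3 * ev e x - ev e e'" by (simp add: ev_albe) (simp add: field_simps)
  moreover have "ev (- e) e' \<le> 1" using nbrs_ev_le assms nbrs_uminus by blast
  ultimately show ?thesis by auto
qed

lemma unit_disc_overlap:
  assumes "cmod v < 1" "cmod (v - a) < 1" "a \<in> ideal_J" "a \<noteq> 0"
  shows "a \<in> nbrs"
proof -
  have "cmod a < 2" using norm_triangle_ineq4[of v "v - a"] assms by simp
  then have "sq a < 2\<^sup>2" by (intro power_strict_mono) auto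
  then have "sq a < 6" by simp
  then show ?thesis using ideal_J_small assms by auto
qed

section \<open>The two descriptions of the domain\<close>

text \<open>All circles and lines bounding the regions of the problem have integer coefficients in these
  coordinates. The countable union of all such curves is null and stable under inversion, translation by the ideal
  and rotation by \<^term>\<open>zeta\<close>, so off it no boundary case ever occurs.\<close>

definition bad :: "complex set" where
  "bad = {z. \<exists>A m n C :: int. (A \<noteq> 0 \<or> m \<noteq> 0 \<or> n \<noteq> 0 \<or> C \<noteq> 0) \<and>
     of_int A * sq z + of_int m * al z + of_int n * be z + of_int C = 0}"

lemma badI:
  fixes A m n C :: int
  assumes "A \<noteq> 0 \<or> m \<noteq> 0 \<or> n \<noteq> 0 \<or> C \<noteq> 0" "of_int A * sq z + of_int m * al z + of_int n * be z + of_int C = 0"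
  shows "z \<in> bad"
  using assms unfolding bad_def by blast

lemma bad_inverse: "1 / z \<in> bad \<longleftrightarrow> z \<in> bad"
proof -
  have *: "1 / z \<in> bad" if z: "z \<in> bad" for z
  proof (cases "z = 0")
    case False
    from z obtain A m n C :: int where nz: "A \<noteq> 0 \<or> m \<noteq> 0 \<or> n \<noteq> 0 \<or> C \<noteq> 0"
      and eq: "of_int A * sq z + of_int m * al z + of_int n * be z + of_int C = 0" by (auto simp: bad_def)
    have inv: "1 / z = cnj z / of_real (sq z)" using False complex_div_cnj[of 1 z] by simp
    have s: "sq (1 / z) = 1 / sq z" by (simp add: norm_divide power_divide)
    have pos: "sq z > 0" using False by simp
    \<comment> \<open>Inversion exchanges the coefficient of \<open>sq z\<close> with the constant
      term; the conjugation contained in \<open>1 / z\<close> replaces the coefficient of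
      \<open>be\<close> by \<open>- m - n\<close>.\<close>
    have "of_int C * sq (1 / z) + of_int m * al (1 / z) + of_int (- m - n) * be (1 / z) + of_int A =
      (of_int A * sq z + of_int m * al z + of_int n * be z + of_int C) / sq z"
      unfolding s unfolding inv al_simps be_simps albe_cnj using pos by (simp add: field_simps)
    then show ?thesis using eq nz by (intro badI[of C m "- m - n" A]) auto
  qed (use z in simp)
  show ?thesis using *[of z] *[of "1 / z"] by auto
qed

lemma bad_ideal_J: assumes "b \<in> ideal_J" shows "z - b \<in> bad \<longleftrightarrow> z \<in> bad"
proof -
  have *: "z - b \<in> bad" if z: "z \<in> bad" and b: "b \<in> ideal_J" for z b
  proof -
    from z obtain A m n C :: int where nz: "A \<noteq> 0 \<or> m \<noteq> 0 \<or> n \<noteq> 0 \<or> C \<noteq> 0"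
      and eq: "of_int A * sq z + of_int m * al z + of_int n * be z + of_int C = 0" by (auto simp: bad_def)
    from b obtain i j :: int where ij: "al b = of_int i" "be b = of_int j" by (auto simp: ideal_J_iff)
    define m' n' C' where "m' = m + A * (2 * i - j)" and "n' = n + A * (2 * j - i)"
      and "C' = C + A * (i * i - i * j + j * j) + m * i + n * j"
    have "of_int A * sq (z - b) + of_int m' * al (z - b) + of_int n' * be (z - b) + of_int C' = 0"
      unfolding eq[symmetric] sq_albe al_simps be_simps ij m'_def n'_def C'_def
      by (simp add: power2_eq_square algebra_simps)
    moreover have "A \<noteq> 0 \<or> m' \<noteq> 0 \<or> n' \<noteq> 0 \<or> C' \<noteq> 0" using nz by (auto simp: m'_def n'_def C'_def)
    ultimately show ?thesis by (intro badI)
  qed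
  show ?thesis using *[of z b] *[of "z - b" "- b"] assms ideal_J_uminus by auto
qed

lemma bad_zeta: assumes "z \<in> bad" shows "zeta * z \<in> bad"
proof -
  from assms obtain A m n C :: int where nz: "A \<noteq> 0 \<or> m \<noteq> 0 \<or> n \<noteq> 0 \<or> C \<noteq> 0"
    and eq: "of_int A * sq z + of_int m * al z + of_int n * be z + of_int C = 0" by (auto simp: bad_def)
  have "of_int A * sq (zeta * z) + of_int (- n) * al (zeta * z) + of_int (m + n) * be (zeta * z) + of_int C = 0"
    unfolding eq[symmetric] by (simp add: norm_mult algebra_simps)
  then show ?thesis by (rule badI[rotated]) (use nz in auto)
qed

lemma bad_zeta_power: "zeta ^ k * z \<in> bad \<longleftrightarrow> z \<in> bad"
proof -
  have *: "zeta ^ k * z \<in> bad" if "z \<in> bad" for z k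
    using that by (induction k) (simp_all add: mult.assoc bad_zeta)
  have "z = zeta ^ (5 * k) * (zeta ^ k * z)"
    using zeta_power_6 by (simp add: mult.assoc[symmetric] power_add[symmetric]) (simp add: power_mult)
  then show ?thesis using * by metis
qed

lemma good_neq:
  assumes "z \<notin> bad"
  shows "of_int A * sq z + of_int m * al z + of_int n * be z + of_int C = 0 \<longleftrightarrow> A = 0 \<and> m = 0 \<and> n = 0 \<and> C = 0"
  using assms badI[of A m n C z] by auto

text \<open>These are the boundary equations of all clauses of \<open>stair\<close> and
  \<open>costair\<close> below; at good points the strict and the non-strict form of a clause
  agree.\<close>

lemma good_ev:
  assumes z: "z \<notin> bad" and e: "e \<in> nbrs"
  shows "sq z \<noteq> 1" "z \<noteq> 0" "ev e z \<noteq> 1" "sq z \<noteq> ev e z" "sq z + 1 \<noteq> 2 * ev e z"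
    "sq z + 2 \<noteq> 3 * ev e z" "2 * sq z + 1 \<noteq> 3 * ev e z"
proof -
  have "\<exists>m n::int. (m \<noteq> 0 \<or> n \<noteq> 0) \<and> ev e z = of_int m * al z + of_int n * be z"
    using nbrs_ev_cases[OF e]
  proof (elim disjE)
    assume *: "ev e = al" show ?thesis by (rule exI[of _ 1], rule exI[of _ 0]) (simp add: *)
  next
    assume *: "ev e = be" show ?thesis by (rule exI[of _ 0], rule exI[of _ 1]) (simp add: *)
  next
    assume *: "ev e = (\<lambda>z. be z - al z)" show ?thesis by (rule exI[of _ "-1"], rule exI[of _ 1]) (simp add: *)
  next
    assume *: "ev e = (\<lambda>z. - al z)" show ?thesis by (rule exI[of _ "-1"], rule exI[of _ 0]) (simp add: *)
  next
    assume *: "ev e = (\<lambda>z. - be z)" show ?thesis by (rule exI[of _ 0], rule exI[of _ "-1"]) (simp add: *)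
  next
    assume *: "ev e = (\<lambda>z. al z - be z)" show ?thesis by (rule exI[of _ "1"], rule exI[of _ "-1"]) (simp add: *)
  qed
  then obtain m n :: int where mn: "m \<noteq> 0 \<or> n \<noteq> 0" "ev e z = of_int m * al z + of_int n * be z" by blast
  show "sq z \<noteq> 1" using good_neq[OF z, of 1 0 0 "-1"] by simp
  show "z \<noteq> 0" using good_neq[OF z, of 1 0 0 "0"] by auto
  show "ev e z \<noteq> 1" using good_neq[OF z, of 0 m n "-1"] mn by simp
  show "sq z \<noteq> ev e z" using good_neq[OF z, of 1 "-m" "-n" 0] mn by simp
  show "sq z + 1 \<noteq> 2 * ev e z" using good_neq[OF z, of 1 "-2*m" "-2*n" 1] mn by (simp add: algebra_simps)
  show "sq z + 2 \<noteq> 3 * ev e z" using good_neq[OF z, of 1 "-3*m" "-3*n" 2] mn by (simp add: algebra_simps)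
  show "2 * sq z + 1 \<noteq> 3 * ev e z" using good_neq[OF z, of 2 "-3*m" "-3*n" 1] mn by (simp add: algebra_simps)
qed

text \<open>The circles with \<open>sq w = 1\<close>, \<open>2 * sq w + 1 = 3 * ev e w\<close> and \<open>sq w + 2 = 3 * ev e w\<close> pass through
  two common vertices of the hexagon, and the cell of \<open>z\<close> decides which of their discs are removed
  from the fibre. Off \<^term>\<open>bad\<close>, \<open>stair\<close> is membership in \<^term>\<open>hat_U\<close>
  and \<open>costair\<close> membership in its image under \<open>(z, w) \<mapsto> (1 / z, 1 / w)\<close>.\<close>

definition stair :: "complex \<Rightarrow> complex \<Rightarrow> bool" where
  "stair z w \<longleftrightarrow> 1 < sq w \<and> (\<forall>e\<in>nbrs. ev e z < 1 \<and> (sq z < ev e z \<longrightarrow> 3 * ev e w < 2 * sq w + 1)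
     \<and> (sq z + 1 < 2 * ev e z \<longrightarrow> 3 * ev e w < sq w + 2))"

definition costair :: "complex \<Rightarrow> complex \<Rightarrow> bool" where
  "costair u v \<longleftrightarrow> sq v < 1 \<and> (\<forall>e\<in>nbrs. ev e u < sq u \<and> (1 < ev e u \<longrightarrow> 3 * ev e v < sq v + 2)
     \<and> (sq u + 1 < 2 * ev e u \<longrightarrow> 3 * ev e v < 2 * sq v + 1))"

lemma nbrs_cnj: "cnj e \<in> nbrs \<longleftrightarrow> e \<in> nbrs"
proof -
  have "cnj e \<in> nbrs" if "e \<in> nbrs" for e
    by (rule nbrsI) (use nbrs_coords[OF that] in \<open>elim disjE; simp\<close>)
  from this[of e] this[of "cnj e"] show ?thesis by auto
qed

lemma clear_denominator:
  fixes a s :: real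
  assumes "s > 0"
  shows "a / s < 1 \<longleftrightarrow> a < s" "1 / s < a / s \<longleftrightarrow> 1 < a" "3 * (a / s) < 2 * (1 / s) + 1 \<longleftrightarrow> 3 * a < s + 2"
    "1 / s + 1 < 2 * (a / s) \<longleftrightarrow> s + 1 < 2 * a" "3 * (a / s) < 1 / s + 2 \<longleftrightarrow> 3 * a < 2 * s + 1" "1 < 1 / s \<longleftrightarrow> s < 1"
proof -
  have "1 / s + 1 = (s + 1) / s" "2 * (1 / s) + 1 = (s + 2) / s" "1 / s + 2 = (2 * s + 1) / s"
    using assms by (simp_all add: field_simps)
  moreover have "2 * (a / s) = 2 * a / s" "3 * (a / s) = 3 * a / s" by simp_all
  ultimately show "a / s < 1 \<longleftrightarrow> a < s" "1 / s < a / s \<longleftrightarrow> 1 < a" "3 * (a / s) < 2 * (1 / s) + 1 \<longleftrightarrow> 3 * a < s + 2"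
    "1 / s + 1 < 2 * (a / s) \<longleftrightarrow> s + 1 < 2 * a" "3 * (a / s) < 1 / s + 2 \<longleftrightarrow> 3 * a < 2 * s + 1" "1 < 1 / s \<longleftrightarrow> s < 1"
    using assms by (simp_all only: divide_less_cancel) (simp_all)
qed

text \<open>Since \<open>ev e (1 / u) = ev (cnj e) u / sq u\<close>, clearing denominators exchanges
  \<open>sq u\<close> with 1 in every clause: the hexagon condition turns into avoidance of the
  small discs, the two fibre conditions are swapped, and the clause with \<open>sq u + 1\<close> is
  self-dual. Conjugation permutes \<open>nbrs\<close>.\<close>

lemma stair_inverse:
  assumes "u \<noteq> 0" "v \<noteq> 0"
  shows "stair (1 / u) (1 / v) \<longleftrightarrow> costair u v"
proof -
  have inv: "sq (1 / z) = 1 / sq z" "ev e (1 / z) = ev (cnj e) z / sq z" "sq z > 0" if "z \<noteq> 0" for z e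
  proof -
    define r where "r = sq z"
    have "1 / z = cnj z / of_real r" using that complex_div_cnj[of 1 z] by (simp add: r_def)
    then have "ev e (1 / z) = ev e (cnj z) / r"
      using that by (simp only: ev_albe al_simps be_simps) (simp add: r_def field_simps)
    also have "ev e (cnj z) = ev (cnj e) z" by (simp add: ev_def)
    finally show "ev e (1 / z) = ev (cnj e) z / sq z" by (simp add: r_def)
  qed (use that in \<open>simp_all add: norm_divide power_divide\<close>)
  have "(\<forall>e\<in>nbrs. P (cnj e)) \<longleftrightarrow> (\<forall>e\<in>nbrs. P e)" for P
  proof
    assume *: "\<forall>e\<in>nbrs. P (cnj e)"
    show "\<forall>e\<in>nbrs. P e"
    proof
      fix e assume "e \<in> nbrs"
      then show "P e" using *[rule_format, of "cnj e"] by (simp add: nbrs_cnj)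
    qed
  qed (simp add: nbrs_cnj)
  note cnj_iff = this[of "\<lambda>e. ev e u < sq u \<and> (1 < ev e u \<longrightarrow> 3 * ev e v < sq v + 2)
     \<and> (sq u + 1 < 2 * ev e u \<longrightarrow> 3 * ev e v < 2 * sq v + 1)"]
  note * = cnj_iff clear_denominator[OF inv(3)[OF assms(1)]] clear_denominator[OF inv(3)[OF assms(2)]]
  show ?thesis
    unfolding stair_def costair_def inv(1,2)[OF assms(1)] inv(1,2)[OF assms(2)] * by simp
qed

text \<open>A violated clause of \<open>stair\<close> puts \<open>v\<close> into a second unit disc,
  about \<open>b\<close> or about \<open>b + e\<close>, so that centre is \<open>0\<close> or a
  neighbour of \<open>0\<close>. If it is \<open>0\<close>, the violation translates into one of a
  clause of \<open>costair\<close>; if it is a neighbour, either \<open>u\<close> is on the wrong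
  side of a bisector or two disjoint discs share a point.\<close>

lemma costair_imp_stair:
  assumes c: "costair u v" and b: "b \<in> ideal_J" and h: "u - b \<in> hexagon"
    and good: "u \<notin> bad" "v \<notin> bad"
  shows "stair (u - b) (v - b)"
proof -
  have gb: "u - b \<notin> bad" "v - b \<notin> bad" using good bad_ideal_J[OF b] by auto
  have v1: "sq v < 1" and c1: "\<And>e. e \<in> nbrs \<Longrightarrow> ev e u < sq u"
    and c2: "\<And>e. e \<in> nbrs \<Longrightarrow> 1 < ev e u \<Longrightarrow> 3 * ev e v < sq v + 2"
    and c3: "\<And>e. e \<in> nbrs \<Longrightarrow> sq u + 1 < 2 * ev e u \<Longrightarrow> 3 * ev e v < 2 * sq v + 1"
    using c by (auto simp: costair_def)
  have v1': "cmod v < 1" using v1 by (simp add: power_less_one_iff)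
  have h1: "ev e (u - b) < 1" if "e \<in> nbrs" for e using h that by (simp add: hexagon_def)
  have eta: "eta \<in> nbrs" by (rule nbrsI) simp
  have u0: "u \<noteq> 0" using good_ev(2)[OF good(1) eta] .
  \<comment> \<open>If \<open>b = 0\<close>, then \<open>u\<close> itself lies in the hexagon, hence
    in a small disc forbidden by \<open>costair\<close>.\<close>
  have b0: "b \<noteq> 0" using hexagon_ex_disc[of u] h u0 c1 by force
  have lens_side: "ev e u < 1" if e: "e \<in> nbrs" and "cmod (v - e) < 1" for e
  proof -
    have "sq (v - e) < 1" using that(2) by (simp add: power_less_one_iff)
    then have "sq v + 2 < 3 * ev e v" by (simp add: sq_diff_nbr e)
    then have "\<not> 1 < ev e u" using c2[OF e] by linarith
    then show ?thesis using good_ev(3)[OF good(1) e] by linarith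
  qed
  have w1: "1 < sq (v - b)"
  proof (rule ccontr)
    assume "\<not> 1 < sq (v - b)"
    then have "sq (v - b) < 1" using good_ev(1)[OF gb(2) eta] by linarith
    then have lt: "cmod (v - b) < 1" by (simp add: power_less_one_iff)
    then have bn: "b \<in> nbrs" using unit_disc_overlap v1' b b0 by blast
    have "ev b u < 1" using lens_side[OF bn lt] .
    moreover have "ev (- b) (u - b) < 1" using h1 nbrs_uminus[OF bn] by blast
    ultimately show False using ev_self[OF bn] by simp
  qed
  have stair_e: "3 * ev e (v - b) < 2 * sq (v - b) + 1" if e: "e \<in> nbrs" and le: "sq (u - b) < ev e (u - b)" for e
  proof (rule ccontr)
    assume "\<not> 3 * ev e (v - b) < 2 * sq (v - b) + 1"
    then have A: "2 * sq (v - b) + 1 < 3 * ev e (v - b)" using good_ev(7)[OF gb(2) e] by linarith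
    have e': "- e \<in> nbrs" using nbrs_uminus[OF e] .
    show False
    proof (cases "b + e = 0")
      case True
      then have be: "b = - e" by (simp add: add_eq_0_iff2)
      have "sq u + 1 < 2 * ev b u" using le sq_diff_nbr[OF e', of u] ev_self[OF e] by (simp add: be)
      moreover have "2 * sq v + 1 < 3 * ev b v" using A sq_diff_nbr[OF e', of v] ev_self[OF e] by (simp add: be)
      ultimately show False using c3[of b] e' by (simp add: be)
    next
      case False
      \<comment> \<open>Coordinates centred at \<open>b + e\<close>: the unit disc about
        \<open>0\<close> becomes that about \<open>- (b + e)\<close>, and the disc about
        \<open>b + e / 2\<close> becomes that about \<open>- e / 2\<close>. These two are
        disjoint.\<close>
      define x where "x = v - (b + e)"
      have vb: "v - b = x - (- e)" by (simp add: x_def)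
      have "sq x = sq (v - b - e)" by (simp add: x_def algebra_simps)
      also have "\<dots> < 1" using A w1 by (simp add: sq_diff_nbr[OF e])
      finally have x1: "sq x < 1" .
      then have x1': "cmod (v - (b + e)) < 1" by (simp add: x_def power_less_one_iff)
      have bn: "b + e \<in> nbrs" using unit_disc_overlap[OF v1' x1'] False ideal_J_add[OF b nbrs_J[OF e]] by blast
      have bn': "- (b + e) \<in> nbrs" using nbrs_uminus[OF bn] .
      have "sq (x - (- (b + e))) < 1" using v1 by (simp add: x_def)
      then have lens: "sq x + 2 < 3 * ev (- (b + e)) x" by (subst (asm) sq_diff_nbr[OF bn']) simp
      have "- e \<noteq> - (b + e)" using b0 by simp
      from lens_disjoint[OF bn' e' this lens] have "3 * ev (- e) x \<le> 2 * sq x + 1" .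
      moreover have "2 * sq x + 1 < 3 * ev (- e) x"
        using A unfolding vb sq_diff_nbr[OF e'] using ev_self[OF e] by simp
      ultimately show False by simp
    qed
  qed
  have stair_e2: "3 * ev e (v - b) < sq (v - b) + 2" if e: "e \<in> nbrs" and le: "sq (u - b) + 1 < 2 * ev e (u - b)" for e
  proof (rule ccontr)
    assume "\<not> 3 * ev e (v - b) < sq (v - b) + 2"
    then have A: "sq (v - b) + 2 < 3 * ev e (v - b)" using good_ev(6)[OF gb(2) e] by linarith
    have e': "- e \<in> nbrs" using nbrs_uminus[OF e] .
    have "sq (v - b - e) < 1" using A by (simp add: sq_diff_nbr[OF e])
    then have x1: "cmod (v - (b + e)) < 1" by (simp add: power_less_one_iff algebra_simps)
    \<comment> \<open>Seen from \<open>b + e\<close>, the disc about \<open>b + 2 * e / 3\<close> is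
      the disc about \<open>- e / 3\<close>.\<close>
    have le': "sq (u - b - e) < ev (- e) (u - b - e)" using le ev_self[OF e] by (simp add: sq_diff_nbr[OF e])
    show False
    proof (cases "b + e = 0")
      case True
      then have be: "b = - e" by (simp add: add_eq_0_iff2)
      show False using le' c1[OF e'] by (simp add: be)
    next
      case False
      have bn: "b + e \<in> nbrs" using unit_disc_overlap[OF v1' x1] False ideal_J_add[OF b nbrs_J[OF e]] by blast
      \<comment> \<open>The unit disc about \<open>b + e\<close> contains \<open>v\<close>, so
        \<open>costair\<close> puts \<open>u\<close> on the \<open>0\<close> side of the bisector of
        \<open>0\<close> and \<open>b + e\<close>, whereas \<open>disc_side\<close> puts it on the
        other side.\<close>
      have "ev (b + e) u < 1" by (rule lens_side[OF bn x1])
      moreover have "- 1 < ev (b + e) (u - b - e)"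
        by (rule disc_side[OF bn e' _ le']) (use b0 in simp)
      ultimately show False using ev_self[OF bn] ev_simps(2)[of "b + e" u "b + e"] by (simp only: diff_diff_add)
    qed
  qed
  show ?thesis unfolding stair_def using w1 h1 stair_e stair_e2 by blast
qed

text \<open>The premise \<open>min\<close> says that every ideal point adjacent to \<open>a\<close>
  whose unit disc contains \<open>v\<close> is farther from \<open>u\<close> than \<open>a\<close>
  is; it yields the middle clause. In the other two clauses the hexagon around \<open>0\<close> that
  contains \<open>u\<close> forces \<open>a = - e\<close>, and the claim becomes a translated clause
  of \<open>stair\<close>.\<close>

lemma stair_imp_costair:
  assumes s: "stair u v" and a: "a \<in> ideal_J" and va: "sq (v - a) < 1"
    and min: "\<And>e. e \<in> nbrs \<Longrightarrow> sq (v - a - e) < 1 \<Longrightarrow> ev e (u - a) < 1"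
    and good: "u \<notin> bad" "v \<notin> bad"
  shows "costair (u - a) (v - a)"
proof -
  have gb: "u - a \<notin> bad" "v - a \<notin> bad" using good bad_ideal_J[OF a] by auto
  have v1: "1 < sq v" and h1: "\<And>e. e \<in> nbrs \<Longrightarrow> ev e u < 1"
    and s2: "\<And>e. e \<in> nbrs \<Longrightarrow> sq u < ev e u \<Longrightarrow> 3 * ev e v < 2 * sq v + 1"
    and s3: "\<And>e. e \<in> nbrs \<Longrightarrow> sq u + 1 < 2 * ev e u \<Longrightarrow> 3 * ev e v < sq v + 2"
    using s by (auto simp: stair_def)
  have h: "(u - a) - (- a) \<in> hexagon" using h1 by (simp add: hexagon_def)
  have a0: "a \<noteq> 0" using v1 va by auto
  have a': "- a \<in> ideal_J" using a ideal_J_uminus by blast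
  have "ev e (u - a) < sq (u - a)" if e: "e \<in> nbrs" for e
  proof (rule ccontr)
    assume "\<not> ev e (u - a) < sq (u - a)"
    then have lt: "sq (u - a) < ev e (u - a)" using good_ev(4)[OF gb(1) e] by linarith
    from small_disc_hexagon[OF e a' h lt] a0 have ae: "a = - e" by auto
    have e': "- e \<in> nbrs" using nbrs_uminus[OF e] .
    have "sq u + 1 < 2 * ev (- e) u" using lt ev_self[OF e] sq_diff_nbr[OF e', of u] by (simp add: ae)
    from s3[OF e' this] show False using va sq_diff_nbr[OF e', of v] by (simp add: ae)
  qed
  moreover have "3 * ev e (v - a) < sq (v - a) + 2" if e: "e \<in> nbrs" and "1 < ev e (u - a)" for e
  proof -
    have "\<not> sq (v - a - e) < 1" using min[OF e] that(2) by linarith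
    then show ?thesis using good_ev(6)[OF gb(2) e] sq_diff_nbr[OF e, of "v - a"] by linarith
  qed
  moreover have "3 * ev e (v - a) < 2 * sq (v - a) + 1" if e: "e \<in> nbrs" and le: "sq (u - a) + 1 < 2 * ev e (u - a)" for e
  proof -
    have e': "- e \<in> nbrs" using nbrs_uminus[OF e] .
    from far_disc_hexagon[OF e a' h le] a0 have ae: "a = - e" by auto
    have "sq u < ev (- e) u" using le ev_self[OF e] sq_diff_nbr[OF e', of u] by (simp add: ae)
    from s2[OF e' this] show ?thesis using ev_self[OF e] sq_diff_nbr[OF e', of v] by (simp add: ae)
  qed
  ultimately show ?thesis unfolding costair_def using va by blast
qed

text \<open>Both unit discs contain \<open>v\<close>, so \<open>a\<close> and \<open>a'\<close> are
  adjacent. The middle clause of each \<open>costair\<close> puts \<open>u\<close> on its own side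
  of their bisector, hence onto the bisector, which lies in \<open>bad\<close>.\<close>

lemma costair_unique:
  assumes "costair (u - a) (v - a)" "costair (u - a') (v - a')" "a \<in> ideal_J" "a' \<in> ideal_J" "u \<notin> bad"
  shows "a = a'"
proof (rule ccontr)
  assume ne: "a \<noteq> a'"
  define e where "e = a' - a"
  have d: "cmod (v - a) < 1" "cmod (v - a') < 1" using assms(1,2) by (simp_all add: costair_def power_less_one_iff)
  have e: "e \<in> nbrs"
  proof (rule unit_disc_overlap[OF d(1)])
    show "cmod (v - a - e) < 1" using d(2) by (simp add: e_def)
  qed (use ne assms in \<open>auto simp: e_def ideal_J_diff\<close>)
  have e': "- e \<in> nbrs" using nbrs_uminus[OF e] .
  have ve: "v - a' = v - a - e" "v - a = v - a' - (- e)" "u - a' = u - a - e" by (simp_all add: e_def)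
  have s: "sq (v - a) < 1" "sq (v - a') < 1" using assms(1,2) by (simp_all add: costair_def)
  have "\<not> 1 < ev e (u - a)"
    using assms(1) e s(2) unfolding costair_def ve(1) sq_diff_nbr[OF e] by force
  moreover have "\<not> 1 < ev (- e) (u - a')"
    using assms(2) e' s(1) unfolding costair_def ve(2) sq_diff_nbr[OF e'] by force
  moreover have "ev e (u - a) \<noteq> 1"
    using good_ev(3)[OF _ e] bad_ideal_J[OF assms(3), of u] assms(5) by blast
  ultimately show False unfolding ve(3) using ev_self[OF e] by simp
qed

section \<open>The half-open hexagon as a fundamental domain of the ideal\<close>

lemma al_scaleR [simp]: "al (r *\<^sub>R z) = r * al z" and be_scaleR [simp]: "be (r *\<^sub>R z) = r * be z"
  by (simp_all add: scaleR_conv_of_real)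

lemma ev_scaleR [simp]: "ev e (r *\<^sub>R z) = r * ev e z"
  by (simp add: ev_def)

lemma convex_hull_zeta_powers: "convex hull {zeta ^ k | k. k \<le> 5} = {z. \<forall>e\<in>nbrs. ev e z \<le> 1}" (is "convex hull ?S = ?H")
proof
  show "convex hull ?S \<subseteq> ?H"
  proof (rule hull_minimal)
    have "zeta ^ k \<in> ?H" for k
    proof (induction k)
      case 0 show ?case by (auto dest: nbrs_ev_cases)
    next
      case (Suc k)
      then show ?case
        using all_nbrs_iff[of "\<lambda>e. ev e (zeta ^ k) \<le> 1" "\<lambda>g. g (zeta ^ k) \<le> 1"]
          all_nbrs_iff[of "\<lambda>e. ev e (zeta ^ Suc k) \<le> 1" "\<lambda>g. g (zeta ^ Suc k) \<le> 1"]
        by simp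
    qed
    then show "?S \<subseteq> ?H" by auto
    show "convex ?H"
      unfolding convex_def
    proof (intro ballI allI impI CollectI)
      fix x y :: complex and u v :: real and e
      assume *: "x \<in> ?H" "y \<in> ?H" "0 \<le> u" "0 \<le> v" "u + v = 1" "e \<in> nbrs"
      then have "u * ev e x \<le> u * 1" "v * ev e y \<le> v * 1" by (intro mult_left_mono; simp)+
      then show "ev e (u *\<^sub>R x + v *\<^sub>R y) \<le> 1" using * by simp
    qed
  qed
next
  show "?H \<subseteq> convex hull ?S"
  proof
    fix z assume "z \<in> ?H"
    then have h: "\<bar>al z\<bar> \<le> 1" "\<bar>be z\<bar> \<le> 1" "\<bar>al z - be z\<bar> \<le> 1"
      using all_nbrs_iff[of "\<lambda>e. ev e z \<le> 1" "\<lambda>g. g z \<le> 1"] by auto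
    have S: "zeta ^ k \<in> convex hull ?S" if "k \<le> 5" for k using that by (auto intro!: hull_inc)
    have "0 = (1/2) *\<^sub>R zeta ^ 0 + (1/2) *\<^sub>R zeta ^ 3"
      by (rule albe_eqI) (simp_all add: numeral_eq_Suc)
    then have 0: "0 \<in> convex hull ?S"
      using convexD[OF convex_convex_hull S[of 0] S[of 3], of "1/2" "1/2"] by simp
    \<comment> \<open>The hexagon is fanned into six triangles with apex \<open>0\<close>. The
      weight \<open>1 - (x + y)\<close> goes to the apex; \<open>x + y = 0\<close> is separate
      because the point on the outer edge is obtained by dividing by \<open>x + y\<close>.\<close>
    have comb: "z \<in> convex hull ?S" if "0 \<le> x" "0 \<le> y" "x + y \<le> 1" "i \<le> 5" "j \<le> 5"
      "al z = x * al (zeta ^ i) + y * al (zeta ^ j)" "be z = x * be (zeta ^ i) + y * be (zeta ^ j)" for x y i j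
    proof -
      have "z = x *\<^sub>R zeta ^ i + y *\<^sub>R zeta ^ j" by (rule albe_eqI) (simp_all add: that)
      moreover have "x *\<^sub>R zeta ^ i + y *\<^sub>R zeta ^ j \<in> convex hull ?S"
      proof (cases "x + y = 0")
        case True then show ?thesis using that 0 by (simp add: add_nonneg_eq_0_iff)
      next
        case False
        have c: "(x / (x + y)) *\<^sub>R zeta ^ i + (y / (x + y)) *\<^sub>R zeta ^ j \<in> convex hull ?S"
          by (rule convexD[OF convex_convex_hull S S]) (use that False in \<open>auto simp flip: add_divide_distrib\<close>)
        have "(x + y) *\<^sub>R ((x / (x + y)) *\<^sub>R zeta ^ i + (y / (x + y)) *\<^sub>R zeta ^ j) + (1 - (x + y)) *\<^sub>R 0 \<in> convex hull ?S"
          by (rule convexD[OF convex_convex_hull c 0]) (use that in auto)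
        then show ?thesis using False by (simp add: scaleR_add_right)
      qed
      ultimately show ?thesis by simp
    qed
    have p: "al (zeta ^ 0) = 1" "be (zeta ^ 0) = 0" "al (zeta ^ 1) = 1" "be (zeta ^ 1) = 1" "al (zeta ^ 2) = 0" "be (zeta ^ 2) = 1"
      "al (zeta ^ 3) = -1" "be (zeta ^ 3) = 0" "al (zeta ^ 4) = -1" "be (zeta ^ 4) = -1" "al (zeta ^ 5) = 0" "be (zeta ^ 5) = -1"
      by (simp_all add: numeral_eq_Suc)
    consider "0 \<le> be z" "be z \<le> al z" | "0 \<le> al z" "al z \<le> be z" | "al z \<le> 0" "0 \<le> be z" |
      "be z \<le> 0" "al z \<le> be z" | "al z \<le> 0" "be z \<le> al z" | "0 \<le> al z" "be z \<le> 0" by linarith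
    then show "z \<in> convex hull ?S"
    proof cases
      case 1 then show ?thesis using h by (intro comb[of "al z - be z" "be z" 0 1]) (auto simp: p)
    next
      case 2 then show ?thesis using h by (intro comb[of "al z" "be z - al z" 1 2]) (auto simp: p)
    next
      case 3 then show ?thesis using h by (intro comb[of "be z" "- al z" 2 3]) (auto simp: p)
    next
      case 4 then show ?thesis using h by (intro comb[of "be z - al z" "- be z" 3 4]) (auto simp: p)
    next
      case 5 then show ?thesis using h by (intro comb[of "- al z" "al z - be z" 4 5]) (auto simp: p)
    next
      case 6 then show ?thesis using h by (intro comb[of "- be z" "al z" 5 0]) (auto simp: p)
    qed
  qed
qed

lemma continuous_on_al [continuous_intros]: "continuous_on S al"
  unfolding al_def by (intro continuous_intros) auto

lemma continuous_on_be [continuous_intros]: "continuous_on S be"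
  unfolding be_def by (intro continuous_intros) auto

lemma open_hexagon: "open hexagon"
proof -
  have *: "hexagon = {z. \<bar>al z\<bar> < 1} \<inter> {z. \<bar>be z\<bar> < 1} \<inter> {z. \<bar>al z - be z\<bar> < 1}" by (auto simp: hexagon_iff)
  show ?thesis unfolding * by (intro open_Int open_Collect_less continuous_intros)
qed

lemma interior_hexagon: "interior (convex hull {zeta ^ k | k. k \<le> 5}) = hexagon"
proof
  show "hexagon \<subseteq> interior (convex hull {zeta ^ k | k. k \<le> 5})"
    unfolding convex_hull_zeta_powers by (rule interior_maximal[OF _ open_hexagon]) (auto simp: hexagon_def intro: less_imp_le)
  show "interior (convex hull {zeta ^ k | k. k \<le> 5}) \<subseteq> hexagon"
    unfolding convex_hull_zeta_powers
  proof
    fix z assume "z \<in> interior {z. \<forall>e\<in>nbrs. ev e z \<le> 1}"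
    then obtain d where d: "d > 0" "ball z d \<subseteq> {z. \<forall>e\<in>nbrs. ev e z \<le> 1}" by (auto simp: mem_interior)
    have "ev e z < 1" if e: "e \<in> nbrs" for e
    proof -
      have ne: "cmod e > 0" using ev_self[OF e] by (auto simp: ev_def)
      define t where "t = d / 2 / cmod e"
      have t: "t > 0" using ne d by (simp add: t_def)
      have "z + t *\<^sub>R e \<in> ball z d" using ne d t by (simp add: dist_norm t_def)
      then have "ev e (z + t *\<^sub>R e) \<le> 1" using d e by blast
      then show ?thesis using t ev_self[OF e] by simp
    qed
    then show "z \<in> hexagon" by (simp add: hexagon_def)
  qed
qed

lemma albe_seg:
  assumes "a \<noteq> b"
  shows "z \<in> open_segment a b \<longleftrightarrow> (\<exists>u. 0 < u \<and> u < 1 \<and> al z = (1 - u) * al a + u * al b \<and> be z = (1 - u) * be a + u * be b)"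
  using assms unfolding in_segment by (auto simp: albe_eq_iff)

lemma dom_U_iff:
  "z \<in> dom_U \<longleftrightarrow> \<bar>al z\<bar> < 1 \<and> \<bar>be z\<bar> < 1 \<and> \<bar>al z - be z\<bar> < 1 \<or> be z = 1 \<and> 0 < al z \<and> al z < 1
     \<or> al z = -1 \<and> -1 \<le> be z \<and> be z < 0 \<or> al z - be z = 1 \<and> 0 \<le> al z \<and> al z < 1"
proof -
  have ne: "zeta \<noteq> - cnj zeta" "- zeta \<noteq> - 1" "1 \<noteq> cnj zeta" by (simp_all add: albe_eq_iff)
  have s: "(\<exists>u. 0 < u \<and> u < 1 \<and> al z = (1 - u) * 1 + u * 0 \<and> be z = (1 - u) * 1 + u * 1) \<longleftrightarrow> be z = 1 \<and> 0 < al z \<and> al z < 1"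
    "(\<exists>u. 0 < u \<and> u < 1 \<and> al z = (1 - u) * (-1) + u * (-1) \<and> be z = (1 - u) * (-1) + u * 0) \<longleftrightarrow> al z = -1 \<and> -1 < be z \<and> be z < 0"
    "(\<exists>u. 0 < u \<and> u < 1 \<and> al z = (1 - u) * 1 + u * 0 \<and> be z = (1 - u) * 0 + u * (-1)) \<longleftrightarrow> al z - be z = 1 \<and> 0 < al z \<and> al z < 1"
      apply (rule iffI; force intro!: exI[of _ "1 - al z"])
     apply (rule iffI; force intro!: exI[of _ "1 + be z"])
    apply (rule iffI; force intro!: exI[of _ "1 - al z"])
    done
  show ?thesis
    unfolding dom_U_def interior_hexagon unfolding Un_iff albe_seg[OF ne(1)] albe_seg[OF ne(2)] albe_seg[OF ne(3)] hexagon_iff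
      insert_iff empty_iff albe_eq_iff
    using s by simp argo
qed

text \<open>The residue of \<open>m + n\<close> modulo 3 tells which corners of the unit square
  around \<open>z\<close> belong to the ideal: \<open>(0, 0)\<close> for 0, \<open>(1, 1)\<close>
  for 1, and both \<open>(1, 0)\<close> and \<open>(0, 1)\<close> for 2, where the diagonal decides.
  For residue 1 the bottom edge without its left end belongs to the hexagon centred at
  \<open>(0, -1)\<close>.\<close>

lemma dom_U_exists: "\<exists>b\<in>ideal_J. z - b \<in> dom_U"
proof -
  define m n x y where "m = \<lfloor>al z\<rfloor>" and "n = \<lfloor>be z\<rfloor>" and "x = al z - m" and "y = be z - n"
  have xy: "0 \<le> x" "x < 1" "0 \<le> y" "y < 1" unfolding x_def y_def m_def n_def by linarith+
  have wit: "\<exists>b\<in>ideal_J. z - b \<in> dom_U" if "3 dvd (m + i) + (n + j)"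
    "\<bar>x - i\<bar> < 1 \<and> \<bar>y - j\<bar> < 1 \<and> \<bar>x - i - (y - j)\<bar> < 1 \<or> y - j = 1 \<and> 0 < x - i \<and> x - i < 1
     \<or> x - i = -1 \<and> -1 \<le> y - j \<and> y - j < 0 \<or> x - i - (y - j) = 1 \<and> 0 \<le> x - i \<and> x - i < 1" for i j :: int
  proof -
    obtain b where b: "al b = of_int (m + i)" "be b = of_int (n + j)" using ex_albe by blast
    have "b \<in> ideal_J" using b that(1) unfolding ideal_J_iff by blast
    moreover have e: "al (z - b) = x - i" "be (z - b) = y - j" using b by (auto simp: x_def y_def)
    have "z - b \<in> dom_U" unfolding dom_U_iff e using that(2) .
    ultimately show ?thesis by blast
  qed
  have "(m + n) mod 3 = 0 \<or> (m + n) mod 3 = 1 \<or> (m + n) mod 3 = 2" by presburger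
  then show ?thesis
  proof (elim disjE)
    assume "(m + n) mod 3 = 0"
    then have "3 dvd (m + 0) + (n + 0)" by presburger
    then show ?thesis by (rule wit) (use xy in auto)
  next
    assume "(m + n) mod 3 = 2"
    then have d: "3 dvd (m + 1) + (n + 0)" "3 dvd (m + 1) + (n + 3)" "3 dvd (m + 0) + (n + 1)" "3 dvd (m - 1) + (n - 1)" "3 dvd (m + 1) + (n + 1) - 1" by presburger+
    show ?thesis
    proof (cases "x > y")
      case True then show ?thesis using wit[OF d(1)] xy by force
    next
      case False then show ?thesis using wit[OF d(3)] xy by force
    qed
  next
    assume "(m + n) mod 3 = 1"
    then have d: "3 dvd (m + 1) + (n + 1)" "3 dvd (m + 0) + (n + (-1))" by presburger+
    show ?thesis
    proof (cases "y = 0 \<and> x > 0")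
      case True then show ?thesis using wit[OF d(2)] xy by force
    next
      case False then show ?thesis using wit[OF d(1)] xy by force
    qed
  qed
qed

lemma dom_U_unique:
  assumes "z \<in> dom_U" "z - b \<in> dom_U" "b \<in> ideal_J"
  shows "b = 0"
proof -
  obtain m n :: int where b: "al b = of_int m" "be b = of_int n" "3 dvd m + n" using assms(3) by (auto simp: ideal_J_iff)
  define x y where "x = al z" and "y = be z"
  have e: "al (z - b) = x - m" "be (z - b) = y - n" by (simp_all add: x_def y_def b)
  note d = assms(1,2)[unfolded dom_U_iff e, folded x_def y_def]
  have "\<bar>x\<bar> \<le> 1" "\<bar>y\<bar> \<le> 1" "\<bar>x - y\<bar> \<le> 1" "\<bar>x - m\<bar> \<le> 1" "\<bar>y - n\<bar> \<le> 1" "\<bar>x - m - (y - n)\<bar> \<le> 1"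
    using d by argo+
  then have "\<bar>m\<bar> \<le> 2" "\<bar>n\<bar> \<le> 2" "\<bar>m - n\<bar> \<le> 2" by linarith+
  then have "m \<in> {-2,-1,0,1,2}" "n \<in> {-2,-1,0,1,2}" by auto
  \<comment> \<open>Among ideal points only \<open>0\<close> and the six neighbours are differences
    of points of the closed hexagon; the choice of sides and vertices in \<open>dom_U\<close> then
    eliminates the neighbours.\<close>
  then have "m = 0 \<and> n = 0 \<or> m = 2 \<and> n = 1 \<or> m = 1 \<and> n = 2 \<or> m = -1 \<and> n = 1 \<or>
    m = -2 \<and> n = -1 \<or> m = -1 \<and> n = -2 \<or> m = 1 \<and> n = -1"
    using b(3) \<open>\<bar>m - n\<bar> \<le> 2\<close> by (elim insertE emptyE; hypsubst; simp)
  then have "m = 0 \<and> n = 0"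
  proof (elim disjE; goal_cases)
    case 1 then show ?case by simp
  qed (use d in \<open>elim conjE; hypsubst; simp; argo\<close>)+
  then show ?thesis using b by (auto intro!: albe_eqI)
qed

lemma bracket_eq:
  assumes "b \<in> ideal_J" "z - b \<in> dom_U"
  shows "bracket z = b"
proof -
  have *: "z \<in> (\<lambda>u. a + u) ` dom_U \<longleftrightarrow> z - a \<in> dom_U" for a
  proof
    assume "z - a \<in> dom_U"
    then show "z \<in> (\<lambda>u. a + u) ` dom_U" by (intro image_eqI[of _ _ "z - a"]) simp_all
  qed auto
  show ?thesis
    unfolding bracket_def *
  proof (rule the_equality)
    fix a assume a: "a \<in> ideal_J \<and> z - a \<in> dom_U"
    have "a - b = 0"
      by (rule dom_U_unique[of "z - b"]) (use a assms in \<open>auto simp: ideal_J_diff\<close>)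
    then show "a = b" by simp
  qed (use assms in auto)
qed

lemma bracket_J: "bracket z \<in> ideal_J" and bracket_dom_U: "z - bracket z \<in> dom_U"
proof -
  obtain b where "b \<in> ideal_J" "z - b \<in> dom_U" using dom_U_exists by blast
  with bracket_eq[OF this] show "bracket z \<in> ideal_J" "z - bracket z \<in> dom_U" by auto
qed

lemma good_dom_U: "z \<notin> bad \<Longrightarrow> z \<in> dom_U \<longleftrightarrow> z \<in> hexagon"
  using good_neq[of z 0 0 1 "-1"] good_neq[of z 0 1 0 "1"] good_neq[of z 0 1 "-1" "-1"]
  by (auto simp: dom_U_iff hexagon_iff)

lemma hexagon_sq_lt: "z \<in> hexagon \<Longrightarrow> sq z < 1"
proof -
  assume z: "z \<in> hexagon"
  show "sq z < 1"
  proof (cases "z = 0")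
    case False
    then obtain e where "e \<in> nbrs" "sq z < ev e z" using hexagon_ex_disc z by blast
    then show ?thesis using z by (force simp: hexagon_def)
  qed simp
qed

lemma near_ideal_J:
  assumes "z \<notin> bad" obtains a where "a \<in> ideal_J" "sq (z - a) < 1"
proof
  have "z - bracket z \<notin> bad" using assms bad_ideal_J[OF bracket_J[of z], of z] by simp
  then show "sq (z - bracket z) < 1" using good_dom_U[of "z - bracket z"] bracket_dom_U[of z] hexagon_sq_lt[of "z - bracket z"] by simp
qed (rule bracket_J)

lemma finite_near_ideal_J: "finite {a \<in> ideal_J. sq (z - a) < 1}"
proof -
  define F where "F = (\<lambda>(m, n). Complex (m - n / 2) (sqrt 3 / 2 * n)) ` (real_of_int ` {\<lfloor>al z\<rfloor> - 3..\<lceil>al z\<rceil> + 3} \<times> real_of_int ` {\<lfloor>be z\<rfloor> - 3..\<lceil>be z\<rceil> + 3})"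
  have "a \<in> F" if aJ: "a \<in> ideal_J" and sa: "sq (z - a) < 1" for a
  proof -
    obtain m n :: int where mn: "al a = m" "be a = n" using aJ unfolding ideal_J_iff by blast
    have pos: "0 \<le> (2 * al (z - a) - be (z - a))\<^sup>2" "0 \<le> (2 * be (z - a) - al (z - a))\<^sup>2" by simp_all
    have "3 * (be (z - a))\<^sup>2 \<le> 4 * sq (z - a)" "3 * (al (z - a))\<^sup>2 \<le> 4 * sq (z - a)"
      using pos unfolding sq_albe by (simp_all add: power2_eq_square algebra_simps)
    then have "(be (z - a))\<^sup>2 < 2\<^sup>2" "(al (z - a))\<^sup>2 < 2\<^sup>2" using sa by simp_all
    then have "\<bar>be (z - a)\<bar> < 2" "\<bar>al (z - a)\<bar> < 2"
      by (metis abs_numeral abs_le_square_iff not_le)+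
    then have "\<bar>be z - n\<bar> < 2" "\<bar>al z - m\<bar> < 2" by (simp_all add: mn)
    then have "m \<in> {\<lfloor>al z\<rfloor> - 3..\<lceil>al z\<rceil> + 3}" "n \<in> {\<lfloor>be z\<rfloor> - 3..\<lceil>be z\<rceil> + 3}" by (auto; linarith)+
    moreover have "a = Complex (m - n / 2) (sqrt 3 / 2 * n)"
      unfolding albe_eq_iff mn by (simp add: al_def be_def)
    ultimately show ?thesis unfolding F_def by force
  qed
  then have "{a \<in> ideal_J. sq (z - a) < 1} \<subseteq> F" by blast
  moreover have "finite F" unfolding F_def by blast
  ultimately show ?thesis by (rule finite_subset)
qed

text \<open>Only finitely many ideal points are within distance 1 of \<open>v\<close>, so one of
  them is nearest to \<open>u\<close>. Minimality gives a non-strict comparison with its neighbours,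
  and goodness makes it strict.\<close>

lemma stair_ex_costair:
  assumes s: "stair u v" and good: "u \<notin> bad" "v \<notin> bad"
  obtains a where "a \<in> ideal_J" "costair (u - a) (v - a)"
proof -
  define N where "N = {a \<in> ideal_J. sq (v - a) < 1}"
  have N: "finite N" "N \<noteq> {}" using finite_near_ideal_J near_ideal_J[OF good(2)] by (auto simp: N_def)
  define a where "a = arg_min_on (\<lambda>a. sq (u - a)) N"
  have a: "a \<in> N" unfolding a_def by (rule arg_min_if_finite(1)[OF N])
  have a2: "sq (u - a) \<le> sq (u - b)" if "b \<in> N" for b unfolding a_def by (rule arg_min_least[OF N that])
  have aJ: "a \<in> ideal_J" "sq (v - a) < 1" using a by (auto simp: N_def)
  have "ev e (u - a) < 1" if e: "e \<in> nbrs" and "sq (v - a - e) < 1" for e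
  proof -
    have "a + e \<in> N" using that aJ by (simp add: N_def ideal_J_add nbrs_J algebra_simps)
    from a2[OF this] have "sq (u - a) \<le> sq (u - a - e)" by (simp only: diff_diff_add)
    then have "ev e (u - a) \<le> 1" by (simp add: sq_diff_nbr[OF e])
    moreover have "u - a \<notin> bad" using good(1) bad_ideal_J[OF aJ(1), of u] by simp
    from good_ev(3)[OF this e] have "ev e (u - a) \<noteq> 1" .
    ultimately show ?thesis by linarith
  qed
  then have "costair (u - a) (v - a)" by (rule stair_imp_costair[OF s aJ _ good])
  with aJ(1) show ?thesis by (rule that)
qed

section \<open>The cells in a fundamental sector\<close>

lemma rad_sq: "rad\<^sup>2 = 1 / 3" by (simp add: rad_def power_divide)

lemma rad_pos: "0 < rad" by (simp add: rad_def)

lemma sq_eq: assumes "e \<in> nbrs" shows "sq (z - of_real t * e) = sq z - 3 * t * ev e z + 3 * t\<^sup>2"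
proof -
  have s: "sq e = 3" using assms by (simp add: nbrs_def)
  have "sq (z - of_real t * e) = sq z - 3 * t * ev e z + t\<^sup>2 * sq e"
    unfolding cmod_power2 ev_def by (simp add: power2_eq_square algebra_simps)
  then show ?thesis by (simp add: s)
qed

lemma norm_less_iff: "0 < r \<Longrightarrow> cmod z < r \<longleftrightarrow> sq z < r\<^sup>2" "0 < r \<Longrightarrow> r < cmod z \<longleftrightarrow> r\<^sup>2 < sq z"
  by (auto intro: power_strict_mono power_less_imp_less_base)

lemma disc_iff:
  assumes "e \<in> nbrs"
  shows "cmod (z - e / 3) < rad \<longleftrightarrow> sq z < ev e z" "rad < cmod (z - e / 3) \<longleftrightarrow> ev e z < sq z"
    "cmod (z - 2 * e / 3) < rad \<longleftrightarrow> sq z + 1 < 2 * ev e z" "rad < cmod (z - 2 * e / 3) \<longleftrightarrow> 2 * ev e z < sq z + 1"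
    "1 / 2 < cmod (z - e / 2) \<longleftrightarrow> 3 * ev e z < 2 * sq z + 1" "1 < cmod (z - e) \<longleftrightarrow> 3 * ev e z < sq z + 2"
proof -
  have s: "sq (z - e / 3) = sq z - ev e z + 1 / 3" "sq (z - 2 * e / 3) = sq z - 2 * ev e z + 4 / 3"
    "sq (z - e / 2) = sq z - 3 / 2 * ev e z + 3 / 4" "sq (z - e) = sq z - 3 * ev e z + 3"
    using sq_eq[OF assms, of z "1/3"] sq_eq[OF assms, of z "2/3"] sq_eq[OF assms, of z "1/2"] sq_eq[OF assms, of z 1]
    by (simp_all add: power2_eq_square)
  show "cmod (z - e / 3) < rad \<longleftrightarrow> sq z < ev e z" "rad < cmod (z - e / 3) \<longleftrightarrow> ev e z < sq z"
    "cmod (z - 2 * e / 3) < rad \<longleftrightarrow> sq z + 1 < 2 * ev e z" "rad < cmod (z - 2 * e / 3) \<longleftrightarrow> 2 * ev e z < sq z + 1"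
    unfolding norm_less_iff[OF rad_pos] rad_sq s by auto
  show "1 / 2 < cmod (z - e / 2) \<longleftrightarrow> 3 * ev e z < 2 * sq z + 1"
    using norm_less_iff(2)[of "1/2" "z - e / 2"] unfolding s by (simp add: power2_eq_square) linarith
  show "1 < cmod (z - e) \<longleftrightarrow> 3 * ev e z < sq z + 2"
    using norm_less_iff(2)[of 1 "z - e"] unfolding s by auto
qed

lemma nbrs_named: "eta \<in> nbrs" "sqrtm3 \<in> nbrs" "cnj eta \<in> nbrs"
  by (rule nbrsI, simp)+

lemma ev_named: "ev eta z = al z" "ev sqrtm3 z = be z" "ev (cnj eta) z = al z - be z"
  by (simp_all add: ev_albe)

text \<open>In the sector \<open>0 < be < al\<close> the regions are governed by the three discs
  \<open>inA\<close>, \<open>inB\<close>, \<open>inC\<close> through the circumcentre of the triangle \<open>0, 1, zeta\<close>.\<close>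

definition inA :: "complex \<Rightarrow> bool" where "inA z \<longleftrightarrow> sq z < al z - be z"
definition inB :: "complex \<Rightarrow> bool" where "inB z \<longleftrightarrow> sq z < be z"
definition inC :: "complex \<Rightarrow> bool" where "inC z \<longleftrightarrow> sq z + 1 < 2 * al z"

definition sector :: "complex set" where "sector = {z. 0 < be z \<and> be z < al z \<and> al z < 1}"

lemma sector_hexagon: "z \<in> sector \<Longrightarrow> z \<in> hexagon"
  by (auto simp: sector_def hexagon_iff)

text \<open>\<open>p\<close>, \<open>b\<close>, \<open>c\<close> are the barycentric coordinates of
  \<open>z\<close> with respect to \<open>1\<close>, \<open>zeta\<close>, \<open>0\<close>. They
  make the three discs cyclically symmetric, and the last identity controls the distance to the unit
  circle in the mass estimates.\<close>

lemma bary: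
  fixes z defines "p \<equiv> al z - be z" and "b \<equiv> be z" and "c \<equiv> 1 - al z"
  shows "inA z \<longleftrightarrow> b\<^sup>2 < p * c" "inB z \<longleftrightarrow> p\<^sup>2 < b * c" "inC z \<longleftrightarrow> c\<^sup>2 < p * b" "1 - sq z = c * (1 + al z) + p * b"
  unfolding inA_def inB_def inC_def sq_albe p_def b_def c_def
  by (auto simp: power2_eq_square algebra_simps)

text \<open>The square of the largest barycentric coordinate is at least the product of the other
  two, so one of the three disc inequalities fails.\<close>

lemma sector_not_all:
  assumes z: "z \<in> sector" shows "\<not> (inA z \<and> inB z \<and> inC z)"
proof
  define p b c where "p = al z - be z" and "b = be z" and "c = 1 - al z"
  have pos: "0 < p" "0 < b" "0 < c" using z by (auto simp: sector_def p_def b_def c_def)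
  assume "inA z \<and> inB z \<and> inC z"
  then have A: "b\<^sup>2 < p * c" and B: "p\<^sup>2 < b * c" and C: "c\<^sup>2 < p * b"
    by (simp_all add: bary p_def b_def c_def)
  consider "b \<le> p" "c \<le> p" | "p \<le> b" "c \<le> b" | "p \<le> c" "b \<le> c" by linarith
  then show False
  proof cases
    case 1
    then have "b * c \<le> p * p" using pos by (intro mult_mono) auto
    then show False using B by (simp add: power2_eq_square)
  next
    case 2
    then have "p * c \<le> b * b" using pos by (intro mult_mono) auto
    then show False using A by (simp add: power2_eq_square)
  next
    case 3
    then have "p * b \<le> c * c" using pos by (intro mult_mono) auto
    then show False using C by (simp add: power2_eq_square)
  qed
qed

text \<open>The square of the smallest barycentric coordinate is at most the product of the other
  two, with equality only at the centroid, the common point of the three circles.\<close>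

lemma sector_some:
  assumes z: "z \<in> sector" "z \<notin> bad" shows "inA z \<or> inB z \<or> inC z"
proof (rule ccontr)
  define p b c where "p = al z - be z" and "b = be z" and "c = 1 - al z"
  have pos: "0 < p" "0 < b" "0 < c" using z by (auto simp: sector_def p_def b_def c_def)
  assume *: "\<not> (inA z \<or> inB z \<or> inC z)"
  \<comment> \<open>Strictness for one circle is enough: equality in either of the other two cases
    forces \<open>p = b = c\<close>, which contradicts it.\<close>
  have "sq z \<noteq> al z - be z" using good_ev(4)[OF z(2) nbrs_named(3)] by (simp add: ev_named)
  then have "\<not> (p * c \<le> b\<^sup>2 \<and> b\<^sup>2 \<le> p * c)" unfolding sq_albe p_def b_def c_def by (simp add: power2_eq_square algebra_simps)
  with * have A: "p * c < b\<^sup>2" and B: "b * c \<le> p\<^sup>2" and C: "p * b \<le> c\<^sup>2"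
    by (auto simp: bary p_def b_def c_def)
  consider "p \<le> b" "p \<le> c" | "b \<le> p" "b \<le> c" | "c \<le> p" "c \<le> b" by linarith
  then show False
  proof cases
    case 1
    then have "p * p \<le> b * c" using pos by (intro mult_mono) auto
    then have e: "p * p = b * c" using B by (simp add: power2_eq_square)
    then have "b = p \<and> c = p" using 1 pos
      by (metis e antisym mult_le_cancel_left_pos mult_le_cancel_right_pos mult_mono less_imp_le order_refl)
    then show False using A by (simp add: power2_eq_square)
  next
    case 2
    then have "b * b \<le> p * c" using pos by (intro mult_mono) auto
    then show False using A by (simp add: power2_eq_square)
  next
    case 3
    then have "c * c \<le> p * b" using pos by (intro mult_mono) auto
    then have e: "c * c = p * b" using C by (simp add: power2_eq_square)
    then have "b = c \<and> c = p" using 3 pos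
      by (metis e antisym mult_le_cancel_left_pos mult_le_cancel_right_pos mult_mono less_imp_le order_refl)
    then show False using A by (simp add: power2_eq_square)
  qed
qed

text \<open>A good point of the sector lies in one or two of the three discs. Cells 1, 4 and 5 name
  the pair that contains it, cells 2, 3 and 6 the pair that does not.\<close>

definition cell :: "nat \<Rightarrow> complex \<Rightarrow> bool" where
  "cell k z \<longleftrightarrow> (if k = 1 then inA z \<and> inB z else if k = 2 then \<not> inC z \<and> \<not> inB z
     else if k = 3 then \<not> inC z \<and> \<not> inA z else if k = 4 then inA z \<and> inC z
     else if k = 5 then inC z \<and> inB z else if k = 6 then \<not> inA z \<and> \<not> inB z else False)"

text \<open>Most cells bound the triangle only implicitly. A point of disc \<open>inA\<close> has
  \<open>p > 0\<close>, a point of \<open>inB\<close> has \<open>b > 0\<close>, a point of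
  \<open>inC\<close> has both (\<open>nC1\<close>, \<open>nC2\<close>); and a point of the open
  first quadrant with \<open>p \<le> 0\<close> would lie in \<open>inB\<close> (\<open>lB\<close>),
  which cells 2 and 6 exclude.\<close>

lemma V1_sector:
  assumes z: "z \<in> hexagon" "z \<in> V1 k" "z \<notin> bad"
  shows "z \<in> sector"
proof -
  define p b where "p = al z - be z" and "b = be z"
  have h: "\<bar>p + b\<bar> < 1" "\<bar>b\<bar> < 1" "\<bar>p\<bar> < 1" using z(1) by (auto simp: hexagon_iff p_def b_def)
  have q: "sq z = p\<^sup>2 + p * b + b\<^sup>2" unfolding sq_albe p_def b_def by (simp add: power2_eq_square algebra_simps)
  have q0: "0 \<le> sq z" by simp
  have re: "Re z = p + b / 2" "Im z = sqrt 3 / 2 * b" by (simp_all add: Re_Im_albe p_def b_def)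
  have lB: "sq z < b" if "0 < b" "p \<le> 0" "0 < p + b / 2"
  proof -
    have "(p + b) * p \<le> 0" using that by (intro mult_nonneg_nonpos) auto
    moreover have "b * b < b" using that h by auto
    ultimately show ?thesis unfolding q by (simp add: power2_eq_square algebra_simps)
  qed
  have nC1: "2 * (p + b) \<le> sq z + 1" if "b \<le> 0"
  proof -
    have "0 \<le> b * (p + b - 2)" using that h by (intro mult_nonpos_nonpos) auto
    moreover have "0 \<le> (p - 1)\<^sup>2" by simp
    ultimately show ?thesis unfolding q by (simp add: power2_eq_square algebra_simps)
  qed
  have nC2: "2 * (p + b) \<le> sq z + 1" if "p \<le> 0"
  proof -
    have "0 \<le> p * (p + b - 2)" using that h by (intro mult_nonpos_nonpos) auto
    moreover have "0 \<le> (b - 1)\<^sup>2" by simp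
    ultimately show ?thesis unfolding q by (simp add: power2_eq_square algebra_simps)
  qed
  have lt: "sqrt 3 / 2 * b < sqrt 3 * (p + b / 2) \<longleftrightarrow> 0 < p"
  proof -
    have "sqrt 3 / 2 * b < sqrt 3 * (p + b / 2) \<longleftrightarrow> 0 < sqrt 3 * p" by (simp add: algebra_simps)
    then show ?thesis by (simp add: zero_less_mult_iff)
  qed
  have al: "al z = p + b" "be z = b" by (auto simp: p_def b_def)
  have pz: "p \<noteq> 0" using good_neq[OF z(3), of 0 1 "-1" 0] by (simp add: p_def)
  have "0 < p \<and> 0 < b"
    using z(2) unfolding V1_def mem_Collect_eq disc_iff[OF nbrs_named(1)] disc_iff[OF nbrs_named(2)] disc_iff[OF nbrs_named(3)]
      ev_named re lt al
    using le_less_trans[OF q0, of p] le_less_trans[OF q0, of b] lB nC1 nC2 pz by (auto split: if_splits simp: zero_less_mult_iff not_less[symmetric])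
  then show ?thesis using h by (auto simp: sector_def p_def b_def)
qed

lemma V1_iff:
  assumes "z \<notin> bad"
  shows "z \<in> V1 k \<longleftrightarrow> z \<in> sector \<and> cell k z"
proof
  assume z: "z \<in> V1 k"
  then have "z \<in> hexagon" using good_dom_U[OF assms] by (auto simp: V1_def)
  then have s: "z \<in> sector" using V1_sector z assms by blast
  moreover have "cell k z"
    using z unfolding V1_def mem_Collect_eq disc_iff[OF nbrs_named(1)] disc_iff[OF nbrs_named(2)] disc_iff[OF nbrs_named(3)]
      ev_named cell_def inA_def inB_def inC_def by (auto split: if_splits)
  ultimately show "z \<in> sector \<and> cell k z" by blast
next
  assume *: "z \<in> sector \<and> cell k z"
  then have U: "z \<in> dom_U" using sector_hexagon good_dom_U[OF assms] by blast
  have re: "0 < Re z" "0 < Im z" "Im z < sqrt 3 * Re z" using *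
    by (auto simp: sector_def Re_Im_albe algebra_simps)
  have ne: "sq z \<noteq> al z - be z" "sq z \<noteq> be z" "sq z + 1 \<noteq> 2 * al z"
    using good_ev(4)[OF assms nbrs_named(3)] good_ev(4)[OF assms nbrs_named(2)] good_ev(5)[OF assms nbrs_named(1)]
    by (simp_all add: ev_named)
  show "z \<in> V1 k"
    unfolding V1_def mem_Collect_eq disc_iff[OF nbrs_named(1)] disc_iff[OF nbrs_named(2)] disc_iff[OF nbrs_named(3)]
      ev_named
    using * U re ne unfolding cell_def inA_def inB_def inC_def by (auto split: if_splits)
qed

lemma cell_exists: "z \<in> sector \<Longrightarrow> z \<notin> bad \<Longrightarrow> \<exists>k\<in>{1..6}. cell k z"
  using sector_some[of z] sector_not_all[of z]
  by (cases "inA z"; cases "inB z"; cases "inC z")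
    (auto simp: cell_def intro: bexI[of _ 1] bexI[of _ 2] bexI[of _ 3] bexI[of _ 4] bexI[of _ 5] bexI[of _ 6])

lemma cell_unique:
  assumes "z \<in> sector" "z \<notin> bad" "cell k z" "cell k' z" shows "k = k'"
  using assms sector_some[of z] sector_not_all[of z]
  by (auto simp: cell_def split: if_splits)

text \<open>Of the twelve discs that \<open>stair\<close> consults, the small one of
  \<open>eta\<close> contains the whole sector, while the far ones of \<open>sqrtm3\<close> and
  \<open>cnj eta\<close> and all six of the opposite directions miss it. Only \<open>inA\<close>,
  \<open>inB\<close> and \<open>inC\<close> remain undecided.\<close>

lemma stair_sector:
  assumes z: "z \<in> sector"
  shows "stair z w \<longleftrightarrow> 1 < sq w \<and> 3 * al w < 2 * sq w + 1 \<and> (inC z \<longrightarrow> 3 * al w < sq w + 2)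
    \<and> (inB z \<longrightarrow> 3 * be w < 2 * sq w + 1) \<and> (inA z \<longrightarrow> 3 * (al w - be w) < 2 * sq w + 1)"
proof -
  define p b where "p = al z - be z" and "b = be z"
  have al: "al z = p + b" "be z = b" by (auto simp: p_def b_def)
  have pos: "0 < p" "0 < b" "p + b < 1" using z by (auto simp: sector_def p_def b_def)
  have q: "sq z = p\<^sup>2 + p * b + b\<^sup>2" unfolding sq_albe p_def b_def by (simp add: power2_eq_square algebra_simps)
  have q0: "0 \<le> sq z" by simp
  have 0: "sq z < p + b"
  proof -
    have "(p + b) * (p + b) < p + b" "0 < p * b" using pos by simp_all
    then show ?thesis unfolding q by (simp add: power2_eq_square algebra_simps)
  qed
  have 1: "2 * b \<le> sq z + 1"
  proof -
    have "0 \<le> (b - 1)\<^sup>2" "0 < p * b" "0 < p * p" using pos by simp_all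
    then show ?thesis unfolding q by (simp add: power2_eq_square algebra_simps)
  qed
  have 2: "2 * p \<le> sq z + 1"
  proof -
    have "0 \<le> (p - 1)\<^sup>2" "0 < p * b" "0 < b * b" using pos by simp_all
    then show ?thesis unfolding q by (simp add: power2_eq_square algebra_simps)
  qed
  have 3: "\<not> sq z < b - (p + b)" "\<not> sq z < - (p + b)" "\<not> sq z < - b"
    "\<not> sq z + 1 < 2 * (b - (p + b))" "\<not> sq z + 1 < 2 * - (p + b)" "\<not> sq z + 1 < 2 * - b"
    "\<not> sq z + 1 < 2 * b" "\<not> sq z + 1 < 2 * (p + b - b)"
    "b - (p + b) < 1" "- (p + b) < 1" "- b < 1" "b < 1" "p + b - b < 1"
  proof -
    define Q where "Q = sq z"
    have "0 \<le> Q" "2 * b \<le> Q + 1" "2 * p \<le> Q + 1" using 1 2 by (simp_all add: Q_def)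
    then show "\<not> sq z < b - (p + b)" "\<not> sq z < - (p + b)" "\<not> sq z < - b"
    "\<not> sq z + 1 < 2 * (b - (p + b))" "\<not> sq z + 1 < 2 * - (p + b)" "\<not> sq z + 1 < 2 * - b"
    "\<not> sq z + 1 < 2 * b" "\<not> sq z + 1 < 2 * (p + b - b)"
    "b - (p + b) < 1" "- (p + b) < 1" "- b < 1" "b < 1" "p + b - b < 1"
      unfolding Q_def[symmetric] using pos by auto
  qed
  show ?thesis
    unfolding stair_def
    apply (subst all_nbrs_iff[of _ "\<lambda>g. g z < 1 \<and> (sq z < g z \<longrightarrow> 3 * g w < 2 * sq w + 1)
     \<and> (sq z + 1 < 2 * g z \<longrightarrow> 3 * g w < sq w + 2)"])
     apply simp
    unfolding inA_def inB_def inC_def al using 0 3 \<open>p + b < 1\<close> by argo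
qed

text \<open>The regions \<open>Vstar1 4\<close>, \<open>Vstar1 5\<close> and \<open>Vstar1 6\<close>
  list the unit circle about \<open>eta\<close> but not the circle about \<open>eta / 2\<close>:
  when \<open>1 < sq w\<close>, the inequality \<open>3 * al w < sq w + 2\<close> implies
  \<open>3 * al w < 2 * sq w + 1\<close>.\<close>

lemma stair_Vstar1:
  assumes "z \<in> sector" "z \<notin> bad" "cell k z"
  shows "stair z w \<longleftrightarrow> w \<in> Vstar1 k"
proof -
  have n: "1 < cmod w \<longleftrightarrow> 1 < sq w" using norm_less_iff(2)[of 1 w] by simp
  show ?thesis
    unfolding stair_sector[OF assms(1)] Vstar1_def mem_Collect_eq n
      disc_iff[OF nbrs_named(1)] disc_iff[OF nbrs_named(2)] disc_iff[OF nbrs_named(3)] ev_named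
    using assms(3) sector_some[OF assms(1,2)] sector_not_all[OF assms(1)] unfolding cell_def
    by (auto split: if_splits)
qed

lemma stair_zeta: "stair (zeta * z) (zeta * w) \<longleftrightarrow> stair z w"
proof -
  have *: "(\<forall>e\<in>nbrs. P e) \<longleftrightarrow> (\<forall>e\<in>nbrs. P (zeta * e))" for P
  proof
    assume *: "\<forall>e\<in>nbrs. P (zeta * e)"
    show "\<forall>e\<in>nbrs. P e"
    proof
      fix e assume "e \<in> nbrs"
      then have "zeta ^ 5 * e \<in> nbrs" by (simp add: nbrs_def ideal_J_zeta_power)
      then have "P (zeta * (zeta ^ 5 * e))" using * by blast
      moreover have "zeta * (zeta ^ 5 * e) = e" using zeta_power_5[of e] by (simp add: mult.left_commute)
      ultimately show "P e" by simp
    qed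
  qed (use nbrs_zeta in blast)
  show ?thesis unfolding stair_def by (subst *) (simp add: norm_mult)
qed

lemma stair_zeta_power: "stair (zeta ^ k * z) (zeta ^ k * w) \<longleftrightarrow> stair z w"
  by (induction k) (simp_all add: mult.assoc stair_zeta)

lemma sector_exists:
  assumes "z \<in> hexagon" "z \<notin> bad"
  obtains l z' where "l < 6" "z = zeta ^ l * z'" "z' \<in> sector"
proof -
  have ne: "al z \<noteq> 0" "be z \<noteq> 0" "al z \<noteq> be z"
    using good_neq[OF assms(2), of 0 1 0 0] good_neq[OF assms(2), of 0 0 1 0] good_neq[OF assms(2), of 0 1 "-1" 0] by auto
  have h: "\<bar>al z\<bar> < 1" "\<bar>be z\<bar> < 1" "\<bar>al z - be z\<bar> < 1" using assms by (auto simp: hexagon_iff)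
  define y where "y k = zeta ^ k * z" for k
  have z6: "zeta ^ (6 - k) * y k = z" if "k \<le> 6" for k
    using zeta_power_6 that by (simp add: y_def mult.assoc[symmetric] power_add[symmetric])
  have y: "al (y 0) = al z" "be (y 0) = be z" "al (y 1) = al z - be z" "be (y 1) = al z"
    "al (y 2) = - be z" "be (y 2) = al z - be z" "al (y 3) = - al z" "be (y 3) = - be z"
    "al (y 4) = be z - al z" "be (y 4) = - al z" "al (y 5) = be z" "be (y 5) = be z - al z"
    by (simp_all add: y_def numeral_eq_Suc mult.assoc)
  consider "0 < be z" "be z < al z" | "0 < al z" "al z < be z" | "al z < 0" "0 < be z" |
    "be z < 0" "al z < be z" | "al z < 0" "be z < al z" | "0 < al z" "be z < 0" using ne by linarith
  then show ?thesis
  proof cases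
    case 1 then have "z \<in> sector" using h by (simp add: sector_def)
    with that[of 0 z] show ?thesis by simp
  next
    case 2 then have "y 5 \<in> sector" using h by (simp add: sector_def y)
    with that[of 1 "y 5"] z6[of 5] show ?thesis by simp
  next
    case 3 then have "y 4 \<in> sector" using h by (simp add: sector_def y)
    with that[of 2 "y 4"] z6[of 4] show ?thesis by simp
  next
    case 4 then have "y 3 \<in> sector" using h by (simp add: sector_def y)
    with that[of 3 "y 3"] z6[of 3] show ?thesis by simp
  next
    case 5 then have "y 2 \<in> sector" using h by (simp add: sector_def y)
    with that[of 4 "y 2"] z6[of 2] show ?thesis by simp
  next
    case 6 then have "y 1 \<in> sector" using h by (simp add: sector_def y[unfolded One_nat_def])
    with that[of 5 "y 1"] z6[of 1] show ?thesis by simp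
  qed
qed

lemma sector_unique:
  assumes "zeta ^ i * z = zeta ^ j * z'" "i < 6" "j < 6" "z \<in> sector" "z' \<in> sector"
  shows "i = j \<and> z = z'"
proof -
  have *: "i = j" if "zeta ^ i * z = zeta ^ j * z'" "i < 6" "j < 6" "z \<in> sector" "z' \<in> sector" "i \<le> j" for i j z z'
  proof (rule ccontr)
    assume "i \<noteq> j"
    then have k: "j - i \<in> {1,2,3,4,5}" using that by auto
    have "zeta ^ j = zeta ^ i * zeta ^ (j - i)" using that by (simp flip: power_add)
    then have "z = zeta ^ (j - i) * z'" using that(1) by (simp add: mult.assoc)
    then show False using k that(4,5) by (elim insertE emptyE) (auto simp: sector_def numeral_eq_Suc mult.assoc)
  qed
  have "i = j" using *[of i z j z'] *[of j z' i z] assms by (cases "i \<le> j") auto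
  then show ?thesis using assms(1) by simp
qed

lemma mem_V_iff:
  assumes "z \<notin> bad"
  shows "z \<in> V k l \<longleftrightarrow> (\<exists>z'. z = zeta ^ (l - 1) * z' \<and> z' \<in> sector \<and> cell k z' \<and> z' \<notin> bad)"
proof -
  have "zeta ^ (l - 1) * z' \<notin> bad \<longleftrightarrow> z' \<notin> bad" for z' by (simp add: bad_zeta_power)
  then show ?thesis unfolding V_def using assms V1_iff by auto
qed

lemma stair_Vstar:
  assumes "z \<notin> bad" "z \<in> V k l"
  shows "stair z w \<longleftrightarrow> w \<in> Vstar k l"
proof -
  obtain z' where z': "z = zeta ^ (l - 1) * z'" "z' \<in> sector" "cell k z'" "z' \<notin> bad"
    using assms mem_V_iff by blast
  define w' where "w' = w / zeta ^ (l - 1)"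
  have w: "w = zeta ^ (l - 1) * w'" by (simp add: w'_def)
  have "w \<in> Vstar k l \<longleftrightarrow> w' \<in> Vstar1 k" unfolding Vstar_def w by (auto simp: image_iff)
  then show ?thesis using stair_Vstar1[OF z'(2,4,3)] unfolding z'(1) w stair_zeta_power by blast
qed

lemma V_exists:
  assumes "z \<in> hexagon" "z \<notin> bad"
  obtains k l where "k \<in> {1..6}" "l \<in> {1..6}" "z \<in> V k l"
proof -
  obtain l z' where l: "l < 6" "z = zeta ^ l * z'" "z' \<in> sector" using sector_exists[OF assms] .
  have g: "z' \<notin> bad" using assms(2) by (simp add: l bad_zeta_power)
  obtain k where k: "k \<in> {1..6}" "cell k z'" using cell_exists[OF l(3) g] by blast
  have "z \<in> V k (Suc l)" using mem_V_iff[OF assms(2)] l k g by auto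
  then show ?thesis using that[of k "Suc l"] k l by auto
qed

lemma V_disjoint:
  assumes "z \<notin> bad" "z \<in> V k l" "z \<in> V k' l'" "l \<in> {1..6}" "l' \<in> {1..6}"
  shows "k = k' \<and> l = l'"
proof -
  obtain z' where z: "z = zeta ^ (l - 1) * z'" "z' \<in> sector" "cell k z'" "z' \<notin> bad"
    using assms mem_V_iff by blast
  obtain z'' where z'': "z = zeta ^ (l' - 1) * z''" "z'' \<in> sector" "cell k' z''"
    using assms mem_V_iff by blast
  have "l - 1 = l' - 1 \<and> z' = z''"
    by (rule sector_unique) (use z z'' assms in auto)
  then show ?thesis using cell_unique z z'' assms by auto
qed

lemma hat_U_iff:
  assumes "z \<notin> bad"
  shows "(z, w) \<in> hat_U \<longleftrightarrow> stair z w"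
proof
  assume "(z, w) \<in> hat_U"
  then show "stair z w" using stair_Vstar[OF assms] by (auto simp: hat_U_def)
next
  assume s: "stair z w"
  then have "z \<in> hexagon" by (simp add: stair_def hexagon_def)
  then obtain k l where "k \<in> {1..6}" "l \<in> {1..6}" "z \<in> V k l" using V_exists assms by blast
  then show "(z, w) \<in> hat_U" using stair_Vstar[OF assms] s unfolding hat_U_def by blast
qed

section \<open>Lebesgue measure on the complex plane\<close>

lemma measurable_Complex [measurable (raw)]:
  assumes "f \<in> borel_measurable M" "g \<in> borel_measurable M"
  shows "(\<lambda>x. Complex (f x) (g x)) \<in> borel_measurable M"
  using assms unfolding complex_eq_iff by (simp add: borel_measurable_complex_iff)

lemma lborel_complex: "(lborel :: complex measure) = distr (lborel \<Otimes>\<^sub>M lborel) borel (\<lambda>(x, y). Complex x y)"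
proof (rule lborel_eqI)
  fix l u :: complex assume le: "\<And>b. b \<in> Basis \<Longrightarrow> l \<bullet> b \<le> u \<bullet> b"
  have le': "Re l \<le> Re u" "Im l \<le> Im u" using le[of 1] le[of \<i>] by (auto simp: Basis_complex_def inner_complex_def)
  have "(\<lambda>(x, y). Complex x y) -` box l u \<inter> space (lborel \<Otimes>\<^sub>M lborel) = {Re l<..<Re u} \<times> {Im l<..<Im u}"
    by (auto simp: box_def Basis_complex_def inner_complex_def space_pair_measure)
  then have "emeasure (distr (lborel \<Otimes>\<^sub>M lborel) borel (\<lambda>(x, y). Complex x y)) (box l u)
    = emeasure (lborel \<Otimes>\<^sub>M lborel) ({Re l<..<Re u} \<times> {Im l<..<Im u})"
    by (subst emeasure_distr) auto
  also have "\<dots> = ennreal (Re u - Re l) * ennreal (Im u - Im l)"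
    using le' by (subst lborel.emeasure_pair_measure_Times) auto
  also have "\<dots> = (\<Prod>b\<in>Basis. (u - l) \<bullet> b)"
    using le' by (simp add: Basis_complex_def inner_complex_def ennreal_mult)
  finally show "emeasure (distr (lborel \<Otimes>\<^sub>M lborel) borel (\<lambda>(x, y). Complex x y)) (box l u) = (\<Prod>b\<in>Basis. (u - l) \<bullet> b)" .
qed simp

lemma nn_integral_complex:
  assumes [measurable]: "f \<in> borel_measurable borel"
  shows "(\<integral>\<^sup>+z. f z \<partial>lborel) = (\<integral>\<^sup>+x. \<integral>\<^sup>+y. f (Complex x y) \<partial>lborel \<partial>lborel)"
    "(\<integral>\<^sup>+z. f z \<partial>lborel) = (\<integral>\<^sup>+y. \<integral>\<^sup>+x. f (Complex x y) \<partial>lborel \<partial>lborel)"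
proof -
  have "(\<integral>\<^sup>+z. f z \<partial>lborel) = (\<integral>\<^sup>+p. f (case p of (x, y) \<Rightarrow> Complex x y) \<partial>(lborel \<Otimes>\<^sub>M lborel))"
    by (subst lborel_complex, subst nn_integral_distr) auto
  also have "\<dots> = (\<integral>\<^sup>+p. (\<lambda>(x, y). f (Complex x y)) p \<partial>(lborel \<Otimes>\<^sub>M lborel))"
    by (intro nn_integral_cong) (auto split: prod.splits)
  finally have *: "(\<integral>\<^sup>+z. f z \<partial>lborel) = (\<integral>\<^sup>+p. (\<lambda>(x, y). f (Complex x y)) p \<partial>(lborel \<Otimes>\<^sub>M lborel))" .
  show "(\<integral>\<^sup>+z. f z \<partial>lborel) = (\<integral>\<^sup>+x. \<integral>\<^sup>+y. f (Complex x y) \<partial>lborel \<partial>lborel)"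
    unfolding * by (subst lborel.nn_integral_fst[symmetric]) auto
  show "(\<integral>\<^sup>+z. f z \<partial>lborel) = (\<integral>\<^sup>+y. \<integral>\<^sup>+x. f (Complex x y) \<partial>lborel \<partial>lborel)"
    unfolding * by (subst lborel_pair.nn_integral_snd[symmetric]) auto
qed

lemma measurable_al [measurable]: "al \<in> borel_measurable borel"
  unfolding al_def[abs_def] by measurable

lemma measurable_be [measurable]: "be \<in> borel_measurable borel"
  unfolding be_def[abs_def] by measurable

lemma finite_quadratic:
  fixes a b c :: real
  assumes "a \<noteq> 0 \<or> b \<noteq> 0"
  shows "finite {x. a * x\<^sup>2 + b * x + c = 0}"
proof -
  have "finite {x. poly [:c, b, a:] x = 0}" using assms by (intro poly_roots_finite) auto
  then show ?thesis by (simp add: power2_eq_square algebra_simps)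
qed

text \<open>A single curve meets every horizontal line in finitely many points unless
  \<open>x\<close> drops out of its equation, and then the vertical lines do the same.\<close>

lemma bad_null: "bad \<in> null_sets lborel"
proof -
  define S where "S = (\<lambda>(A, m, n, C). {z. of_int A * sq z + of_int m * al z + of_int n * be z + of_int C = 0})"
  define I :: "(int \<times> int \<times> int \<times> int) set" where "I = - {(0, 0, 0, 0)}"
  have eq: "bad = (\<Union>i\<in>I. S i)" unfolding bad_def S_def I_def by auto
  have "S i \<in> null_sets lborel" if i: "i \<in> I" for i
  proof -
    obtain A m n C where Si: "i = (A, m, n, C)" by (cases i) auto
    have nz: "A \<noteq> 0 \<or> m \<noteq> 0 \<or> n \<noteq> 0 \<or> C \<noteq> 0" using i Si by (auto simp: I_def)
    have [measurable]: "S i \<in> sets borel" unfolding S_def Si by simp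
    have mem: "Complex x y \<in> S i \<longleftrightarrow> of_int A * x\<^sup>2 + of_int m * x + (of_int A * y\<^sup>2 + (of_int m + 2 * of_int n) / sqrt 3 * y + of_int C) = 0" for x y
      by (simp add: S_def Si cmod_power2 al_def be_def add_divide_distrib algebra_simps)
    have z: "(\<integral>\<^sup>+x. indicator F x \<partial>lborel) = 0" if "finite F" for F :: "real set"
      using null_setsD1[OF finite_imp_null_set_lborel[OF that]] finite_imp_null_set_lborel[OF that]
      by (subst nn_integral_indicator) auto
    have "(\<integral>\<^sup>+z. indicator (S i) z \<partial>lborel) = 0"
    proof (cases "A = 0 \<and> m = 0")
      case False
      have "(\<integral>\<^sup>+x. indicator (S i) (Complex x y) \<partial>lborel) = 0" for y
      proof -
        have "finite {x. Complex x y \<in> S i}" unfolding mem by (rule finite_quadratic) (use False in auto)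
        from z[OF this] show ?thesis by (simp add: indicator_def)
      qed
      then show ?thesis by (subst nn_integral_complex(2)) auto
    next
      case True
      have "(\<integral>\<^sup>+y. indicator (S i) (Complex x y) \<partial>lborel) = 0" for x
      proof -
        have "finite {y. Complex x y \<in> S i}"
        proof (cases "n = 0")
          case False
          have "finite {y. 0 * y\<^sup>2 + (2 * of_int n) / sqrt 3 * y + of_int C = 0}"
            by (rule finite_quadratic) (use False in auto)
          then show ?thesis unfolding mem using True by simp
        next
          case n0: True
          then show ?thesis unfolding mem using True nz by simp
        qed
        from z[OF this] show ?thesis by (simp add: indicator_def)
      qed
      then show ?thesis by (subst nn_integral_complex(1)) auto
    qed
    then show ?thesis by (intro null_setsI) auto
  qed
  then show ?thesis unfolding eq by (rule null_sets_UN'[OF countableI_type])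
qed

lemma bad_measurable [measurable]: "bad \<in> sets borel"
  using bad_null by (auto simp: null_sets_def)

section \<open>Behaviour of Lebesgue measure under inversion, rotation and translation\<close>

lemma nn_integral_inverse_real:
  fixes f :: "real \<Rightarrow> ennreal"
  assumes [measurable]: "f \<in> borel_measurable borel"
  shows "(\<integral>\<^sup>+x. f (1 / x) * ennreal (1 / x\<^sup>2) \<partial>lborel) = (\<integral>\<^sup>+x. f x \<partial>lborel)"
proof -
  have "lborel = distr (density lborel (\<lambda>x. ennreal (1 / x\<^sup>2))) borel (\<lambda>x::real. 1 / x)" (is "_ = ?M")
  proof (rule lborel_eqI)
    fix l u :: real assume "\<And>b. b \<in> Basis \<Longrightarrow> l \<bullet> b \<le> u \<bullet> b"
    then have lu: "l \<le> u" by simp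
    let ?f = "indicat_real {l<..<u}"
    let ?g = "\<lambda>x::real. 1 / x" and ?S = "UNIV - {0::real}"
    have "\<And>x. x \<in> ?S \<Longrightarrow> (?g has_field_derivative (- 1 / x\<^sup>2)) (at x within ?S)"
      by (auto intro!: derivative_eq_intros simp: power2_eq_square)
    moreover have "inj_on ?g ?S" by (auto simp: inj_on_def)
    moreover have img: "?g ` ?S = ?S"
    proof (intro equalityI subsetI)
      fix x :: real assume "x \<in> ?S"
      then show "x \<in> ?g ` ?S" by (intro image_eqI[of _ _ "1 / x"]) auto
    qed auto
    moreover have I: "(?f has_integral (u - l)) ?S"
    proof -
      have "(?f has_integral (u - l)) UNIV"
        using has_integral_integral_lborel[of ?f] lu by (simp add: emeasure_lborel_Ioo)
      moreover have "negligible {x \<in> UNIV - ?S. ?f x \<noteq> 0}" "negligible {x \<in> ?S - UNIV. ?f x \<noteq> 0}"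
        by (rule negligible_subset[of "{0}"]; auto)+
      ultimately show ?thesis using has_integral_spike_set_eq by blast
    qed
    moreover have "?f absolutely_integrable_on ?S"
      using I by (intro nonnegative_absolutely_integrable_1) auto
    ultimately have "(\<lambda>x. \<bar>- 1 / x\<^sup>2\<bar> * ?f (1 / x)) absolutely_integrable_on ?S \<and>
      integral ?S (\<lambda>x. \<bar>- 1 / x\<^sup>2\<bar> * ?f (1 / x)) = u - l"
      by (subst has_absolute_integral_change_of_variables_1') (auto simp: integral_unique)
    then have "((\<lambda>x. \<bar>- 1 / x\<^sup>2\<bar> * ?f (1 / x)) has_integral (u - l)) ?S"
      using set_lebesgue_integral_eq_integral(1) by (metis has_integral_integrable_integral)
    \<comment> \<open>Passing from the punctured line to \<open>UNIV\<close> adds only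
      \<open>x = 0\<close>, where the integrand vanishes because division by zero gives 0.\<close>
    then have "((\<lambda>x. \<bar>- 1 / x\<^sup>2\<bar> * ?f (1 / x)) has_integral (u - l)) UNIV"
      by (rule has_integral_on_superset) auto
    then have "(\<integral>\<^sup>+x. ennreal (\<bar>- 1 / x\<^sup>2\<bar> * ?f (1 / x)) \<partial>lborel) = ennreal (u - l)"
      by (intro nn_integral_has_integral_lborel) auto
    moreover have "ennreal (\<bar>- 1 / x\<^sup>2\<bar> * ?f (1 / x)) = ennreal (1 / x\<^sup>2) * indicator ((\<lambda>x. 1 / x) -` {l<..<u}) x" for x
      by (auto simp: indicator_def)
    moreover have "(\<lambda>x. 1 / x) -` {l<..<u} \<in> sets borel"
      by (rule measurable_sets_borel[of _ borel]) measurable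
    ultimately show "emeasure ?M (box l u) = (\<Prod>b\<in>Basis. (u - l) \<bullet> b)"
      by (simp add: emeasure_distr emeasure_density box_real)
  qed simp
  then have "(\<integral>\<^sup>+x. f x \<partial>lborel) = (\<integral>\<^sup>+x. f x \<partial>?M)" by simp
  also have "\<dots> = (\<integral>\<^sup>+x. f (1 / x) * ennreal (1 / x\<^sup>2) \<partial>lborel)"
    by (simp add: nn_integral_distr nn_integral_density mult.commute)
  finally show ?thesis ..
qed

text \<open>In slope coordinates \<open>y = x * s\<close>, inversion negates \<open>s\<close> and
  sends \<open>x\<close> to \<open>1 / (x * (1 + s^2))\<close>. For each fixed slope this is the
  inversion of the real line followed by a dilation; the factor \<open>|x|\<close> is the Jacobian
  of the slope coordinates, introduced at the start and removed at the end.\<close>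

lemma nn_integral_inverse_complex:
  fixes f :: "complex \<Rightarrow> ennreal"
  assumes [measurable]: "f \<in> borel_measurable borel"
  shows "(\<integral>\<^sup>+z. f (1 / z) * ennreal (1 / cmod z ^ 4) \<partial>lborel) = (\<integral>\<^sup>+z. f z \<partial>lborel)"
proof -
  have inv: "1 / Complex x (x * s) = Complex (1 / x * (1 / (1 + s\<^sup>2))) (- s * (1 / x * (1 / (1 + s\<^sup>2))))" if "x \<noteq> 0" for x s
  proof -
    have p: "1 + s\<^sup>2 > 0" "x\<^sup>2 > 0" using that by (auto intro: add_pos_nonneg)
    have "x\<^sup>2 + (x * s)\<^sup>2 = x\<^sup>2 * (1 + s\<^sup>2)" by (simp add: power2_eq_square algebra_simps)
    then show ?thesis using p that
      by (simp add: complex_eq_iff Re_divide Im_divide cmod_power2) (simp add: power2_eq_square)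
  qed
  have nrm: "1 / cmod (Complex x (x * s)) ^ 4 = 1 / x ^ 4 * (1 / (1 + s\<^sup>2)\<^sup>2)" for x s
  proof -
    have "cmod (Complex x (x * s)) ^ 4 = (cmod (Complex x (x * s)) ^ 2)\<^sup>2" by simp
    also have "cmod (Complex x (x * s)) ^ 2 = x\<^sup>2 * (1 + s\<^sup>2)" by (simp add: cmod_power2) (simp add: power2_eq_square algebra_simps)
    finally show ?thesis by (simp add: power_mult_distrib)
  qed
  have "(\<integral>\<^sup>+z. f (1 / z) * ennreal (1 / cmod z ^ 4) \<partial>lborel)
    = (\<integral>\<^sup>+x. \<integral>\<^sup>+y. f (1 / Complex x y) * ennreal (1 / cmod (Complex x y) ^ 4) \<partial>lborel \<partial>lborel)"
    by (subst nn_integral_complex(1)) auto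
  also have "\<dots> = (\<integral>\<^sup>+x. \<integral>\<^sup>+s. ennreal \<bar>x\<bar> * (f (1 / Complex x (x * s)) * ennreal (1 / cmod (Complex x (x * s)) ^ 4)) \<partial>lborel \<partial>lborel)"
  proof (rule nn_integral_cong_AE, rule AE_mp[OF AE_lborel_singleton[of 0]], rule AE_I2, rule impI)
    fix x :: real assume "x \<noteq> 0"
    then show "(\<integral>\<^sup>+y. f (1 / Complex x y) * ennreal (1 / cmod (Complex x y) ^ 4) \<partial>lborel) =
      (\<integral>\<^sup>+s. ennreal \<bar>x\<bar> * (f (1 / Complex x (x * s)) * ennreal (1 / cmod (Complex x (x * s)) ^ 4)) \<partial>lborel)"
      by (subst nn_integral_real_affine[where c = x and t = 0]) (auto simp: nn_integral_cmult)
  qed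
  also have "\<dots> = (\<integral>\<^sup>+s. \<integral>\<^sup>+x. ennreal \<bar>x\<bar> * (f (1 / Complex x (x * s)) * ennreal (1 / cmod (Complex x (x * s)) ^ 4)) \<partial>lborel \<partial>lborel)"
    by (rule lborel_pair.Fubini') measurable
  also have "\<dots> = (\<integral>\<^sup>+s. \<integral>\<^sup>+x. ennreal \<bar>x\<bar> * f (Complex x (- s * x)) \<partial>lborel \<partial>lborel)"
  proof (rule nn_integral_cong)
    fix s :: real
    define r where "r = 1 + s\<^sup>2"
    have r: "r > 0" unfolding r_def by (auto intro: add_pos_nonneg)
    \<comment> \<open>\<open>\<phi>\<close> is the slice integrand as a function of
      \<open>t = 1 / x\<close>: the weight \<open>|x| / x^4\<close> splits into
      \<open>|1 / x|\<close> and the factor \<open>1 / x^2\<close> that the real inversion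
      consumes.\<close>
    define \<phi> where "\<phi> t = ennreal (\<bar>t\<bar> / r\<^sup>2) * f (Complex (t * (1 / r)) (- s * (t * (1 / r))))" for t
    have [measurable]: "\<phi> \<in> borel_measurable borel" unfolding \<phi>_def by measurable
    have "(\<integral>\<^sup>+x. ennreal \<bar>x\<bar> * (f (1 / Complex x (x * s)) * ennreal (1 / cmod (Complex x (x * s)) ^ 4)) \<partial>lborel)
      = (\<integral>\<^sup>+x. \<phi> (1 / x) * ennreal (1 / x\<^sup>2) \<partial>lborel)"
    proof (rule nn_integral_cong_AE, rule AE_mp[OF AE_lborel_singleton[of 0]], rule AE_I2, rule impI)
      fix x :: real assume x: "x \<noteq> 0"
      have "\<bar>x\<bar> * (1 / x ^ 4 * (1 / r\<^sup>2)) = \<bar>1 / x\<bar> / r\<^sup>2 * (1 / x\<^sup>2)"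
      proof -
        define y where "y = \<bar>x\<bar>"
        have y: "y > 0" "x ^ 4 = y ^ 4" "x\<^sup>2 = y\<^sup>2" "\<bar>1 / x\<bar> = 1 / y" using x by (simp_all add: y_def power_even_abs)
        show ?thesis unfolding y(2-4) y_def[symmetric] using y(1) r
          by (simp add: field_simps power2_eq_square power4_eq_xxxx)
      qed
      then have eq: "ennreal \<bar>x\<bar> * ennreal (1 / x ^ 4 * (1 / r\<^sup>2)) = ennreal (\<bar>1 / x\<bar> / r\<^sup>2) * ennreal (1 / x\<^sup>2)"
        by (simp add: ennreal_mult[symmetric])
      have "ennreal \<bar>x\<bar> * (F * ennreal (1 / x ^ 4 * (1 / r\<^sup>2))) = (ennreal (\<bar>1 / x\<bar> / r\<^sup>2) * F) * ennreal (1 / x\<^sup>2)" for F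
      proof -
        have "ennreal \<bar>x\<bar> * (F * ennreal (1 / x ^ 4 * (1 / r\<^sup>2))) = (ennreal \<bar>x\<bar> * ennreal (1 / x ^ 4 * (1 / r\<^sup>2))) * F"
          by (simp only: ac_simps)
        also have "\<dots> = (ennreal (\<bar>1 / x\<bar> / r\<^sup>2) * F) * ennreal (1 / x\<^sup>2)" unfolding eq by (simp only: ac_simps)
        finally show ?thesis .
      qed
      then show "ennreal \<bar>x\<bar> * (f (1 / Complex x (x * s)) * ennreal (1 / cmod (Complex x (x * s)) ^ 4)) = \<phi> (1 / x) * ennreal (1 / x\<^sup>2)"
        unfolding \<phi>_def nrm inv[OF x] r_def .
    qed
    also have "\<dots> = (\<integral>\<^sup>+x. \<phi> x \<partial>lborel)" by (rule nn_integral_inverse_real) measurable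
    also have "\<dots> = ennreal \<bar>r\<bar> * (\<integral>\<^sup>+x. \<phi> (0 + r * x) \<partial>lborel)"
      by (rule nn_integral_real_affine) (use r in auto)
    also have "\<dots> = (\<integral>\<^sup>+x. ennreal r * \<phi> (r * x) \<partial>lborel)" using r by (simp add: nn_integral_cmult)
    also have "\<dots> = (\<integral>\<^sup>+x. ennreal \<bar>x\<bar> * f (Complex x (- s * x)) \<partial>lborel)"
    proof (intro nn_integral_cong)
      fix x
      have "ennreal r * ennreal (\<bar>r * x\<bar> / r\<^sup>2) = ennreal \<bar>x\<bar>"
        using r by (simp add: ennreal_mult[symmetric] abs_mult power2_eq_square)
      then show "ennreal r * \<phi> (r * x) = ennreal \<bar>x\<bar> * f (Complex x (- s * x))"
        using r by (simp add: \<phi>_def mult.assoc[symmetric])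
    qed
    finally show "(\<integral>\<^sup>+x. ennreal \<bar>x\<bar> * (f (1 / Complex x (x * s)) * ennreal (1 / cmod (Complex x (x * s)) ^ 4)) \<partial>lborel)
      = (\<integral>\<^sup>+x. ennreal \<bar>x\<bar> * f (Complex x (- s * x)) \<partial>lborel)" .
  qed
  also have "\<dots> = (\<integral>\<^sup>+x. \<integral>\<^sup>+s. ennreal \<bar>x\<bar> * f (Complex x (- s * x)) \<partial>lborel \<partial>lborel)"
    by (rule lborel_pair.Fubini'[symmetric]) measurable
  also have "\<dots> = (\<integral>\<^sup>+x. \<integral>\<^sup>+y. f (Complex x y) \<partial>lborel \<partial>lborel)"
  proof (rule nn_integral_cong_AE, rule AE_mp[OF AE_lborel_singleton[of 0]], rule AE_I2, rule impI)
    fix x :: real assume "x \<noteq> 0"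
    then show "(\<integral>\<^sup>+s. ennreal \<bar>x\<bar> * f (Complex x (- s * x)) \<partial>lborel) = (\<integral>\<^sup>+y. f (Complex x y) \<partial>lborel)"
      by (subst (2) nn_integral_real_affine[where c = "- x" and t = 0]) (auto simp: nn_integral_cmult mult.commute)
  qed
  also have "\<dots> = (\<integral>\<^sup>+z. f z \<partial>lborel)" by (rule nn_integral_complex(1)[symmetric]) measurable
  finally show ?thesis .
qed

text \<open>A rotation is a product of three shears, and a shear acts as a translation on each line
  of a parallel family. Here \<open>t\<close> is minus the tangent of half the angle, written with
  \<open>Im c\<close> in the denominator.\<close>

lemma nn_integral_rotate_complex:
  fixes f :: "complex \<Rightarrow> ennreal"
  assumes [measurable]: "f \<in> borel_measurable borel" and c: "cmod c = 1" "Im c \<noteq> 0"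
  shows "(\<integral>\<^sup>+z. f (c * z) \<partial>lborel) = (\<integral>\<^sup>+z. f z \<partial>lborel)"
proof -
  define a b t where "a = Re c" and "b = Im c" and "t = (a - 1) / b"
  have ab: "a\<^sup>2 + b\<^sup>2 = 1" using c(1) cmod_power2[of c] by (simp add: a_def b_def)
  have b: "b \<noteq> 0" using c(2) by (simp add: b_def)
  have shx: "(\<integral>\<^sup>+z. g z \<partial>lborel) = (\<integral>\<^sup>+z. g (Complex (Re z + k * Im z) (Im z)) \<partial>lborel)"
    if [measurable]: "g \<in> borel_measurable borel" for g :: "complex \<Rightarrow> ennreal" and k
    apply (subst (1 2) nn_integral_complex(2))
      apply measurable
    apply (rule nn_integral_cong)
    subgoal for y using nn_integral_real_affine[of "\<lambda>x. g (Complex x y)" 1 "k * y"] by (simp add: add.commute)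
    done
  have shy: "(\<integral>\<^sup>+z. g z \<partial>lborel) = (\<integral>\<^sup>+z. g (Complex (Re z) (Im z + k * Re z)) \<partial>lborel)"
    if [measurable]: "g \<in> borel_measurable borel" for g :: "complex \<Rightarrow> ennreal" and k
    apply (subst (1 2) nn_integral_complex(1))
      apply measurable
    apply (rule nn_integral_cong)
    subgoal for x using nn_integral_real_affine[of "\<lambda>y. g (Complex x y)" 1 "k * x"] by (simp add: add.commute)
    done
  have t: "t * b = a - 1" using b by (simp add: t_def)
  have t2: "t * (a + 1) = - b"
  proof -
    have "b * (t * (a + 1)) = (t * b) * (a + 1)" by simp
    also have "\<dots> = (a - 1) * (a + 1)" by (simp only: t)
    also have "\<dots> = b * (- b)" using ab by (simp add: power2_eq_square algebra_simps)
    finally show ?thesis by (simp only: mult_left_cancel[OF b])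
  qed
  have "(\<integral>\<^sup>+z. f z \<partial>lborel) = (\<integral>\<^sup>+z. f (Complex (Re z + t * Im z) (Im z)) \<partial>lborel)" by (rule shx) measurable
  also have "\<dots> = (\<integral>\<^sup>+z. f (Complex (Re z + t * (Im z + b * Re z)) (Im z + b * Re z)) \<partial>lborel)"
    by (subst shy[where k = b]) simp_all
  also have "\<dots> = (\<integral>\<^sup>+z. f (Complex (Re z + t * Im z + t * (Im z + b * (Re z + t * Im z))) (Im z + b * (Re z + t * Im z))) \<partial>lborel)"
    by (subst shx[where k = t]) simp_all
  also have "\<dots> = (\<integral>\<^sup>+z. f (c * z) \<partial>lborel)"
  proof (intro nn_integral_cong)
    fix z :: complex
    have t1: "1 + t * b = a" using t by simp
    have "Im z + b * (Re z + t * Im z) = (1 + t * b) * Im z + b * Re z" by (simp add: algebra_simps)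
    then have "Im z + b * (Re z + t * Im z) = a * Im z + b * Re z" by (simp only: t1)
    moreover have "Re z + t * Im z + t * (a * Im z + b * Re z) = a * Re z - b * Im z"
    proof -
      have "Re z + t * Im z + t * (a * Im z + b * Re z) = Re z * (1 + t * b) + Im z * (t * (a + 1))" by (simp add: algebra_simps)
      then show ?thesis by (simp only: t1 t2) simp
    qed
    ultimately have "Complex (Re z + t * Im z + t * (Im z + b * (Re z + t * Im z))) (Im z + b * (Re z + t * Im z)) = c * z"
      by (simp add: complex_eq_iff a_def b_def)
    then show "f (Complex (Re z + t * Im z + t * (Im z + b * (Re z + t * Im z))) (Im z + b * (Re z + t * Im z))) = f (c * z)" by simp
  qed
  finally show ?thesis ..
qed

lemma nn_integral_translate_complex:
  fixes f :: "complex \<Rightarrow> ennreal"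
  assumes [measurable]: "f \<in> borel_measurable borel"
  shows "(\<integral>\<^sup>+z. f (z + c) \<partial>lborel) = (\<integral>\<^sup>+z. f z \<partial>lborel)"
proof -
  have "(\<integral>\<^sup>+z. f z \<partial>lborel) = (\<integral>\<^sup>+z. f z \<partial>(distr lborel borel ((+) c)))" by (simp add: lborel_distr_plus)
  also have "\<dots> = (\<integral>\<^sup>+z. f (c + z) \<partial>lborel)" by (rule nn_integral_distr) auto
  finally show ?thesis by (simp add: add.commute)
qed

section \<open>Finiteness of the total mass\<close>

definition kap :: "complex \<Rightarrow> complex \<Rightarrow> ennreal" where "kap z w = ennreal (1 / cmod (z - w) ^ 4)"

lemma kap_sym: "kap z w = kap w z" by (simp add: kap_def norm_minus_commute)

lemma measurable_kap [measurable (raw)]: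
  assumes [measurable]: "f \<in> borel_measurable M" "g \<in> borel_measurable M"
  shows "(\<lambda>x. kap (f x) (g x)) \<in> borel_measurable M"
  unfolding kap_def by measurable

definition J0 :: ennreal where "J0 = (\<integral>\<^sup>+x. ennreal (1 / (1 + x\<^sup>2)) \<partial>(lborel :: real measure))"

lemma J0_finite: "J0 < \<infinity>"
proof -
  have "integrable lborel (\<lambda>x::real. inverse (1 + x\<^sup>2))"
    using integrable_inverse_1_plus_square by (simp add: set_integrable_def)
  then have "(\<integral>\<^sup>+x. ennreal (norm (inverse (1 + x\<^sup>2))) \<partial>(lborel :: real measure)) < \<infinity>"
    by (simp add: integrable_iff_bounded)
  moreover have "norm (inverse (1 + x\<^sup>2)) = 1 / (1 + x\<^sup>2)" for x :: real
    by (simp add: inverse_eq_divide)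
  ultimately show ?thesis unfolding J0_def by simp
qed

lemma nn_integral_cauchy:
  assumes d: "0 < d"
  shows "(\<integral>\<^sup>+x. ennreal (1 / (d\<^sup>2 + x\<^sup>2)) \<partial>(lborel :: real measure)) = ennreal (1 / d) * J0"
proof -
  have "(\<integral>\<^sup>+x. ennreal (1 / (d\<^sup>2 + x\<^sup>2)) \<partial>(lborel :: real measure)) = ennreal d * (\<integral>\<^sup>+x. ennreal (1 / (d\<^sup>2 + (0 + d * x)\<^sup>2)) \<partial>lborel)"
    using nn_integral_real_affine[of "\<lambda>x. ennreal (1 / (d\<^sup>2 + x\<^sup>2))" d 0] d by simp
  also have "(\<integral>\<^sup>+x. ennreal (1 / (d\<^sup>2 + (0 + d * x)\<^sup>2)) \<partial>lborel) = (\<integral>\<^sup>+x. ennreal (1 / d\<^sup>2) * ennreal (1 / (1 + x\<^sup>2)) \<partial>lborel)"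
  proof (rule nn_integral_cong)
    fix x :: real
    have "d\<^sup>2 + (0 + d * x)\<^sup>2 = d\<^sup>2 * (1 + x\<^sup>2)" by (simp add: power2_eq_square algebra_simps)
    then show "ennreal (1 / (d\<^sup>2 + (0 + d * x)\<^sup>2)) = ennreal (1 / d\<^sup>2) * ennreal (1 / (1 + x\<^sup>2))"
      by (simp add: ennreal_mult[symmetric])
  qed
  also have "\<dots> = ennreal (1 / d\<^sup>2) * J0" unfolding J0_def by (rule nn_integral_cmult) measurable
  also have "ennreal d * (ennreal (1 / d\<^sup>2) * J0) = ennreal (1 / d) * J0"
    using d by (simp add: mult.assoc[symmetric] ennreal_mult[symmetric] power2_eq_square)
  finally show ?thesis .
qed

text \<open>With \<open>s = x^2 + y^2 \<ge> d^2\<close>, the product of \<open>d^2 + x^2\<close> and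
  \<open>d^2 + y^2\<close> is \<open>d^4 + d^2 * s + x^2 * y^2\<close>, at most
  \<open>3 * s^2\<close>. The kernel is thus dominated by a product of two Cauchy densities.\<close>

lemma tail_bound:
  assumes d: "0 < d"
  shows "(\<integral>\<^sup>+w. indicator {w. d \<le> cmod (z - w)} w * kap z w \<partial>lborel) \<le> ennreal (3 / d\<^sup>2) * (J0 * J0)"
proof -
  define f where "f w = indicator {w. d \<le> cmod (z - w)} w * kap z w" for w
  have [measurable]: "f \<in> borel_measurable borel" unfolding f_def by measurable
  have le: "f (Complex x y + z) \<le> ennreal 3 * (ennreal (1 / (d\<^sup>2 + x\<^sup>2)) * ennreal (1 / (d\<^sup>2 + y\<^sup>2)))" for x y
  proof (cases "d \<le> cmod (Complex x y)")
    case True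
    define s where "s = x\<^sup>2 + y\<^sup>2"
    have s: "cmod (Complex x y) ^ 4 = s\<^sup>2"
    proof -
      have "cmod (Complex x y) ^ 4 = (cmod (Complex x y) ^ 2)\<^sup>2" by simp
      then show ?thesis by (simp add: cmod_power2 s_def)
    qed
    have "d\<^sup>2 \<le> cmod (Complex x y) ^ 2" using d True by (intro power_mono) auto
    then have ds: "d\<^sup>2 \<le> s" by (simp add: cmod_power2 s_def)
    have s0: "0 < s" using ds d by (smt (verit) zero_less_power)
    have "d\<^sup>2 * d\<^sup>2 \<le> s * s" using ds s0 by (intro mult_mono) auto
    moreover have "d\<^sup>2 * s \<le> s * s" using ds s0 by (intro mult_right_mono) auto
    moreover have "x\<^sup>2 * y\<^sup>2 \<le> s * s" unfolding s_def by (intro mult_mono) auto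
    ultimately have "(d\<^sup>2 + x\<^sup>2) * (d\<^sup>2 + y\<^sup>2) \<le> 3 * s\<^sup>2" by (simp add: s_def power2_eq_square algebra_simps)
    moreover have p: "0 < (d\<^sup>2 + x\<^sup>2) * (d\<^sup>2 + y\<^sup>2)" using d by (intro mult_pos_pos add_pos_nonneg) auto
    ultimately have "1 / s\<^sup>2 \<le> 3 / ((d\<^sup>2 + x\<^sup>2) * (d\<^sup>2 + y\<^sup>2))" using s0 by (simp add: field_simps)
    then have "ennreal (1 / s\<^sup>2) \<le> ennreal (3 * (1 / (d\<^sup>2 + x\<^sup>2) * (1 / (d\<^sup>2 + y\<^sup>2))))" by (intro ennreal_leI) simp
    also have "\<dots> = ennreal 3 * (ennreal (1 / (d\<^sup>2 + x\<^sup>2)) * ennreal (1 / (d\<^sup>2 + y\<^sup>2)))"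
      by (subst ennreal_mult, simp, simp, subst ennreal_mult) simp_all
    finally show ?thesis using True unfolding f_def kap_def by (simp add: s norm_minus_commute)
  qed (simp add: f_def norm_minus_commute)
  have "(\<integral>\<^sup>+w. f w \<partial>lborel) = (\<integral>\<^sup>+w. f (w + z) \<partial>lborel)" by (rule nn_integral_translate_complex[symmetric]) measurable
  also have "\<dots> = (\<integral>\<^sup>+x. \<integral>\<^sup>+y. f (Complex x y + z) \<partial>lborel \<partial>lborel)" by (rule nn_integral_complex(1)) measurable
  also have "\<dots> \<le> (\<integral>\<^sup>+x. \<integral>\<^sup>+y. ennreal 3 * (ennreal (1 / (d\<^sup>2 + x\<^sup>2)) * ennreal (1 / (d\<^sup>2 + y\<^sup>2))) \<partial>lborel \<partial>lborel)"
    by (intro nn_integral_mono le)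
  also have "\<dots> = ennreal 3 * ((ennreal (1 / d) * J0) * (ennreal (1 / d) * J0))"
    by (simp add: nn_integral_cmult nn_integral_multc nn_integral_cauchy[OF d])
  also have "\<dots> = ennreal (3 / d\<^sup>2) * (J0 * J0)"
  proof -
    have "ennreal 3 * ((ennreal (1 / d) * J0) * (ennreal (1 / d) * J0)) = ennreal 3 * (ennreal (1 / d) * ennreal (1 / d)) * (J0 * J0)"
      by (simp only: ac_simps)
    also have "ennreal 3 * (ennreal (1 / d) * ennreal (1 / d)) = ennreal (3 * (1 / d * (1 / d)))"
    proof -
      have "ennreal (3 * (1 / d * (1 / d))) = ennreal 3 * ennreal (1 / d * (1 / d))" using d by (intro ennreal_mult) auto
      also have "ennreal (1 / d * (1 / d)) = ennreal (1 / d) * ennreal (1 / d)" using d by (intro ennreal_mult) auto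
      finally show ?thesis ..
    qed
    also have "3 * (1 / d * (1 / d)) = 3 / d\<^sup>2" by (simp add: power2_eq_square)
    finally show ?thesis .
  qed
  finally show ?thesis unfolding f_def .
qed

definition Itw :: "complex set \<Rightarrow> complex set \<Rightarrow> ennreal" where
  "Itw A B = (\<integral>\<^sup>+z. \<integral>\<^sup>+w. indicator A z * indicator B w * kap z w \<partial>lborel \<partial>lborel)"

lemma Itw_sym:
  assumes [measurable]: "A \<in> sets borel" "B \<in> sets borel"
  shows "Itw A B = Itw B A"
proof -
  have "Itw A B = (\<integral>\<^sup>+w. \<integral>\<^sup>+z. indicator A z * indicator B w * kap z w \<partial>lborel \<partial>lborel)"
    unfolding Itw_def by (rule lborel_pair.Fubini') measurable
  also have "\<dots> = Itw B A" unfolding Itw_def by (intro nn_integral_cong) (simp add: kap_sym mult.commute)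
  finally show ?thesis .
qed

lemma Itw_Un:
  assumes [measurable]: "A \<in> sets borel" "B \<in> sets borel" "A1 \<in> sets borel" "A2 \<in> sets borel" and sub: "A \<subseteq> A1 \<union> A2"
    and fin: "Itw A1 B < \<infinity>" "Itw A2 B < \<infinity>"
  shows "Itw A B < \<infinity>"
proof -
  have ind: "indicator A z \<le> indicator A1 z + (indicator A2 z :: ennreal)" for z using sub by (auto split: split_indicator)
  have "Itw A B \<le> (\<integral>\<^sup>+z. \<integral>\<^sup>+w. indicator A1 z * indicator B w * kap z w + indicator A2 z * indicator B w * kap z w \<partial>lborel \<partial>lborel)"
    unfolding Itw_def by (intro nn_integral_mono) (simp only: distrib_right[symmetric] mult_right_mono[OF ind] zero_le mult_right_mono)
  also have "\<dots> = Itw A1 B + Itw A2 B" unfolding Itw_def by (simp add: nn_integral_add)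
  also have "\<dots> < \<infinity>" using fin by simp
  finally show ?thesis .
qed

lemma Itw_AE_mono:
  assumes [measurable]: "A \<in> sets borel" "B \<in> sets borel" "A' \<in> sets borel" and sub: "A \<subseteq> A' \<union> bad"
  shows "Itw A B \<le> Itw A' B"
  unfolding Itw_def
proof (rule nn_integral_mono_AE, rule AE_mp[OF AE_not_in[OF bad_null]], rule AE_I2, rule impI)
  fix z assume "z \<notin> bad"
  then have "indicator A z \<le> (indicator A' z :: ennreal)" using sub by (auto split: split_indicator)
  then show "(\<integral>\<^sup>+w. indicator A z * indicator B w * kap z w \<partial>lborel) \<le> (\<integral>\<^sup>+w. indicator A' z * indicator B w * kap z w \<partial>lborel)"
    by (intro nn_integral_mono mult_right_mono) auto
qed

text \<open>Integrating out \<open>w\<close> leaves the inverse square of a lower bound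
  \<open>d z\<close> for the distance to \<open>B\<close>, so finiteness becomes a question about a
  planar integral over \<open>A\<close>.\<close>

lemma Itw_le:
  assumes [measurable]: "A \<in> sets borel" "B \<in> sets borel" "d \<in> borel_measurable borel"
    and pos: "\<And>z. z \<in> A \<Longrightarrow> 0 < d z" and dist: "\<And>z w. z \<in> A \<Longrightarrow> w \<in> B \<Longrightarrow> d z \<le> cmod (z - w)"
  shows "Itw A B \<le> (\<integral>\<^sup>+z. indicator A z * ennreal (1 / (d z)\<^sup>2) \<partial>lborel) * (3 * (J0 * J0))"
proof -
  have "Itw A B \<le> (\<integral>\<^sup>+z. indicator A z * ennreal (1 / (d z)\<^sup>2) * (3 * (J0 * J0)) \<partial>lborel)"
    unfolding Itw_def
  proof (rule nn_integral_mono)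
    fix z
    show "(\<integral>\<^sup>+w. indicator A z * indicator B w * kap z w \<partial>lborel) \<le> indicator A z * ennreal (1 / (d z)\<^sup>2) * (3 * (J0 * J0))"
    proof (cases "z \<in> A")
      case True
      have "(\<integral>\<^sup>+w. indicator A z * indicator B w * kap z w \<partial>lborel) \<le> (\<integral>\<^sup>+w. indicator {w. d z \<le> cmod (z - w)} w * kap z w \<partial>lborel)"
        using dist[OF True] True by (intro nn_integral_mono mult_right_mono) (auto split: split_indicator)
      also have "\<dots> \<le> ennreal (3 / (d z)\<^sup>2) * (J0 * J0)" by (rule tail_bound[OF pos[OF True]])
      also have "ennreal (3 / (d z)\<^sup>2) = ennreal (1 / (d z)\<^sup>2) * 3"
        using ennreal_mult[of "1 / (d z)\<^sup>2" 3] by simp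
      finally show ?thesis using True by (simp add: mult.assoc)
    qed simp
  qed
  also have "\<dots> = (\<integral>\<^sup>+z. indicator A z * ennreal (1 / (d z)\<^sup>2) \<partial>lborel) * (3 * (J0 * J0))"
    by (rule nn_integral_multc) measurable
  finally show ?thesis .
qed

lemma JJ_finite: "3 * (J0 * J0) < \<infinity>"
  using J0_finite by (simp add: ennreal_mult_less_top)

lemma Itw_bounded:
  assumes m: "A \<in> sets borel" "B \<in> sets borel" and bA: "bounded A" and d: "0 < d"
    and dist: "\<And>z w. z \<in> A \<Longrightarrow> w \<in> B \<Longrightarrow> d \<le> cmod (z - w)"
  shows "Itw A B < \<infinity>"
proof -
  have "Itw A B \<le> (\<integral>\<^sup>+z. indicator A z * ennreal (1 / d\<^sup>2) \<partial>lborel) * (3 * (J0 * J0))"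
    by (rule Itw_le[OF m]) (use d dist in auto)
  also have "(\<integral>\<^sup>+z. indicator A z * ennreal (1 / d\<^sup>2) \<partial>lborel) = emeasure lborel A * ennreal (1 / d\<^sup>2)"
    using m by (subst nn_integral_multc) auto
  also have "emeasure lborel A * ennreal (1 / d\<^sup>2) * (3 * (J0 * J0)) < \<infinity>"
    using JJ_finite emeasure_bounded_finite[OF bA] by (simp add: ennreal_mult_less_top)
  finally show ?thesis .
qed

text \<open>At abscissa \<open>x\<close> the cusp has height \<open>2 * C * x^2\<close>, which
  cancels the weight.\<close>

lemma cusp_finite:
  assumes C: "0 \<le> C"
  shows "(\<integral>\<^sup>+z. indicator {z. \<bar>Im z\<bar> \<le> C * (Re z)\<^sup>2 \<and> \<bar>Re z\<bar> \<le> 1} z * ennreal (1 / (Re z)\<^sup>2) \<partial>lborel) < \<infinity>"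
proof -
  define f where "f z = indicator {z. \<bar>Im z\<bar> \<le> C * (Re z)\<^sup>2 \<and> \<bar>Re z\<bar> \<le> 1} z * ennreal (1 / (Re z)\<^sup>2)" for z
  have [measurable]: "f \<in> borel_measurable borel" unfolding f_def by measurable
  have le: "(\<integral>\<^sup>+y. f (Complex x y) \<partial>lborel) \<le> ennreal (2 * C) * indicator {-1..1} x" for x
  proof -
    have "(\<integral>\<^sup>+y. f (Complex x y) \<partial>lborel) = (\<integral>\<^sup>+y. indicator {-1..1} x * ennreal (1 / x\<^sup>2) * indicator {- (C * x\<^sup>2)..C * x\<^sup>2} y \<partial>lborel)"
      by (intro nn_integral_cong) (auto simp: f_def split: split_indicator)
    also have "\<dots> = indicator {-1..1} x * ennreal (1 / x\<^sup>2) * ennreal (2 * C * x\<^sup>2)"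
      using C by (subst nn_integral_cmult) (auto simp: mult.assoc)
    also have "\<dots> = ennreal (1 / x\<^sup>2) * ennreal (2 * C * x\<^sup>2) * indicator {-1..1} x" by (simp only: ac_simps)
    finally have eq: "(\<integral>\<^sup>+y. f (Complex x y) \<partial>lborel) = ennreal (1 / x\<^sup>2) * ennreal (2 * C * x\<^sup>2) * indicator {-1..1} x" .
    have "ennreal (1 / x\<^sup>2) * ennreal (2 * C * x\<^sup>2) \<le> ennreal (2 * C)"
      using C by (cases "x = 0") (simp_all add: ennreal_mult[symmetric])
    then show ?thesis unfolding eq by (rule mult_right_mono) simp
  qed
  have "(\<integral>\<^sup>+z. f z \<partial>lborel) = (\<integral>\<^sup>+x. \<integral>\<^sup>+y. f (Complex x y) \<partial>lborel \<partial>lborel)"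
    by (rule nn_integral_complex(1)) measurable
  also have "\<dots> \<le> (\<integral>\<^sup>+x. ennreal (2 * C) * indicator {-1..1::real} x \<partial>lborel)"
    by (rule nn_integral_mono) (rule le)
  also have "\<dots> < \<infinity>" by (simp add: nn_integral_cmult ennreal_mult_less_top)
  finally show ?thesis unfolding f_def .
qed

text \<open>\<open>p\<close> is the tip and \<open>c\<close> turns the axis of the cusp into the
  real line. A gap that grows linearly with the distance from the tip gives exactly the weight
  handled by \<open>cusp_finite\<close>.\<close>

lemma Itw_cusp:
  assumes m: "A \<in> sets borel" "B \<in> sets borel" and c: "cmod c = 1" "c = 1 \<or> Im c \<noteq> 0" and d: "0 < d" and C: "0 \<le> C"
    and cusp: "\<And>z. z \<in> A \<Longrightarrow> Re (c * (z - p)) \<noteq> 0 \<and> \<bar>Re (c * (z - p))\<bar> \<le> 1 \<and> \<bar>Im (c * (z - p))\<bar> \<le> C * (Re (c * (z - p)))\<^sup>2"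
    and dist: "\<And>z w. z \<in> A \<Longrightarrow> w \<in> B \<Longrightarrow> d * \<bar>Re (c * (z - p))\<bar> \<le> cmod (z - w)"
  shows "Itw A B < \<infinity>"
proof -
  define f where "f z = indicator {z. \<bar>Im z\<bar> \<le> C * (Re z)\<^sup>2 \<and> \<bar>Re z\<bar> \<le> 1} z * ennreal (1 / (Re z)\<^sup>2)" for z
  have [measurable]: "f \<in> borel_measurable borel" unfolding f_def by measurable
  have "(\<integral>\<^sup>+z. f (c * (z - p)) \<partial>lborel) = (\<integral>\<^sup>+z. f (c * z) \<partial>lborel)"
    using nn_integral_translate_complex[of "\<lambda>z. f (c * z)" "- p"] by simp
  also have "\<dots> = (\<integral>\<^sup>+z. f z \<partial>lborel)"
    using nn_integral_rotate_complex[of f c] c by auto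
  also have "\<dots> < \<infinity>" unfolding f_def by (rule cusp_finite[OF C])
  finally have fin: "(\<integral>\<^sup>+z. f (c * (z - p)) \<partial>lborel) < \<infinity>" .
  have "Itw A B \<le> (\<integral>\<^sup>+z. indicator A z * ennreal (1 / (d * \<bar>Re (c * (z - p))\<bar>)\<^sup>2) \<partial>lborel) * (3 * (J0 * J0))"
  proof (rule Itw_le[OF m])
    show "\<And>z. z \<in> A \<Longrightarrow> 0 < d * \<bar>Re (c * (z - p))\<bar>" using cusp d by auto
    show "(\<lambda>z. d * \<bar>Re (c * (z - p))\<bar>) \<in> borel_measurable borel" by measurable
  qed (use dist in auto)
  also have "(\<integral>\<^sup>+z. indicator A z * ennreal (1 / (d * \<bar>Re (c * (z - p))\<bar>)\<^sup>2) \<partial>lborel) \<le> (\<integral>\<^sup>+z. ennreal (1 / d\<^sup>2) * f (c * (z - p)) \<partial>lborel)"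
  proof (rule nn_integral_mono)
    fix z
    show "indicator A z * ennreal (1 / (d * \<bar>Re (c * (z - p))\<bar>)\<^sup>2) \<le> ennreal (1 / d\<^sup>2) * f (c * (z - p))"
    proof (cases "z \<in> A")
      case True
      have "ennreal (1 / (d * \<bar>Re (c * (z - p))\<bar>)\<^sup>2) = ennreal (1 / d\<^sup>2) * ennreal (1 / (Re (c * (z - p)))\<^sup>2)"
        by (subst ennreal_mult[symmetric]) (simp_all add: power_mult_distrib)
      then show ?thesis using True cusp[OF True] unfolding f_def by simp
    qed simp
  qed
  also have "(\<integral>\<^sup>+z. ennreal (1 / d\<^sup>2) * f (c * (z - p)) \<partial>lborel) = ennreal (1 / d\<^sup>2) * (\<integral>\<^sup>+z. f (c * (z - p)) \<partial>lborel)"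
    by (rule nn_integral_cmult) measurable
  finally have "Itw A B \<le> ennreal (1 / d\<^sup>2) * (\<integral>\<^sup>+z. f (c * (z - p)) \<partial>lborel) * (3 * (J0 * J0))"
    by (simp add: mult_right_mono)
  also have "\<dots> < \<infinity>" using fin JJ_finite by (simp add: ennreal_mult_less_top)
  finally show ?thesis .
qed

lemma dom_U_measurable [measurable]: "dom_U \<in> sets borel"
proof -
  have "dom_U = {z. \<bar>al z\<bar> < 1 \<and> \<bar>be z\<bar> < 1 \<and> \<bar>al z - be z\<bar> < 1 \<or> be z = 1 \<and> 0 < al z \<and> al z < 1
     \<or> al z = -1 \<and> -1 \<le> be z \<and> be z < 0 \<or> al z - be z = 1 \<and> 0 \<le> al z \<and> al z < 1}"
    using dom_U_iff by auto
  moreover have "{z \<in> space borel. \<bar>al z\<bar> < 1 \<and> \<bar>be z\<bar> < 1 \<and> \<bar>al z - be z\<bar> < 1 \<or> be z = 1 \<and> 0 < al z \<and> al z < 1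
     \<or> al z = -1 \<and> -1 \<le> be z \<and> be z < 0 \<or> al z - be z = 1 \<and> 0 \<le> al z \<and> al z < 1} \<in> sets borel"
    by measurable
  ultimately show ?thesis by simp
qed

lemma V1_measurable [measurable]: "V1 k \<in> sets borel"
proof -
  have [measurable]: "Measurable.pred borel (\<lambda>z. z \<in> dom_U)" by (simp add: pred_def)
  have "{z \<in> space borel. z \<in> V1 k} \<in> sets borel" unfolding V1_def mem_Collect_eq by measurable
  then show ?thesis by simp
qed

lemma Vstar1_measurable [measurable]: "Vstar1 k \<in> sets borel"
proof -
  have "{z \<in> space borel. z \<in> Vstar1 k} \<in> sets borel" unfolding Vstar1_def mem_Collect_eq by measurable
  then show ?thesis by simp
qed

lemma zeta_image: "(\<lambda>z. zeta ^ n * z) ` A = (\<lambda>z. z / zeta ^ n) -` A"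
proof (intro equalityI subsetI)
  fix z assume "z \<in> (\<lambda>z. z / zeta ^ n) -` A"
  then show "z \<in> (\<lambda>z. zeta ^ n * z) ` A" by (intro image_eqI[of _ _ "z / zeta ^ n"]) auto
qed auto

lemma zeta_image_measurable: "A \<in> sets borel \<Longrightarrow> (\<lambda>z. zeta ^ n * z) ` A \<in> sets borel"
proof -
  have "(\<lambda>z. z / zeta ^ n) \<in> borel \<rightarrow>\<^sub>M borel" by measurable
  then show "A \<in> sets borel \<Longrightarrow> (\<lambda>z. zeta ^ n * z) ` A \<in> sets borel"
    unfolding zeta_image by (rule measurable_sets_borel)
qed

lemma V_measurable [measurable]: "V k l \<in> sets borel"
  unfolding V_def by (rule zeta_image_measurable) measurable

lemma Vstar_measurable [measurable]: "Vstar k l \<in> sets borel"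
  unfolding Vstar_def by (rule zeta_image_measurable) measurable

lemma Im_zeta: "Im zeta \<noteq> 0"
  by (simp add: zeta_def sqrtm3_def)

lemma nn_integral_zeta_power:
  fixes f :: "complex \<Rightarrow> ennreal"
  assumes [measurable]: "f \<in> borel_measurable borel"
  shows "(\<integral>\<^sup>+z. f (zeta ^ n * z) \<partial>lborel) = (\<integral>\<^sup>+z. f z \<partial>lborel)"
proof (induction n)
  case (Suc n)
  have "(\<integral>\<^sup>+z. f (zeta ^ Suc n * z) \<partial>lborel) = (\<integral>\<^sup>+z. f (zeta ^ n * (zeta * z)) \<partial>lborel)"
    by (simp add: mult.assoc mult.left_commute)
  also have "\<dots> = (\<integral>\<^sup>+z. f (zeta ^ n * z) \<partial>lborel)"
    by (rule nn_integral_rotate_complex[OF _ zeta_norm Im_zeta]) measurable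
  finally show ?case using Suc by simp
qed simp

lemma kap_zeta_power: "kap (zeta ^ n * z) (zeta ^ n * w) = kap z w"
  by (simp add: kap_def flip: right_diff_distrib)

lemma indicator_zeta_image: "indicator ((\<lambda>z. zeta ^ n * z) ` A) (zeta ^ n * z) = indicator A z"
  unfolding zeta_image by (auto split: split_indicator)

lemma Itw_zeta_power:
  assumes [measurable]: "A \<in> sets borel" "B \<in> sets borel"
  shows "Itw ((\<lambda>z. zeta ^ n * z) ` A) ((\<lambda>z. zeta ^ n * z) ` B) = Itw A B"
proof -
  let ?A = "(\<lambda>z. zeta ^ n * z) ` A" and ?B = "(\<lambda>z. zeta ^ n * z) ` B"
  note [measurable] = zeta_image_measurable[OF assms(1), of n] zeta_image_measurable[OF assms(2), of n]
  have "Itw ?A ?B = (\<integral>\<^sup>+z. \<integral>\<^sup>+w. indicator ?A (zeta ^ n * z) * indicator ?B w * kap (zeta ^ n * z) w \<partial>lborel \<partial>lborel)"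
    unfolding Itw_def by (rule nn_integral_zeta_power[symmetric]) measurable
  also have "\<dots> = (\<integral>\<^sup>+z. \<integral>\<^sup>+w. indicator ?A (zeta ^ n * z) * indicator ?B (zeta ^ n * w) * kap (zeta ^ n * z) (zeta ^ n * w) \<partial>lborel \<partial>lborel)"
    by (rule nn_integral_cong, rule nn_integral_zeta_power[symmetric]) measurable
  also have "\<dots> = Itw A B"
    unfolding Itw_def indicator_zeta_image kap_zeta_power ..
  finally show ?thesis .
qed

section \<open>Finite mass over each of the six cells\<close>

lemma sector_dist:
  assumes z: "z \<in> sector" and w: "1 < sq w"
  shows "((1 - al z) + (al z - be z) * be z) / 2 \<le> cmod (z - w)"
proof -
  define p b c where "p = al z - be z" and "b = be z" and "c = 1 - al z"
  have pos: "0 < p" "0 < b" "0 < c" using z by (auto simp: sector_def p_def b_def c_def)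
  have "1 - sq z = c * (1 + al z) + p * b" using bary(4)[of z] by (simp add: p_def b_def c_def)
  moreover have "0 \<le> c * al z" using pos by (intro mult_nonneg_nonneg) (auto simp: p_def b_def)
  ultimately have *: "c + p * b \<le> 1 - sq z" by (simp add: algebra_simps)
  have z1: "cmod z \<le> 1" "1 < cmod w"
  proof -
    have "sq z \<le> 1\<^sup>2" using * pos by (simp add: add_nonneg_nonneg) (smt (verit) mult_pos_pos)
    then show "cmod z \<le> 1" by (rule power2_le_imp_le) simp
    show "1 < cmod w" using norm_less_iff(2)[of 1 w] w by simp
  qed
  have "1 - sq z = (1 - cmod z) * (1 + cmod z)" by (simp add: power2_eq_square algebra_simps)
  also have "\<dots> \<le> (1 - cmod z) * 2" using z1 by (intro mult_left_mono) auto
  finally have "(c + p * b) / 2 \<le> 1 - cmod z" using * by simp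
  also have "\<dots> \<le> cmod (z - w)" using z1 norm_triangle_ineq3[of z w] by simp
  finally show ?thesis by (simp add: p_def b_def c_def)
qed

definition Acell :: "nat \<Rightarrow> complex set" where "Acell k = {z \<in> sector. cell k z}"

lemma sector_measurable [measurable]: "Measurable.pred borel (\<lambda>z. z \<in> sector)"
  unfolding sector_def by simp

lemma Acell_measurable [measurable]: "Acell k \<in> sets borel"
proof -
  have "{z \<in> space borel. z \<in> Acell k} \<in> sets borel" unfolding Acell_def cell_def inA_def inB_def inC_def mem_Collect_eq by measurable
  then show ?thesis by simp
qed

lemma V1_Acell: "V1 k \<subseteq> Acell k \<union> bad"
  using V1_iff by (auto simp: Acell_def)

lemma bounded_sector: "bounded sector"
proof (rule boundedI[of _ 1])
  fix z assume "z \<in> sector"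
  then have "sq z \<le> 1\<^sup>2" using hexagon_sq_lt[OF sector_hexagon] by fastforce
  then show "norm z \<le> 1" by (rule power2_le_imp_le) simp
qed

lemma bounded_Acell: "bounded (Acell k)"
  by (rule bounded_subset[OF bounded_sector]) (auto simp: Acell_def)

lemma Vstar1_sq: "w \<in> Vstar1 k \<Longrightarrow> 1 < sq w"
  using norm_less_iff(2)[of 1 w] by (simp add: Vstar1_def)

lemma AcellD:
  assumes "z \<in> Acell k"
  defines "p \<equiv> al z - be z" and "b \<equiv> be z" and "c \<equiv> 1 - al z"
  shows "0 < p" "0 < b" "0 < c" "p + b + c = 1" "al z = p + b" "be z = b"
    "1 < sq w \<Longrightarrow> (c + p * b) / 2 \<le> cmod (z - w)"
    "k = 1 \<Longrightarrow> b\<^sup>2 < p * c" "k = 1 \<Longrightarrow> p\<^sup>2 < b * c"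
    "k = 2 \<Longrightarrow> p * b \<le> c\<^sup>2" "k = 2 \<Longrightarrow> b * c \<le> p\<^sup>2"
    "k = 3 \<Longrightarrow> p * b \<le> c\<^sup>2" "k = 3 \<Longrightarrow> p * c \<le> b\<^sup>2"
    "k = 4 \<Longrightarrow> b\<^sup>2 < p * c" "k = 4 \<Longrightarrow> c\<^sup>2 < p * b"
    "k = 5 \<Longrightarrow> c\<^sup>2 < p * b" "k = 5 \<Longrightarrow> p\<^sup>2 < b * c"
    "k = 6 \<Longrightarrow> p * c \<le> b\<^sup>2" "k = 6 \<Longrightarrow> b * c \<le> p\<^sup>2"
  using assms sector_dist[of z w] unfolding Acell_def sector_def cell_def bary p_def b_def c_def
  by (auto simp: not_less)

text \<open>Cell 1 is the part around \<open>0\<close>: its two inequalities make \<open>c\<close>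
  the largest barycentric coordinate, hence at least 1/3, which keeps the cell away from the unit
  circle.\<close>

lemma Itw_cell1: "Itw (Acell 1) (Vstar1 k) < \<infinity>"
proof (rule Itw_bounded)
  fix z w assume z: "z \<in> Acell 1" and w: "w \<in> Vstar1 k"
  define p b c where "p = al z - be z" and "b = be z" and "c = 1 - al z"
  note D = AcellD[OF z, folded p_def b_def c_def]
  have "c \<ge> 1 / 3"
  proof (rule ccontr)
    assume "\<not> c \<ge> 1 / 3"
    then consider "c \<le> p" "b \<le> p" | "c \<le> b" "p \<le> b" using D(4) by linarith
    then show False
    proof cases
      case 1
      then have "b * c \<le> p * p" using D by (intro mult_mono) auto
      then show False using D(9) by (simp add: power2_eq_square)
    next
      case 2
      then have "p * c \<le> b * b" using D by (intro mult_mono) auto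
      then show False using D(8) by (simp add: power2_eq_square)
    qed
  qed
  moreover have "0 < p * b" using D by simp
  ultimately show "1 / 6 \<le> cmod (z - w)" using D(7)[OF Vstar1_sq[OF w]] by argo
qed (auto intro: bounded_Acell)

text \<open>\<open>c + b / 2\<close> is \<open>1 - Re z\<close>. If \<open>p \<ge> 1 / 4\<close>,
  the inequality \<open>p * b \<le> c^2\<close> gives \<open>b \<le> 4 * c^2\<close>; otherwise
  \<open>c\<close> is bounded below and crude estimates suffice. The constant 8 serves both
  cases.\<close>

lemma cusp_bound:
  fixes p b c :: real
  assumes pos: "0 < p" "0 < b" "0 < c" "p + b + c = 1" and "p * b \<le> c\<^sup>2" "b * c \<le> p\<^sup>2"
  shows "b \<le> 8 * (c + b / 2)\<^sup>2" "1 / 8 * (c + b / 2) \<le> (c + p * b) / 2"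
proof -
  have sq: "c\<^sup>2 \<le> (c + b / 2)\<^sup>2" using pos by (intro power_mono) auto
  have "b\<^sup>2 * c = b * (b * c)" by (simp add: power2_eq_square)
  also have "\<dots> \<le> b * p\<^sup>2" using assms(6) pos by (intro mult_left_mono) auto
  also have "\<dots> = p * (p * b)" by (simp add: power2_eq_square)
  also have "\<dots> \<le> p * c\<^sup>2" using assms(5) pos by (intro mult_left_mono) auto
  also have "\<dots> = (p * c) * c" by (simp add: power2_eq_square)
  finally have "b\<^sup>2 * c \<le> (p * c) * c" .
  \<comment> \<open>Dividing the chain by \<open>c\<close> yields \<open>b^2 \<le> p * c\<close>,
    which limits \<open>b\<close> when \<open>p\<close> is small.\<close>
  from mult_right_le_imp_le[OF this pos(3)] have bpc: "b\<^sup>2 \<le> p * c" .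
  have "b \<le> 8 * (c + b / 2)\<^sup>2 \<and> 1 / 8 * (c + b / 2) \<le> (c + p * b) / 2"
  proof (cases "1 / 4 \<le> p")
    case True
    then have "1 / 4 * b \<le> p * b" using pos by (intro mult_right_mono) auto
    then have "b \<le> 4 * (c + b / 2)\<^sup>2" "1 / 8 * (c + b / 2) \<le> (c + p * b) / 2" using assms(5) sq pos by argo+
    moreover have "0 \<le> (c + b / 2)\<^sup>2" by simp
    ultimately show ?thesis by linarith
  next
    case False
    have c4: "1 / 4 \<le> c"
    proof (rule ccontr)
      assume "\<not> 1 / 4 \<le> c"
      then have "b > 1 / 2" "c < 1 / 4" using False pos by linarith+
      note bpc
      also have "p * c \<le> 1 / 4 * (1 / 4)" using False \<open>c < 1/4\<close> pos by (intro mult_mono) auto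
      also have "\<dots> < (1 / 2)\<^sup>2" by (simp add: power2_eq_square)
      also have "\<dots> < b\<^sup>2" using \<open>b > 1/2\<close> by (intro power_strict_mono) auto
      finally show False .
    qed
    have "1 / 4 * (1 / 4) \<le> c * c" using c4 by (intro mult_mono) auto
    then have c16: "1 / 16 \<le> (c + b / 2)\<^sup>2" using sq by (simp add: power2_eq_square)
    have b2: "b \<le> 1 / 2"
    proof (rule ccontr)
      assume "\<not> b \<le> 1 / 2"
      note bpc
      also have "p * c \<le> 1 / 4 * 1" using False pos by (intro mult_mono) auto
      also have "\<dots> = (1 / 2)\<^sup>2" by (simp add: power2_eq_square)
      also have "\<dots> < b\<^sup>2" using \<open>\<not> b \<le> 1/2\<close> by (intro power_strict_mono) auto
      finally show False by simp
    qed
    have "0 < p * b" using pos by simp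
    then show ?thesis using c16 b2 c4 pos by argo
  qed
  then show "b \<le> 8 * (c + b / 2)\<^sup>2" "1 / 8 * (c + b / 2) \<le> (c + p * b) / 2" by auto
qed

lemma sqrt3_half_le: "sqrt 3 / 2 \<le> 1"
  using real_sqrt_le_mono[of 3 4] by simp

lemma cusp_Im:
  assumes "0 \<le> y" "y \<le> C * r\<^sup>2"
  shows "\<bar>sqrt 3 / 2 * y\<bar> \<le> C * r\<^sup>2" "\<bar>sqrt 3 / 2 * - y\<bar> \<le> C * r\<^sup>2"
proof -
  have "sqrt 3 / 2 * y \<le> 1 * y" using assms sqrt3_half_le by (intro mult_right_mono) auto
  then show "\<bar>sqrt 3 / 2 * y\<bar> \<le> C * r\<^sup>2" "\<bar>sqrt 3 / 2 * - y\<bar> \<le> C * r\<^sup>2" using assms by auto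
qed

text \<open>Near \<open>1\<close> the cell is the cusp between the real axis and the circle of
  \<open>inC\<close>, which are tangent there.\<close>

lemma Itw_cell2: "Itw (Acell 2) (Vstar1 k) < \<infinity>"
proof (rule Itw_cusp[where c = 1 and p = 1 and d = "1/8" and C = 8])
  fix z w assume z: "z \<in> Acell 2"
  define p b c where "p = al z - be z" and "b = be z" and "c = 1 - al z"
  note D = AcellD[OF z, folded p_def b_def c_def]
  note cb = cusp_bound[OF D(1-4) D(10) D(11), simplified]
  have re: "Re (1 * (z - 1)) = - (c + b / 2)" "Im (1 * (z - 1)) = sqrt 3 / 2 * b"
    by (simp_all add: Re_Im_albe p_def b_def c_def)
  show "Re (1 * (z - 1)) \<noteq> 0 \<and> \<bar>Re (1 * (z - 1))\<bar> \<le> 1 \<and> \<bar>Im (1 * (z - 1))\<bar> \<le> 8 * (Re (1 * (z - 1)))\<^sup>2"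
    unfolding re power2_minus using D(1-4) cusp_Im(1)[OF _ cb(1)] by auto
  show "1 / 8 * \<bar>Re (1 * (z - 1))\<bar> \<le> cmod (z - w)" if "w \<in> Vstar1 k"
    unfolding re using cb(2) D(1-4) D(7)[OF Vstar1_sq[OF that]] by auto
qed auto

text \<open>Mirror image of cell 2 with tip \<open>zeta\<close> and with \<open>p\<close> and
  \<open>b\<close> exchanged; \<open>zeta ^ 5\<close> turns the ray through \<open>zeta\<close> into
  the real axis.\<close>

lemma Itw_cell3: "Itw (Acell 3) (Vstar1 k) < \<infinity>"
proof (rule Itw_cusp[where c = "zeta ^ 5" and p = zeta and d = "1/8" and C = 8])
  fix z w assume z: "z \<in> Acell 3"
  define p b c where "p = al z - be z" and "b = be z" and "c = 1 - al z"
  note D = AcellD[OF z, folded p_def b_def c_def]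
  have "b + p + c = 1" "b * p \<le> c\<^sup>2" using D(4,12) by (simp_all add: mult.commute)
  note cb = cusp_bound[OF D(2,1,3) this D(13), simplified]
  have e: "al (zeta ^ 5 * (z - zeta)) = be z - 1" "be (zeta ^ 5 * (z - zeta)) = be z - al z"
    by (simp_all add: numeral_eq_Suc mult.assoc)
  have re: "Re (zeta ^ 5 * (z - zeta)) = - (c + p / 2)" "Im (zeta ^ 5 * (z - zeta)) = sqrt 3 / 2 * - p"
    unfolding Re_Im_albe e by (simp_all add: p_def b_def c_def field_simps)
  show "Re (zeta ^ 5 * (z - zeta)) \<noteq> 0 \<and> \<bar>Re (zeta ^ 5 * (z - zeta))\<bar> \<le> 1 \<and> \<bar>Im (zeta ^ 5 * (z - zeta))\<bar> \<le> 8 * (Re (zeta ^ 5 * (z - zeta)))\<^sup>2"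
    unfolding re power2_minus using D(1-4) cusp_Im(2)[OF _ cb(1)] by auto
  show "1 / 8 * \<bar>Re (zeta ^ 5 * (z - zeta))\<bar> \<le> cmod (z - w)" if "w \<in> Vstar1 k"
    unfolding re using cb(2) D(1-4) D(7)[OF Vstar1_sq[OF that]] by (auto simp: mult.commute)
next
  have "zeta ^ 5 = cnj zeta" by (rule albe_eqI) (simp_all add: numeral_eq_Suc)
  then show "zeta ^ 5 = 1 \<or> Im (zeta ^ 5) \<noteq> 0" using Im_zeta by simp
qed (auto simp: norm_power)

text \<open>From \<open>b \<le> p\<close> follows \<open>c \<le> b\<close>, so \<open>p\<close> is
  the largest coordinate and at least 1/3; then \<open>p * c \<le> b^2\<close> makes
  \<open>c\<close> quadratically small along the side \<open>c = 0\<close>.\<close>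

lemma edge_bound:
  fixes p b c :: real
  assumes pos: "0 < p" "0 < b" "0 < c" "p + b + c = 1" and A: "p * c \<le> b\<^sup>2" and bp: "b \<le> p"
  shows "c \<le> 3 * (b + c / 2)\<^sup>2" "1 / 6 * (b + c / 2) \<le> (c + p * b) / 2"
proof -
  have "b * b \<le> p * b" using bp pos by (intro mult_right_mono) auto
  then have "p * c \<le> p * b" using A by (simp add: power2_eq_square)
  then have "c \<le> b" using pos by simp
  then have p3: "1 / 3 \<le> p" using pos bp by linarith
  have "1 / 3 * c \<le> p * c" using p3 pos by (intro mult_right_mono) auto
  then have "c \<le> 3 * b\<^sup>2" using A by simp
  also have "b\<^sup>2 \<le> (b + c / 2)\<^sup>2" using pos by (intro power_mono) auto
  finally show "c \<le> 3 * (b + c / 2)\<^sup>2" by simp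
  have "1 / 3 * b \<le> p * b" using p3 pos by (intro mult_right_mono) auto
  then show "1 / 6 * (b + c / 2) \<le> (c + p * b) / 2" using pos by argo
qed

text \<open>The cell runs along a side of the hexagon and has a cusp at each end, so it is cut at
  \<open>p = b\<close>. The factors \<open>zeta ^ 4\<close> and \<open>zeta\<close> turn the side,
  directed away from the respective tip, into the positive real axis.\<close>

lemma Itw_cell6: "Itw (Acell 6) (Vstar1 k) < \<infinity>"
proof (rule Itw_Un)
  show "Itw {z \<in> Acell 6. be z \<le> al z - be z} (Vstar1 k) < \<infinity>"
  proof (rule Itw_cusp[where c = "zeta ^ 4" and p = 1 and d = "1/6" and C = 3])
    fix z w assume z: "z \<in> {z \<in> Acell 6. be z \<le> al z - be z}"
    define p b c where "p = al z - be z" and "b = be z" and "c = 1 - al z"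
    have z6: "z \<in> Acell 6" and bp: "b \<le> p" using z by (auto simp: p_def b_def)
    note D = AcellD[OF z6, folded p_def b_def c_def]
    note cb = edge_bound[OF D(1-4) D(18) bp, simplified]
    have e: "al (zeta ^ 4 * (z - 1)) = c + b" "be (zeta ^ 4 * (z - 1)) = c"
      by (simp_all add: numeral_eq_Suc mult.assoc p_def b_def c_def)
    have re: "Re (zeta ^ 4 * (z - 1)) = b + c / 2" "Im (zeta ^ 4 * (z - 1)) = sqrt 3 / 2 * c"
      unfolding Re_Im_albe e by (simp_all add: field_simps)
    show "Re (zeta ^ 4 * (z - 1)) \<noteq> 0 \<and> \<bar>Re (zeta ^ 4 * (z - 1))\<bar> \<le> 1 \<and> \<bar>Im (zeta ^ 4 * (z - 1))\<bar> \<le> 3 * (Re (zeta ^ 4 * (z - 1)))\<^sup>2"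
      unfolding re using D(1-4) cusp_Im(1)[OF _ cb(1)] by auto
    show "1 / 6 * \<bar>Re (zeta ^ 4 * (z - 1))\<bar> \<le> cmod (z - w)" if "w \<in> Vstar1 k"
      unfolding re using cb(2) D(1-4) D(7)[OF Vstar1_sq[OF that]] by auto
  next
    have "zeta ^ 4 = - zeta" by (rule albe_eqI) (simp_all add: numeral_eq_Suc)
    then show "zeta ^ 4 = 1 \<or> Im (zeta ^ 4) \<noteq> 0" using Im_zeta by simp
  qed (auto simp: norm_power)
  show "Itw {z \<in> Acell 6. al z - be z \<le> be z} (Vstar1 k) < \<infinity>"
  proof (rule Itw_cusp[where c = zeta and p = zeta and d = "1/6" and C = 3])
    fix z w assume z: "z \<in> {z \<in> Acell 6. al z - be z \<le> be z}"
    define p b c where "p = al z - be z" and "b = be z" and "c = 1 - al z"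
    have z6: "z \<in> Acell 6" and pb: "p \<le> b" using z by (auto simp: p_def b_def)
    note D = AcellD[OF z6, folded p_def b_def c_def]
    have s: "b + p + c = 1" using D(4) by simp
    note cb = edge_bound[OF D(2,1,3) s D(19) pb, simplified]
    have e: "al (zeta * (z - zeta)) = p" "be (zeta * (z - zeta)) = - c"
      by (simp_all add: p_def b_def c_def)
    have re: "Re (zeta * (z - zeta)) = p + c / 2" "Im (zeta * (z - zeta)) = sqrt 3 / 2 * - c"
      unfolding Re_Im_albe e by (simp_all add: field_simps)
    show "Re (zeta * (z - zeta)) \<noteq> 0 \<and> \<bar>Re (zeta * (z - zeta))\<bar> \<le> 1 \<and> \<bar>Im (zeta * (z - zeta))\<bar> \<le> 3 * (Re (zeta * (z - zeta)))\<^sup>2"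
      unfolding re using D(1-4) cusp_Im(2)[OF _ cb(1)] by auto
    show "1 / 6 * \<bar>Re (zeta * (z - zeta))\<bar> \<le> cmod (z - w)" if "w \<in> Vstar1 k"
      unfolding re using cb(2) D(1-4) D(7)[OF Vstar1_sq[OF that]] by (auto simp: mult.commute)
  qed (auto simp: Im_zeta)
qed auto

lemma vertex_bound:
  fixes p b c :: real
  assumes pos: "0 < p" "0 < b" "0 < c" "p + b + c = 1" and A: "b\<^sup>2 < p * c" and C: "c\<^sup>2 < p * b"
  shows "(b + c) / 6 \<le> (c + p * b) / 2"
proof -
  have "1 / 3 \<le> p"
  proof (rule ccontr)
    assume "\<not> 1 / 3 \<le> p"
    then consider "p \<le> b" "c \<le> b" | "p \<le> c" "b \<le> c" using pos by linarith
    then show False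
    proof cases
      case 1
      then have "p * c \<le> b * b" using pos by (intro mult_mono) auto
      then show False using A by (simp add: power2_eq_square)
    next
      case 2
      then have "p * b \<le> c * c" using pos by (intro mult_mono) auto
      then show False using C by (simp add: power2_eq_square)
    qed
  qed
  then have "1 / 3 * b \<le> p * b" using pos by (intro mult_right_mono) auto
  then show ?thesis using pos by argo
qed

text \<open>Here \<open>A\<close> may fill an angle at the vertex \<open>v\<close>, and
  \<open>B\<close> supplies the cusp; \<open>Itw_sym\<close> exchanges their roles. The triangle
  inequality carries the linear gap over from \<open>z\<close> to \<open>w\<close>, the divisor 6
  becoming 7.\<close>

lemma Itw_vertex:
  assumes m [measurable]: "A \<in> sets borel" "B \<in> sets borel" and bA: "bounded A" and c: "cmod c = 1" "c = 1 \<or> Im c \<noteq> 0"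
    and dist: "\<And>z w. z \<in> A \<Longrightarrow> w \<in> B \<Longrightarrow> cmod (z - v) / 6 \<le> cmod (z - w)"
    and cusp: "\<And>w. w \<in> B \<Longrightarrow> 2 * \<bar>Im (c * (w - v))\<bar> < 2 * sq (w - v)" and Bv: "v \<notin> B"
  shows "Itw A B < \<infinity>"
proof -
  have dist': "cmod (w - v) / 7 \<le> cmod (z - w)" if "z \<in> A" "w \<in> B" for z w
    using dist[OF that] norm_triangle_ineq4[of "z - v" "z - w"] by simp
  define B1 B2 where "B1 = {w \<in> B. cmod (w - v) \<le> 1 / 2}" and "B2 = {w \<in> B. 1 / 2 \<le> cmod (w - v)}"
  have [measurable]: "B1 \<in> sets borel" "B2 \<in> sets borel" unfolding B1_def B2_def by measurable
  have "Itw B A < \<infinity>"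
  proof (rule Itw_Un[of _ _ B1 B2])
    show "B \<subseteq> B1 \<union> B2" by (auto simp: B1_def B2_def)
    have "Itw A B2 < \<infinity>"
    proof (rule Itw_bounded[OF _ _ bA])
      show "1 / 14 \<le> cmod (z - w)" if "z \<in> A" "w \<in> B2" for z w
        using dist'[OF that(1), of w] that(2) by (simp add: B2_def)
    qed auto
    then show "Itw B2 A < \<infinity>" by (simp add: Itw_sym)
    show "Itw B1 A < \<infinity>"
    proof (rule Itw_cusp[where c = c and p = v and d = "1/7" and C = 2])
      fix w z assume w: "w \<in> B1"
      define x y where "x = Re (c * (w - v))" and "y = Im (c * (w - v))"
      have s: "sq (w - v) = x\<^sup>2 + y\<^sup>2"
        using cmod_power2[of "c * (w - v)"] c(1) by (simp add: x_def y_def norm_mult)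
      have n: "cmod (w - v) \<le> 1 / 2" "w \<in> B" using w by (auto simp: B1_def)
      have xy: "\<bar>x\<bar> \<le> cmod (w - v)" "\<bar>y\<bar> \<le> 1 / 2"
        using abs_Re_le_cmod[of "c * (w - v)"] abs_Im_le_cmod[of "c * (w - v)"] c(1) n by (simp_all add: x_def y_def norm_mult)
      \<comment> \<open>Because \<open>|y| \<le> 1 / 2\<close>, the term \<open>y^2\<close> in
        \<open>|y| < x^2 + y^2\<close> is at most half of the left side and can be absorbed.\<close>
      have "\<bar>y\<bar> * \<bar>y\<bar> \<le> 1 / 2 * \<bar>y\<bar>" using xy by (intro mult_right_mono) auto
      then have yx: "\<bar>y\<bar> \<le> 2 * x\<^sup>2" using cusp[OF n(2)] unfolding s y_def[symmetric] by (simp add: power2_eq_square)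
      have "x \<noteq> 0"
      proof
        assume "x = 0"
        then have "sq (w - v) = 0" using yx s by simp
        then show False using n(2) Bv by auto
      qed
      then show "Re (c * (w - v)) \<noteq> 0 \<and> \<bar>Re (c * (w - v))\<bar> \<le> 1 \<and> \<bar>Im (c * (w - v))\<bar> \<le> 2 * (Re (c * (w - v)))\<^sup>2"
        using xy(1) n(1) yx by (simp add: x_def y_def)
      show "1 / 7 * \<bar>Re (c * (w - v))\<bar> \<le> cmod (w - z)" if "z \<in> A"
        using dist'[OF that n(2)] xy(1) by (simp add: x_def norm_minus_commute)
    qed (use c in auto)
  qed auto
  then show ?thesis by (simp add: Itw_sym)
qed

text \<open>The fibre lies outside the circles about \<open>eta\<close> and
  \<open>cnj eta / 2\<close>, which touch externally at \<open>1\<close>; the unit number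
  \<open>eta / sqrt 3\<close> turns their common tangent into the real axis.\<close>

lemma Itw_cell4: "Itw (Acell 4) (Vstar1 4) < \<infinity>"
proof (rule Itw_vertex[where v = 1 and c = "eta / of_real (sqrt 3)"])
  have "sq eta = 3" by (simp add: sq_albe)
  then have "cmod eta = sqrt 3" by (metis norm_ge_zero real_sqrt_unique)
  then show "cmod (eta / of_real (sqrt 3)) = 1" by (simp add: norm_divide)
  show "eta / of_real (sqrt 3) = 1 \<or> Im (eta / of_real (sqrt 3)) \<noteq> 0"
    by (simp add: Im_divide_of_real eta_def sqrtm3_def)
  show "1 \<notin> Vstar1 4" by (simp add: Vstar1_def)
next
  fix z w assume z: "z \<in> Acell 4" and w: "w \<in> Vstar1 4"
  define p b c where "p = al z - be z" and "b = be z" and "c = 1 - al z"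
  note D = AcellD[OF z, folded p_def b_def c_def]
  have "sq (z - 1) = c\<^sup>2 + c * b + b\<^sup>2" unfolding sq_albe by (simp add: b_def c_def power2_eq_square algebra_simps)
  also have "\<dots> \<le> (b + c)\<^sup>2" using D(1-3) by (simp add: power2_eq_square algebra_simps)
  finally have "cmod (z - 1) \<le> b + c" by (rule power2_le_imp_le) (use D in auto)
  then show "cmod (z - 1) / 6 \<le> cmod (z - w)"
    using vertex_bound[OF D(1-4) D(14) D(15)] D(7)[OF Vstar1_sq[OF w]] by auto
next
  fix w assume w: "w \<in> Vstar1 4"
  define x where "x = w - 1"
  have c: "3 * al w < sq w + 2" "3 * (al w - be w) < 2 * sq w + 1"
    using w unfolding Vstar1_def mem_Collect_eq disc_iff[OF nbrs_named(1)] disc_iff[OF nbrs_named(3)] ev_named by auto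
  have aw: "al w = 1 + al x" "be w = be x" by (simp_all add: x_def)
  have s: "sq w = 1 + 2 * al x - be x + sq x" unfolding sq_albe aw by (simp add: power2_eq_square algebra_simps)
  have "al x + be x < sq x" "- (al x + be x) < 2 * sq x" using c unfolding aw s by argo+
  then have "\<bar>al x + be x\<bar> < 2 * sq x" by (smt (verit) zero_le_power2)
  moreover have "Im (eta / of_real (sqrt 3) * x) = (al x + be x) / 2"
  proof -
    have "Im (eta * x) = sqrt 3 / 2 * (al x + be x)" unfolding Re_Im_albe albe_mult by simp
    moreover have "eta / of_real (sqrt 3) * x = (eta * x) / of_real (sqrt 3)" by simp
    ultimately show ?thesis by (simp only: Im_divide_of_real) simp
  qed
  ultimately have "2 * \<bar>Im (eta / of_real (sqrt 3) * x)\<bar> < 2 * sq x" by (simp only:) simp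
  then show "2 * \<bar>Im (eta / of_real (sqrt 3) * (w - 1))\<bar> < 2 * sq (w - 1)" unfolding x_def .
qed (auto intro: bounded_Acell)

text \<open>The circles about \<open>eta\<close> and \<open>sqrtm3 / 2\<close> touch externally at
  \<open>zeta\<close> with a vertical tangent, hence the quarter turn.\<close>

lemma Itw_cell5: "Itw (Acell 5) (Vstar1 5) < \<infinity>"
proof (rule Itw_vertex[where v = zeta and c = \<i>])
  show "zeta \<notin> Vstar1 5" by (simp add: Vstar1_def)
next
  fix z w assume z: "z \<in> Acell 5" and w: "w \<in> Vstar1 5"
  define p b c where "p = al z - be z" and "b = be z" and "c = 1 - al z"
  note D = AcellD[OF z, folded p_def b_def c_def]
  have s1: "b + p + c = 1" "c\<^sup>2 < b * p" using D(4) D(16) by (simp_all add: mult.commute)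
  have e: "be (z - zeta) = - p - c" "al (z - zeta) = - c" by (simp_all add: p_def b_def c_def)
  have "sq (z - zeta) = c\<^sup>2 + c * p + p\<^sup>2" unfolding sq_albe e by (simp add: power2_eq_square algebra_simps)
  also have "\<dots> \<le> (p + c)\<^sup>2" using D(1-3) by (simp add: power2_eq_square algebra_simps)
  finally have "cmod (z - zeta) \<le> p + c" by (rule power2_le_imp_le) (use D in auto)
  then show "cmod (z - zeta) / 6 \<le> cmod (z - w)"
    using vertex_bound[OF D(2,1,3) s1(1) _ s1(2)] D(17) D(7)[OF Vstar1_sq[OF w]] by (auto simp: mult.commute)
next
  fix w assume w: "w \<in> Vstar1 5"
  define x where "x = w - zeta"
  have c: "3 * al w < sq w + 2" "3 * be w < 2 * sq w + 1"
    using w unfolding Vstar1_def mem_Collect_eq disc_iff[OF nbrs_named(1)] disc_iff[OF nbrs_named(2)] ev_named by auto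
  have aw: "al w = 1 + al x" "be w = 1 + be x" by (simp_all add: x_def)
  have s: "sq w = 1 + al x + be x + sq x" unfolding sq_albe aw by (simp add: power2_eq_square algebra_simps)
  have "2 * al x - be x < sq x" "- (2 * al x - be x) < 2 * sq x" using c unfolding aw s by argo+
  then have "\<bar>2 * al x - be x\<bar> < 2 * sq x" by (smt (verit) zero_le_power2)
  moreover have "Im (\<i> * x) = (2 * al x - be x) / 2" using Re_Im_albe(1)[of x] by simp
  ultimately have "2 * \<bar>Im (\<i> * x)\<bar> < 2 * sq x" by (simp only:) simp
  then show "2 * \<bar>Im (\<i> * (w - zeta))\<bar> < 2 * sq (w - zeta)" unfolding x_def .
qed (auto intro: bounded_Acell)

lemma Itw_V_finite:
  assumes "k \<in> {1..6}"
  shows "Itw (V k l) (Vstar k l) < \<infinity>"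
proof -
  have "Itw (Acell k) (Vstar1 k) < \<infinity>"
    using assms Itw_cell1 Itw_cell2 Itw_cell3 Itw_cell4 Itw_cell5 Itw_cell6
    by (auto simp: numeral_eq_Suc atLeastAtMostSuc_conv)
  then have "Itw (V1 k) (Vstar1 k) < \<infinity>"
    using Itw_AE_mono[OF _ _ _ V1_Acell, of k "Vstar1 k"] by (auto intro: le_less_trans)
  then show ?thesis unfolding V_def Vstar_def by (subst Itw_zeta_power) auto
qed

section \<open>The invariant measure\<close>

abbreviation L2 :: "(complex \<times> complex) measure" where "L2 \<equiv> lborel \<Otimes>\<^sub>M lborel"

abbreviation kp :: "complex \<times> complex \<Rightarrow> ennreal" where "kp p \<equiv> kap (fst p) (snd p)"

text \<open>Unnormalised and on the whole product, so that invariance under each branch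
  \<open>gmap b\<close> can be stated without reference to \<open>hat_U\<close>.\<close>

definition kappa :: "(complex \<times> complex) measure" where "kappa = density L2 kp"

lemma sets_kappa [measurable_cong]: "sets kappa = sets L2" by (simp add: kappa_def)

text \<open>\<open>dom_U\<close> contains only three of the six sides and is not invariant under
  rotation, unlike the open hexagon. Excluding the sides for all points, \<open>bad\<close> ones
  included, is what places every \<open>V k l\<close> inside \<open>dom_U\<close>.\<close>

lemma V1_hexagon: "V1 k \<subseteq> hexagon"
proof
  fix z assume z: "z \<in> V1 k"
  then have "z \<in> dom_U" by (simp add: V1_def)
  define x y where "x = al z" and "y = be z"
  have re: "Re z = x - y / 2" "Im z = sqrt 3 / 2 * y" by (simp_all add: Re_Im_albe x_def y_def)
  have q: "sq z = x\<^sup>2 - x * y + y\<^sup>2" by (simp add: sq_albe x_def y_def)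
  have q0: "\<not> sq z < c" if "c \<le> 0" for c using zero_le_power2[of "cmod z"] that by linarith
  have lt: "sqrt 3 / 2 * y < sqrt 3 * (x - y / 2) \<longleftrightarrow> y < x"
  proof -
    have "sqrt 3 / 2 * y < sqrt 3 * (x - y / 2) \<longleftrightarrow> sqrt 3 * y < sqrt 3 * x" by (simp add: algebra_simps)
    then show ?thesis by simp
  qed
  have s: "0 < sqrt 3 / 2 * y \<longleftrightarrow> 0 < y" by (simp add: zero_less_mult_iff)
  note V = z[unfolded V1_def mem_Collect_eq disc_iff[OF nbrs_named(1)] disc_iff[OF nbrs_named(2)] disc_iff[OF nbrs_named(3)]
      ev_named re lt s, folded x_def y_def]
  have poly: "0 \<le> (1 - x) * (2 - x)" if "x < 1" using that by simp
  consider "z \<in> hexagon" | "y = 1" "0 < x" "x < 1" | "x = -1" "-1 \<le> y" "y < 0" | "x - y = 1" "0 \<le> x" "x < 1"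
    using \<open>z \<in> dom_U\<close> unfolding dom_U_iff hexagon_iff x_def y_def by blast
  then show "z \<in> hexagon"
  proof cases
    case 2
    then have "sq z = x * x - x + 1" unfolding q by (simp add: power2_eq_square)
    moreover have "x * x < x * 1" using 2 by (intro mult_strict_left_mono) auto
    moreover have "2 * x \<le> x * x - x + 1 + 1" using poly 2 by (simp add: algebra_simps)
    ultimately show ?thesis using V q0[of "x - y"] 2 by (auto split: if_splits)
  next
    case 3
    then show ?thesis using V q0[of y] q0[of "x - y"] by (auto split: if_splits)
  next
    case 4
    then have y: "y = x - 1" by simp
    then have "sq z = x * x - x + 1" unfolding q y by (simp add: power2_eq_square algebra_simps)
    moreover have "2 * x \<le> x * x - x + 1 + 1" using poly 4 by (simp add: algebra_simps)
    ultimately show ?thesis using V q0[of y] 4 y by (auto split: if_splits)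
  qed
qed

lemma V_hexagon: "V k l \<subseteq> hexagon"
  by (auto simp: V_def dest: subsetD[OF V1_hexagon])

lemma hexagon_dom_U: "hexagon \<subseteq> dom_U"
  by (auto simp: hexagon_iff dom_U_iff)

lemma hat_U_measurable [measurable]: "hat_U \<in> sets L2"
  unfolding hat_U_def by (intro sets.finite_UN pair_measureI) auto

lemma sets_L2: "sets L2 = sets (borel \<Otimes>\<^sub>M borel)"
  by (rule sets_pair_measure_cong) simp_all

lemma hat_U_borel [simp]: "hat_U \<in> sets (borel \<Otimes>\<^sub>M borel)"
  using hat_U_measurable by (simp only: sets_L2)

lemma hat_U_fst: "p \<in> hat_U \<Longrightarrow> fst p \<in> dom_U"
  using V_hexagon hexagon_dom_U by (force simp: hat_U_def)

lemma space_hat_mu [simp]: "space hat_mu = hat_U"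
  by (simp add: hat_mu_def space_restrict_space space_pair_measure)

lemma sets_hat_mu: "sets hat_mu = sets (restrict_space L2 hat_U)"
  by (simp add: hat_mu_def)

lemma sets_hat_mu_iff: "A \<in> sets hat_mu \<longleftrightarrow> A \<in> sets L2 \<and> A \<subseteq> hat_U"
  unfolding sets_hat_mu by (subst sets_restrict_space_iff) (auto simp: space_pair_measure)

lemma hat_mu_density: "hat_mu = density (restrict_space L2 hat_U) (\<lambda>p. C0 * kp p)"
  unfolding hat_mu_def kap_def by (simp add: case_prod_beta')

lemma emeasure_hat_mu:
  assumes "A \<in> sets L2" "A \<subseteq> hat_U"
  shows "emeasure hat_mu A = C0 * emeasure kappa A"
proof -
  have "A \<in> sets (restrict_space L2 hat_U)" using assms sets_hat_mu_iff sets_hat_mu by blast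
  then have "emeasure hat_mu A = (\<integral>\<^sup>+p. C0 * kp p * indicator A p \<partial>restrict_space L2 hat_U)"
    unfolding hat_mu_density by (subst emeasure_density) (auto intro!: measurable_restrict_space1)
  also have "\<dots> = (\<integral>\<^sup>+p. C0 * kp p * indicator A p * indicator hat_U p \<partial>L2)"
    by (rule nn_integral_restrict_space) (simp add: space_pair_measure)
  also have "\<dots> = (\<integral>\<^sup>+p. C0 * (kp p * indicator A p) \<partial>L2)"
    by (rule nn_integral_cong) (use assms in \<open>auto split: split_indicator\<close>)
  also have "\<dots> = C0 * emeasure kappa A"
    unfolding kappa_def using assms by (subst nn_integral_cmult) (auto simp: emeasure_density)
  finally show ?thesis .
qed

lemma C0_eq: "C0 = 1 / emeasure kappa hat_U"
proof -
  have "(\<integral>\<^sup>+ (z, w). ennreal (1 / cmod (z - w) ^ 4) \<partial>restrict_space L2 hat_U) = (\<integral>\<^sup>+ p. kp p \<partial>restrict_space L2 hat_U)"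
    by (simp add: kap_def case_prod_beta')
  also have "\<dots> = (\<integral>\<^sup>+ p. kp p * indicator hat_U p \<partial>L2)"
    by (rule nn_integral_restrict_space) (simp add: space_pair_measure)
  also have "\<dots> = emeasure kappa hat_U" unfolding kappa_def by (simp add: emeasure_density)
  finally show ?thesis unfolding C0_def by simp
qed

lemma kappa_Times:
  assumes [measurable]: "A \<in> sets borel" "B \<in> sets borel"
  shows "emeasure kappa (A \<times> B) = Itw A B"
proof -
  have [measurable]: "A \<times> B \<in> sets L2" by (intro pair_measureI) auto
  have "emeasure kappa (A \<times> B) = (\<integral>\<^sup>+ p. kp p * indicator (A \<times> B) p \<partial>L2)"
    unfolding kappa_def by (rule emeasure_density) auto
  also have "\<dots> = (\<integral>\<^sup>+z. \<integral>\<^sup>+w. kp (z, w) * indicator (A \<times> B) (z, w) \<partial>lborel \<partial>lborel)"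
    by (rule lborel.nn_integral_fst[symmetric]) measurable
  also have "\<dots> = Itw A B" unfolding Itw_def by (intro nn_integral_cong) (auto split: split_indicator)
  finally show ?thesis .
qed

lemma kappa_hat_U_finite: "emeasure kappa hat_U < \<infinity>"
proof -
  have "emeasure kappa hat_U \<le> (\<Sum>k\<in>{1..6}. emeasure kappa (\<Union>l\<in>{1..6}. V k l \<times> Vstar k l))"
    unfolding hat_U_def by (intro emeasure_subadditive_finite) (auto simp: sets_kappa)
  also have "\<dots> < \<infinity>"
    unfolding infinity_ennreal_def
  proof (subst ennreal_sum_less_top)
    show "\<forall>k\<in>{1..6}. emeasure kappa (\<Union>l\<in>{1..6}. V k l \<times> Vstar k l) < \<top>"
    proof
      fix k :: nat assume k: "k \<in> {1..6}"
      have "emeasure kappa (\<Union>l\<in>{1..6}. V k l \<times> Vstar k l) \<le> (\<Sum>l\<in>{1..6::nat}. emeasure kappa (V k l \<times> Vstar k l))"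
        by (intro emeasure_subadditive_finite) (auto simp: sets_kappa)
      also have "\<dots> < \<top>"
        using Itw_V_finite[OF k] by (simp add: kappa_Times ennreal_sum_less_top)
      finally show "emeasure kappa (\<Union>l\<in>{1..6}. V k l \<times> Vstar k l) < \<top>" .
    qed
  qed simp
  finally show ?thesis .
qed

lemma open_lborel_pos:
  fixes S :: "'a::euclidean_space set"
  assumes "open S" "S \<noteq> {}"
  shows "emeasure lborel S \<noteq> 0"
proof
  assume "emeasure lborel S = 0"
  then have "S \<in> null_sets lebesgue" using assms by (intro null_sets_completionI null_setsI) auto
  then show False using open_not_negligible[OF assms] by (simp add: negligible_iff_null_sets)
qed

lemma AE_L2_good: "AE p in L2. fst p \<notin> bad \<and> snd p \<notin> bad"
proof -
  have "emeasure L2 (bad \<times> UNIV) = 0" "emeasure L2 (UNIV \<times> bad) = 0"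
    using bad_null by (subst lborel.emeasure_pair_measure_Times; auto simp: null_sets_def)+
  then have "bad \<times> UNIV \<in> null_sets L2" "UNIV \<times> bad \<in> null_sets L2" by (auto intro!: null_setsI pair_measureI)
  then have "(bad \<times> UNIV) \<union> (UNIV \<times> bad) \<in> null_sets L2" by (rule null_sets.Un)
  from AE_not_in[OF this] show ?thesis by eventually_elim auto
qed

lemma kappa_hat_U_pos: "emeasure kappa hat_U \<noteq> 0"
proof
  assume 0: "emeasure kappa hat_U = 0"
  have "emeasure kappa (V 1 1 \<times> Vstar 1 1) \<le> emeasure kappa hat_U"
  proof (rule emeasure_mono)
    show "V 1 1 \<times> Vstar 1 1 \<subseteq> hat_U"
      unfolding hat_U_def by (rule subset_trans[OF _ UN_upper[of 1]], rule UN_upper) auto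
  qed (simp add: sets_kappa)
  then have "emeasure kappa (V1 1 \<times> Vstar1 1) = 0" using 0 by (simp add: V_def Vstar_def)
  then have "(\<integral>\<^sup>+ p. kp p * indicator (V1 1 \<times> Vstar1 1) p \<partial>L2) = 0"
    unfolding kappa_def by (subst (asm) emeasure_density) auto
  then have "AE p in L2. kp p * indicator (V1 1 \<times> Vstar1 1) p = 0"
    by (subst (asm) nn_integral_0_iff_AE) auto
  moreover have "kp p * indicator (V1 1 \<times> Vstar1 1) p \<noteq> 0" if "p \<in> V1 1 \<times> Vstar1 1" for p
  proof -
    have "fst p \<in> hexagon" "1 < cmod (snd p)" using that subsetD[OF V1_hexagon[of 1], of "fst p"] by (auto simp: Vstar1_def)
    then have "fst p \<noteq> snd p" using hexagon_sq_lt[of "fst p"] by (auto simp: power_less_one_iff)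
    then show ?thesis using that by (simp add: kap_def)
  qed
  ultimately have "AE p in L2. p \<notin> V1 1 \<times> Vstar1 1" by (auto elim!: eventually_mono)
  then have "emeasure L2 (V1 1 \<times> Vstar1 1) = 0"
    by (subst (asm) AE_iff_measurable[OF _ refl]) (auto simp: space_pair_measure)
  then have "emeasure lborel (V1 1) = 0 \<or> emeasure lborel (Vstar1 1) = 0"
    by (subst (asm) lborel.emeasure_pair_measure_Times) auto
  moreover have "emeasure lborel (Vstar1 1) \<noteq> 0"
  proof (rule open_lborel_pos)
    show "open (Vstar1 1)" unfolding Vstar1_def
      by (auto intro!: open_Collect_conj open_Collect_less continuous_intros)
    have "10 \<in> Vstar1 1"
      unfolding Vstar1_def mem_Collect_eq disc_iff[OF nbrs_named(1)] disc_iff[OF nbrs_named(2)] disc_iff[OF nbrs_named(3)] ev_named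
      by (simp add: al_def be_def)
    then show "Vstar1 1 \<noteq> {}" by auto
  qed
  moreover have "emeasure lborel (V1 1) \<noteq> 0"
  proof -
    have "V1 1 = hexagon \<inter> {z. cmod (z - cnj eta / 3) < rad} \<inter> {z. cmod (z - sqrtm3 / 3) < rad}"
      using V1_hexagon[of 1] hexagon_dom_U by (auto simp: V1_def)
    moreover have "open \<dots>" by (intro open_Int open_hexagon open_Collect_less continuous_intros)
    \<comment> \<open>Close to \<open>0\<close> the quadratic \<open>sq z\<close> is dominated by
      both linear forms \<open>be z\<close> and \<open>al z - be z\<close>.\<close>
    moreover obtain z where z: "al z = 1 / 5" "be z = 1 / 10" using ex_albe by blast
    have "sq z = 3 / 100" unfolding sq_albe z by (simp add: power2_eq_square)
    then have "z \<in> hexagon \<inter> {z. cmod (z - cnj eta / 3) < rad} \<inter> {z. cmod (z - sqrtm3 / 3) < rad}"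
      using disc_iff(1)[OF nbrs_named(2), of z] disc_iff(1)[OF nbrs_named(3), of z]
      by (auto simp: hexagon_iff ev_named z)
    ultimately show ?thesis using open_lborel_pos by (metis empty_iff)
  qed
  ultimately show False by blast
qed

lemma prob_hat_mu: "prob_space hat_mu"
proof
  have "emeasure hat_mu (space hat_mu) = C0 * emeasure kappa hat_U"
    using emeasure_hat_mu[OF hat_U_measurable] by simp
  also have "\<dots> = 1" unfolding C0_eq using kappa_hat_U_finite kappa_hat_U_pos
    by (simp add: ennreal_divide_times ennreal_divide_self)
  finally show "emeasure hat_mu (space hat_mu) = 1" .
qed

section \<open>Invariance of the kernel under inversion and translation\<close>

lemma kap_inverse: "z \<noteq> 0 \<Longrightarrow> w \<noteq> 0 \<Longrightarrow> kap z w = kap (1 / z) (1 / w) * ennreal (1 / cmod w ^ 4) * ennreal (1 / cmod z ^ 4)"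
proof -
  assume *: "z \<noteq> 0" "w \<noteq> 0"
  have "1 / z - 1 / w = (w - z) / (z * w)" using * by (simp add: field_simps)
  then have "cmod (1 / z - 1 / w) = cmod (z - w) / (cmod z * cmod w)" by (simp add: norm_divide norm_mult norm_minus_commute)
  then have eq: "1 / cmod (z - w) ^ 4 = 1 / cmod (1 / z - 1 / w) ^ 4 * (1 / cmod w ^ 4) * (1 / cmod z ^ 4)"
    using * by (simp add: power_divide power_mult_distrib)
  have m3: "ennreal (x * y * u) = ennreal x * ennreal y * ennreal u" if "0 \<le> x" "0 \<le> y" "0 \<le> u" for x y u
    using that by (simp add: ennreal_mult)
  show ?thesis unfolding kap_def eq by (rule m3) auto
qed

lemma kap_translate: "kap (z + c) (w + c) = kap z w"
  by (simp add: kap_def)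

definition gmap :: "complex \<Rightarrow> complex \<times> complex \<Rightarrow> complex \<times> complex" where
  "gmap b = (\<lambda>(z, w). (1 / z - b, 1 / w - b))"

definition hmap :: "complex \<Rightarrow> complex \<times> complex \<Rightarrow> complex \<times> complex" where
  "hmap b = (\<lambda>(z, w). (1 / (z + b), 1 / (w + b)))"

text \<open>With \<open>1 / 0 = 0\<close> both maps are total and mutually inverse at every
  point.\<close>

lemma gmap_hmap [simp]: "gmap b (hmap b p) = p" "hmap b (gmap b p) = p"
  by (auto simp: gmap_def hmap_def split: prod.splits)

lemma gmap_measurable [measurable]: "gmap b \<in> L2 \<rightarrow>\<^sub>M L2"
  unfolding gmap_def by measurable

lemma hmap_measurable [measurable]: "hmap b \<in> L2 \<rightarrow>\<^sub>M L2"
  unfolding hmap_def by measurable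

text \<open>\<open>kap_inverse\<close> provides precisely the two factors \<open>|w|^-4\<close> and
  \<open>|z|^-4\<close> consumed by the planar inversions, first in \<open>w\<close> for fixed
  \<open>z\<close> and then in \<open>z\<close>.\<close>

lemma nn_integral_gmap:
  assumes [measurable]: "F \<in> borel_measurable L2"
  shows "(\<integral>\<^sup>+p. F (gmap b p) * kp p \<partial>L2) = (\<integral>\<^sup>+p. F p * kp p \<partial>L2)"
proof -
  have [measurable]: "(\<lambda>(z, w). F (z, w)) \<in> borel_measurable (borel \<Otimes>\<^sub>M borel)"
    using assms by (simp cong: measurable_cong_sets)
  define H where "H z = (\<integral>\<^sup>+w. F (z - b, w - b) * kap z w \<partial>lborel)" for z
  have [measurable]: "H \<in> borel_measurable borel" unfolding H_def by measurable
  have nz: "AE z in (lborel :: complex measure). z \<noteq> 0" by (rule AE_lborel_singleton)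
  have "(\<integral>\<^sup>+p. F (gmap b p) * kp p \<partial>L2) = (\<integral>\<^sup>+z. \<integral>\<^sup>+w. F (1 / z - b, 1 / w - b) * kap z w \<partial>lborel \<partial>lborel)"
    by (subst lborel.nn_integral_fst[symmetric]) (auto simp: gmap_def)
  also have "\<dots> = (\<integral>\<^sup>+z. H (1 / z) * ennreal (1 / cmod z ^ 4) \<partial>lborel)"
  proof (rule nn_integral_cong_AE, rule AE_mp[OF nz], rule AE_I2, rule impI)
    fix z :: complex assume z: "z \<noteq> 0"
    have "(\<integral>\<^sup>+w. F (1 / z - b, 1 / w - b) * kap z w \<partial>lborel)
      = (\<integral>\<^sup>+w. (F (1 / z - b, 1 / w - b) * kap (1 / z) (1 / w) * ennreal (1 / cmod w ^ 4)) * ennreal (1 / cmod z ^ 4) \<partial>lborel)"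
      by (rule nn_integral_cong_AE, rule AE_mp[OF nz], rule AE_I2, rule impI) (subst kap_inverse[OF z], assumption, simp only: mult.assoc)
    also have "\<dots> = (\<integral>\<^sup>+w. F (1 / z - b, 1 / w - b) * kap (1 / z) (1 / w) * ennreal (1 / cmod w ^ 4) \<partial>lborel) * ennreal (1 / cmod z ^ 4)"
      by (rule nn_integral_multc) measurable
    also have "(\<integral>\<^sup>+w. F (1 / z - b, 1 / w - b) * kap (1 / z) (1 / w) * ennreal (1 / cmod w ^ 4) \<partial>lborel) = H (1 / z)"
      unfolding H_def by (rule nn_integral_inverse_complex) measurable
    finally show "(\<integral>\<^sup>+w. F (1 / z - b, 1 / w - b) * kap z w \<partial>lborel) = H (1 / z) * ennreal (1 / cmod z ^ 4)" .
  qed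
  also have "\<dots> = (\<integral>\<^sup>+z. H z \<partial>lborel)" by (rule nn_integral_inverse_complex) measurable
  also have "\<dots> = (\<integral>\<^sup>+z. H (z + b) \<partial>lborel)" by (rule nn_integral_translate_complex[symmetric]) measurable
  also have "\<dots> = (\<integral>\<^sup>+z. \<integral>\<^sup>+w. F (z, w) * kap z w \<partial>lborel \<partial>lborel)"
  proof (rule nn_integral_cong)
    fix z
    have "H (z + b) = (\<integral>\<^sup>+w. F (z + b - b, (w + b) - b) * kap (z + b) (w + b) \<partial>lborel)"
      unfolding H_def by (rule nn_integral_translate_complex[symmetric]) measurable
    then show "H (z + b) = (\<integral>\<^sup>+w. F (z, w) * kap z w \<partial>lborel)" by (simp add: kap_translate)
  qed
  also have "\<dots> = (\<integral>\<^sup>+p. F p * kp p \<partial>L2)"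
    by (subst lborel.nn_integral_fst[symmetric]) auto
  finally show ?thesis .
qed

lemma kappa_gmap:
  assumes [measurable]: "A \<in> sets L2"
  shows "emeasure kappa (gmap b -` A) = emeasure kappa A"
proof -
  have g: "gmap b -` A \<in> sets L2" using measurable_sets[OF gmap_measurable assms] by (simp add: space_pair_measure)
  have "emeasure kappa (gmap b -` A) = (\<integral>\<^sup>+p. kp p * indicator (gmap b -` A) p \<partial>L2)"
    unfolding kappa_def by (rule emeasure_density[OF _ g]) measurable
  also have "\<dots> = (\<integral>\<^sup>+p. indicator A (gmap b p) * kp p \<partial>L2)"
    by (rule nn_integral_cong) (auto split: split_indicator)
  also have "\<dots> = (\<integral>\<^sup>+p. indicator A p * kp p \<partial>L2)" by (rule nn_integral_gmap) measurable
  also have "\<dots> = emeasure kappa A"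
  proof -
    have "emeasure kappa A = (\<integral>\<^sup>+p. kp p * indicator A p \<partial>L2)"
      unfolding kappa_def by (rule emeasure_density[OF _ assms]) measurable
    then show ?thesis by (simp add: mult.commute)
  qed
  finally show ?thesis .
qed

section \<open>The bijection and its invariance\<close>

text \<open>The set of full measure on which the dynamics is exact: \<open>bad\<close> is stable
  under inversion and under the ideal, so no orbit starting here ever leaves it.\<close>

definition Xset :: "(complex \<times> complex) set" where
  "Xset = {p. fst p \<notin> bad \<and> snd p \<notin> bad \<and> stair (fst p) (snd p)}"

lemma Xset_hat_U: "Xset \<subseteq> hat_U"
  using hat_U_iff by (auto simp: Xset_def)

lemma Xset_eq: "Xset = hat_U - (bad \<times> UNIV \<union> UNIV \<times> bad)"
  using hat_U_iff by (auto simp: Xset_def)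

lemma Xset_L2 [measurable]: "Xset \<in> sets L2"
  unfolding Xset_eq by (intro sets.Diff sets.Un pair_measureI hat_U_measurable) auto

lemma Xset_sets: "Xset \<in> sets hat_mu"
  using Xset_hat_U Xset_L2 sets_hat_mu_iff by blast

lemma AE_Xset: "AE p in hat_mu. p \<in> Xset"
proof -
  have "AE p in L2. p \<in> hat_U \<longrightarrow> 0 < C0 * kp p \<longrightarrow> p \<in> Xset"
    using AE_L2_good by eventually_elim (auto simp: Xset_eq)
  then have "AE p in restrict_space L2 hat_U. 0 < C0 * kp p \<longrightarrow> p \<in> Xset"
    by (subst AE_restrict_space_iff) (simp_all add: space_pair_measure)
  then show ?thesis
    unfolding hat_mu_density by (subst AE_density) (auto intro!: measurable_restrict_space1)
qed

lemma Xset_hexagon: "p \<in> Xset \<Longrightarrow> fst p \<in> hexagon"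
  by (simp add: Xset_def stair_def hexagon_def)

lemma bad_0: "0 \<in> bad"
  by (rule badI[of 1 0 0 0]) auto

lemma Xset_nz: "p \<in> Xset \<Longrightarrow> fst p \<noteq> 0" "p \<in> Xset \<Longrightarrow> snd p \<noteq> 0"
  using bad_0 by (auto simp: Xset_def)

lemma bracket_hexagon:
  assumes "b \<in> ideal_J" "z - b \<in> hexagon"
  shows "bracket z = b"
  using bracket_eq[OF assms(1)] assms(2) hexagon_dom_U by blast

lemma hat_T_gmap: "hat_T p = gmap (b1 (fst p)) p"
  by (simp add: hat_T_def gmap_def split: prod.splits)

lemma b1_J: "b1 z \<in> ideal_J"
  unfolding b1_def by (rule bracket_J)

lemma hat_T_Xset:
  assumes "p \<in> Xset"
  shows "hat_T p \<in> Xset"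
proof -
  obtain z w where p: "p = (z, w)" by (cases p)
  have g: "z \<notin> bad" "w \<notin> bad" "stair z w" using assms by (auto simp: Xset_def p)
  have nz: "z \<noteq> 0" "w \<noteq> 0" using Xset_nz[OF assms] by (auto simp: p)
  have ig: "1 / z \<notin> bad" "1 / w \<notin> bad" using g bad_inverse by auto
  have c: "costair (1 / z) (1 / w)" using stair_inverse[of "1 / z" "1 / w"] nz g(3) by simp
  define b where "b = b1 z"
  have b: "b \<in> ideal_J" unfolding b_def by (rule b1_J)
  have bg: "1 / z - b \<notin> bad" "1 / w - b \<notin> bad" using ig bad_ideal_J[OF b] by auto
  have "1 / z - b \<in> dom_U" unfolding b_def b1_def by (rule bracket_dom_U)
  then have "1 / z - b \<in> hexagon" using good_dom_U bg by blast
  from costair_imp_stair[OF c b this ig] show ?thesis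
    using bg by (simp add: hat_T_def p Xset_def b_def)
qed

lemma b1_hmap:
  assumes "q \<in> Xset" "b \<in> ideal_J"
  shows "b1 (fst (hmap b q)) = b"
proof -
  have "fst q \<in> hexagon" using Xset_hexagon[OF assms(1)] .
  then have "bracket (fst q + b) = b" by (intro bracket_hexagon assms) simp
  then show ?thesis by (cases q) (auto simp: b1_def hmap_def)
qed

lemma hat_T_hmap:
  assumes "q \<in> Xset" "b \<in> ideal_J"
  shows "hat_T (hmap b q) = q"
  unfolding hat_T_gmap b1_hmap[OF assms] by simp

text \<open>The candidate preimage of \<open>q\<close> under the branch with digit \<open>b\<close>
  inverts \<open>q + b\<close>. Existence and uniqueness of the preimage thereby become existence
  and uniqueness of a \<open>costair\<close> translate.\<close>

lemma hmap_Xset_iff: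
  assumes "q \<in> Xset" "b \<in> ideal_J"
  shows "hmap b q \<in> Xset \<longleftrightarrow> costair (fst q + b) (snd q + b)"
proof -
  have b': "- b \<in> ideal_J" using assms(2) by (rule ideal_J_uminus)
  have g: "fst q + b \<notin> bad" "snd q + b \<notin> bad"
    using assms(1) bad_ideal_J[OF b', of "fst q"] bad_ideal_J[OF b', of "snd q"] by (auto simp: Xset_def)
  then have "fst q + b \<noteq> 0" "snd q + b \<noteq> 0" using bad_0 by metis+
  from stair_inverse[OF this] show ?thesis
    using g by (cases q) (simp add: Xset_def hmap_def bad_inverse)
qed

lemma hmap_exists:
  assumes "q \<in> Xset"
  obtains b where "b \<in> ideal_J" "hmap b q \<in> Xset"
proof -
  obtain a where a: "a \<in> ideal_J" "costair (fst q - a) (snd q - a)"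
    using stair_ex_costair[of "fst q" "snd q"] assms by (auto simp: Xset_def)
  then have "- a \<in> ideal_J" by (simp add: ideal_J_uminus)
  with a(2) show ?thesis using that[of "- a"] hmap_Xset_iff[OF assms, of "- a"] by simp
qed

lemma hmap_unique:
  assumes "q \<in> Xset" "b \<in> ideal_J" "b' \<in> ideal_J" "hmap b q \<in> Xset" "hmap b' q \<in> Xset"
  shows "b = b'"
proof -
  have "costair (fst q - (- b)) (snd q - (- b))" "costair (fst q - (- b')) (snd q - (- b'))"
    using assms hmap_Xset_iff by auto
  from costair_unique[OF this] have "- b = - b'"
    using assms ideal_J_uminus by (auto simp: Xset_def)
  then show ?thesis by simp
qed

lemma hmap_hat_T: "hmap (b1 (fst p)) (hat_T p) = p"
  by (simp add: hat_T_gmap)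

lemma bij_hat_T: "bij_betw hat_T Xset Xset"
proof (rule bij_betwI')
  fix p q assume pq: "p \<in> Xset" "q \<in> Xset"
  show "hat_T p = hat_T q \<longleftrightarrow> p = q"
  proof
    assume e: "hat_T p = hat_T q"
    have b: "b1 (fst p) = b1 (fst q)"
      by (rule hmap_unique[OF hat_T_Xset[OF pq(1)] b1_J b1_J]) (simp_all add: hmap_hat_T pq, simp add: e hmap_hat_T pq)
    have "p = hmap (b1 (fst p)) (hat_T p)" by (rule hmap_hat_T[symmetric])
    also have "\<dots> = hmap (b1 (fst q)) (hat_T q)" by (simp only: b e)
    also have "\<dots> = q" by (rule hmap_hat_T)
    finally show "p = q" .
  qed simp
next
  fix q assume q: "q \<in> Xset"
  obtain b where b: "b \<in> ideal_J" "hmap b q \<in> Xset" using hmap_exists[OF q] .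
  then show "\<exists>p\<in>Xset. q = hat_T p" using hat_T_hmap[OF q b(1)] by metis
qed (rule hat_T_Xset)

lemma bracket_measurable [measurable]: "bracket \<in> borel_measurable borel"
proof (rule borel_measurableI)
  fix S :: "complex set" assume "open S"
  have "bracket -` S \<inter> space borel = (\<Union>b\<in>ideal_J \<inter> S. {z \<in> space borel. z - b \<in> dom_U})"
  proof (intro equalityI subsetI)
    fix z assume "z \<in> bracket -` S \<inter> space borel"
    then show "z \<in> (\<Union>b\<in>ideal_J \<inter> S. {z \<in> space borel. z - b \<in> dom_U})"
      using bracket_J[of z] bracket_dom_U[of z] by auto
  qed (use bracket_eq in auto)
  also have "\<dots> \<in> sets borel"
    by (rule sets.countable_UN''[OF countable_Int1[OF countable_ideal_J]]) measurable
  finally show "bracket -` S \<inter> space borel \<in> sets borel" .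
qed

lemma b1_measurable [measurable]: "b1 \<in> borel_measurable borel"
  unfolding b1_def[abs_def] by measurable

lemma hat_T_measurable [measurable]: "hat_T \<in> L2 \<rightarrow>\<^sub>M L2"
  unfolding hat_T_def by measurable

abbreviation MX :: "(complex \<times> complex) measure" where "MX \<equiv> restrict_space hat_mu Xset"

lemma space_MX [simp]: "space MX = Xset"
  using Xset_hat_U by (auto simp: space_restrict_space)

lemma sets_MX_iff: "A \<in> sets MX \<longleftrightarrow> A \<in> sets L2 \<and> A \<subseteq> Xset"
  by (subst sets_restrict_space_iff) (use Xset_sets Xset_hat_U in \<open>auto simp: sets_hat_mu_iff\<close>)

lemma emeasure_MX: "A \<in> sets MX \<Longrightarrow> emeasure MX A = C0 * emeasure kappa A"
  using Xset_hat_U Xset_sets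
  by (subst emeasure_restrict_space) (auto simp: sets_MX_iff emeasure_hat_mu Int_absorb2[OF Xset_hat_U])

lemma hat_T_MX: "hat_T \<in> MX \<rightarrow>\<^sub>M MX"
proof (rule measurableI)
  fix A assume A: "A \<in> sets MX"
  have "hat_T -` A \<inter> space L2 \<in> sets L2" using A by (intro measurable_sets[OF hat_T_measurable]) (simp add: sets_MX_iff)
  then show "hat_T -` A \<inter> space MX \<in> sets MX" by (simp add: sets_MX_iff space_pair_measure)
qed (simp add: hat_T_Xset)

lemma vimage_hmap: "A \<in> sets L2 \<Longrightarrow> hmap b -` A \<in> sets L2"
  using measurable_sets[OF hmap_measurable, of A b] by (simp add: space_pair_measure)

lemma inv_hat_T_eq: "q \<in> Xset \<Longrightarrow> b \<in> ideal_J \<Longrightarrow> hmap b q \<in> Xset \<Longrightarrow> the_inv_into Xset hat_T q = hmap b q"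
  using bij_hat_T hat_T_hmap[of q b] by (metis bij_betw_def the_inv_into_f_f)

lemma inv_hat_T_MX: "the_inv_into Xset hat_T \<in> MX \<rightarrow>\<^sub>M MX"
proof (rule measurableI)
  fix q assume "q \<in> space MX"
  then show "the_inv_into Xset hat_T q \<in> space MX"
    using bij_betw_the_inv_into[OF bij_hat_T] by (simp add: bij_betw_def) blast
next
  fix A assume A: "A \<in> sets MX"
  have "the_inv_into Xset hat_T -` A \<inter> space MX = Xset \<inter> (\<Union>b\<in>ideal_J. hmap b -` A)"
  proof (intro equalityI subsetI)
    fix q assume q: "q \<in> the_inv_into Xset hat_T -` A \<inter> space MX"
    then have "q \<in> Xset" by simp
    from hmap_exists[OF this] obtain b where b: "b \<in> ideal_J" "hmap b q \<in> Xset" .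
    then show "q \<in> Xset \<inter> (\<Union>b\<in>ideal_J. hmap b -` A)" using q inv_hat_T_eq[of q b] by auto
  next
    fix q assume q: "q \<in> Xset \<inter> (\<Union>b\<in>ideal_J. hmap b -` A)"
    then obtain b where b: "b \<in> ideal_J" "hmap b q \<in> A" "q \<in> Xset" by auto
    then have "hmap b q \<in> Xset" using A by (auto simp: sets_MX_iff)
    then show "q \<in> the_inv_into Xset hat_T -` A \<inter> space MX" using b inv_hat_T_eq[of q b] by auto
  qed
  moreover have "(\<Union>b\<in>ideal_J. hmap b -` A) \<in> sets L2"
    by (rule sets.countable_UN''[OF countable_ideal_J vimage_hmap]) (use A in \<open>simp only: sets_MX_iff\<close>)
  ultimately show "the_inv_into Xset hat_T -` A \<inter> space MX \<in> sets MX"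
    using Xset_L2 by (auto simp: sets_MX_iff)
qed

text \<open>On the part of the preimage with digit \<open>b\<close> the map is
  \<open>gmap b\<close>, which preserves \<open>kappa\<close>. The preimage pieces are separated by
  their digits and the image pieces \<open>B b\<close> by \<open>hmap_unique\<close>, and there are
  countably many.\<close>

lemma kappa_hat_T:
  assumes A: "A \<in> sets L2" "A \<subseteq> Xset"
  shows "emeasure kappa (hat_T -` A \<inter> Xset) = emeasure kappa A"
proof -
  define B where "B b = A \<inter> hmap b -` Xset" for b
  have B [measurable]: "B b \<in> sets L2" for b unfolding B_def using A vimage_hmap[OF Xset_L2] by blast
  have gB: "gmap b -` B b \<in> sets L2" for b
    using measurable_sets[OF gmap_measurable B, of b b] by (simp add: space_pair_measure)
  have gB_iff: "p \<in> gmap b -` B b \<longleftrightarrow> p \<in> Xset \<and> b1 (fst p) = b \<and> hat_T p \<in> A" if b: "b \<in> ideal_J" for b p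
  proof
    assume "p \<in> gmap b -` B b"
    then have p: "gmap b p \<in> A" "p \<in> Xset" by (auto simp: B_def)
    have "b1 (fst (hmap b (gmap b p))) = b" by (rule b1_hmap) (use p A b in auto)
    then show "p \<in> Xset \<and> b1 (fst p) = b \<and> hat_T p \<in> A" using p by (simp add: hat_T_gmap)
  next
    assume "p \<in> Xset \<and> b1 (fst p) = b \<and> hat_T p \<in> A"
    then show "p \<in> gmap b -` B b" by (auto simp: B_def hat_T_gmap)
  qed
  have 1: "hat_T -` A \<inter> Xset = (\<Union>b\<in>ideal_J. gmap b -` B b)"
  proof (intro equalityI subsetI)
    fix p assume "p \<in> hat_T -` A \<inter> Xset"
    then have "p \<in> gmap (b1 (fst p)) -` B (b1 (fst p))" using gB_iff[OF b1_J[of "fst p"], of p] by blast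
    then show "p \<in> (\<Union>b\<in>ideal_J. gmap b -` B b)" using b1_J by blast
  next
    fix p assume "p \<in> (\<Union>b\<in>ideal_J. gmap b -` B b)"
    then show "p \<in> hat_T -` A \<inter> Xset" using gB_iff by blast
  qed
  have 2: "A = (\<Union>b\<in>ideal_J. B b)"
  proof (intro equalityI subsetI)
    fix q assume q: "q \<in> A"
    then have "q \<in> Xset" using A(2) by blast
    from hmap_exists[OF this] obtain b where "b \<in> ideal_J" "hmap b q \<in> Xset" .
    then show "q \<in> (\<Union>b\<in>ideal_J. B b)" using q by (auto simp: B_def)
  qed (auto simp: B_def)
  have d1: "disjoint_family_on (\<lambda>b. gmap b -` B b) ideal_J"
  proof (unfold disjoint_family_on_def, intro ballI impI)
    fix b b' assume b: "b \<in> ideal_J" "b' \<in> ideal_J" "b \<noteq> b'"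
    show "gmap b -` B b \<inter> gmap b' -` B b' = {}"
    proof (rule ccontr)
      assume "gmap b -` B b \<inter> gmap b' -` B b' \<noteq> {}"
      then obtain p where "p \<in> gmap b -` B b" "p \<in> gmap b' -` B b'" by blast
      then have "b1 (fst p) = b" "b1 (fst p) = b'" using gB_iff[OF b(1)] gB_iff[OF b(2)] by blast+
      then show False using b(3) by simp
    qed
  qed
  have d2: "disjoint_family_on B ideal_J"
  proof (unfold disjoint_family_on_def, intro ballI impI)
    fix b b' assume b: "b \<in> ideal_J" "b' \<in> ideal_J" "b \<noteq> b'"
    show "B b \<inter> B b' = {}"
    proof (rule ccontr)
      assume "B b \<inter> B b' \<noteq> {}"
      then obtain q where "q \<in> Xset" "hmap b q \<in> Xset" "hmap b' q \<in> Xset" using A(2) unfolding B_def by blast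
      then show False using hmap_unique[of q b b'] b by blast
    qed
  qed
  have "emeasure kappa (hat_T -` A \<inter> Xset) = (\<integral>\<^sup>+b. emeasure kappa (gmap b -` B b) \<partial>count_space ideal_J)"
    unfolding 1 by (rule emeasure_UN_countable[OF _ countable_ideal_J d1]) (simp only: sets_kappa gB)
  also have "\<dots> = (\<integral>\<^sup>+b. emeasure kappa (B b) \<partial>count_space ideal_J)"
    by (simp only: kappa_gmap[OF B])
  also have "\<dots> = emeasure kappa (\<Union>b\<in>ideal_J. B b)"
    by (rule emeasure_UN_countable[OF _ countable_ideal_J d2, symmetric]) (simp only: sets_kappa B)
  also have "\<dots> = emeasure kappa A" using 2 by simp
  finally show ?thesis .
qed

lemma distr_hat_T: "distr MX MX hat_T = MX"
proof (rule measure_eqI)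
  fix A assume "A \<in> sets (distr MX MX hat_T)"
  then have A: "A \<in> sets MX" by simp
  have "hat_T -` A \<inter> Xset \<in> sets MX" using measurable_sets[OF hat_T_MX A] by simp
  then show "emeasure (distr MX MX hat_T) A = emeasure MX A"
    using A kappa_hat_T[of A] by (simp add: emeasure_distr[OF hat_T_MX] emeasure_MX) (simp add: sets_MX_iff)
qed simp

lemma fst_hat_T: "p \<in> Xset \<Longrightarrow> fst (hat_T p) = map_T (fst p)"
  using Xset_nz(1)[of p] by (auto simp: hat_T_def map_T_def b1_def split: prod.splits)

section \<open>The projection to the first coordinate\<close>

lemma sets_mu: "sets mu = sets (restrict_space borel dom_U)"
  by (simp add: mu_def sets_restrict_space)

lemma space_mu [simp]: "space mu = dom_U"
  by (simp add: mu_def space_restrict_space)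

lemma sets_mu_iff: "A \<in> sets mu \<longleftrightarrow> A \<in> sets borel \<and> A \<subseteq> dom_U"
  unfolding sets_mu by (subst sets_restrict_space_iff) auto

lemma fst_measurable: "fst \<in> hat_mu \<rightarrow>\<^sub>M mu"
proof (rule measurableI)
  fix A assume A: "A \<in> sets mu"
  have "fst -` A \<inter> space hat_mu = A \<times> UNIV \<inter> hat_U" by auto
  moreover have "A \<times> UNIV \<in> sets L2" using A by (intro pair_measureI) (auto simp: sets_mu_iff)
  ultimately show "fst -` A \<inter> space hat_mu \<in> sets hat_mu"
    using hat_U_measurable by (simp only: sets_hat_mu_iff) blast
qed (simp add: hat_U_fst)

lemma map_T_measurable: "map_T \<in> mu \<rightarrow>\<^sub>M mu"
proof (rule measurableI)
  have m: "map_T \<in> borel_measurable borel" unfolding map_T_def[abs_def] by measurable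
  fix A assume A: "A \<in> sets mu"
  have "map_T -` A \<in> sets borel" using measurable_sets_borel[OF m] A by (simp add: sets_mu_iff)
  then show "map_T -` A \<inter> space mu \<in> sets mu" by (auto simp: sets_mu_iff)
next
  fix z assume "z \<in> space mu"
  have "0 \<in> dom_U" by (simp add: dom_U_iff)
  then show "map_T z \<in> space mu" using bracket_dom_U[of "1 / z"] by (simp add: map_T_def)
qed

lemma dens_h_measurable: "dens_h \<in> borel_measurable borel"
proof -
  have "(\<lambda>z. \<integral>\<^sup>+ w. ennreal (1 / cmod (z - w) ^ 4) \<partial>restrict_space lborel (Vstar k l)) \<in> borel_measurable borel" for k l
  proof -
    have "(\<integral>\<^sup>+ w. ennreal (1 / cmod (z - w) ^ 4) \<partial>restrict_space lborel (Vstar k l)) = (\<integral>\<^sup>+ w. kap z w * indicator (Vstar k l) w \<partial>lborel)" for z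
      unfolding kap_def by (rule nn_integral_restrict_space) auto
    then show ?thesis by simp
  qed
  note [measurable] = this
  show ?thesis unfolding dens_h_def[abs_def] by measurable
qed

lemma hat_U_indicator:
  assumes "z \<notin> bad"
  shows "indicator hat_U (z, w) = (\<Sum>k\<in>{1..6::nat}. \<Sum>l\<in>{1..6::nat}. indicator (V k l) z * (indicator (Vstar k l) w :: ennreal))"
proof -
  have "(\<Sum>k\<in>{1..6::nat}. \<Sum>l\<in>{1..6::nat}. indicator (V k l) z * (indicator (Vstar k l) w :: ennreal))
    = (\<Sum>p\<in>{1..6::nat} \<times> {1..6::nat}. indicator (V (fst p) (snd p) \<times> Vstar (fst p) (snd p)) (z, w))"
    unfolding sum.cartesian_product by (rule sum.cong) (auto split: split_indicator)
  also have "\<dots> = indicator hat_U (z, w)"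
  proof (cases "(z, w) \<in> hat_U")
    case True
    then obtain k l where kl: "k \<in> {1..6}" "l \<in> {1..6}" "z \<in> V k l" "w \<in> Vstar k l" by (auto simp: hat_U_def)
    have "indicator (V (fst p) (snd p) \<times> Vstar (fst p) (snd p)) (z, w) = (if p = (k, l) then 1 else 0 :: ennreal)"
      if "p \<in> {1..6} \<times> {1..6}" for p
    proof (cases "p = (k, l)")
      case True
      then show ?thesis using kl by simp
    next
      case False
      have "snd p \<in> {1..6}" using that by (auto simp only: mem_Times_iff)
      then have "z \<notin> V (fst p) (snd p)"
        using V_disjoint[OF assms kl(3) _ kl(2), of "fst p" "snd p"] False by (metis prod.collapse)
      then show ?thesis using False by simp
    qed
    then have "(\<Sum>p\<in>{1..6::nat} \<times> {1..6::nat}. indicator (V (fst p) (snd p) \<times> Vstar (fst p) (snd p)) (z, w))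
      = (\<Sum>p\<in>{1..6::nat} \<times> {1..6::nat}. if p = (k, l) then 1 else 0 :: ennreal)" by (rule sum.cong[OF refl])
    also have "\<dots> = 1" using kl by simp
    finally show ?thesis using True by simp
  next
    case False
    then have "indicator (V (fst p) (snd p) \<times> Vstar (fst p) (snd p)) (z, w) = (0 :: ennreal)"
      if "p \<in> {1..6} \<times> {1..6}" for p
      using that by (cases p) (auto simp: hat_U_def split: split_indicator)
    then show ?thesis using False by (simp add: sum.neutral)
  qed
  finally show ?thesis ..
qed

text \<open>Integration along fibres: for good \<open>z\<close> the cells are disjoint, so the
  indicator of \<open>hat_U\<close> is the double sum occurring in \<open>dens_h\<close>; the other
  \<open>z\<close> form a null set.\<close>

lemma distr_fst: "distr hat_mu mu fst = mu"
proof (rule measure_eqI)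
  fix A assume "A \<in> sets (distr hat_mu mu fst)"
  then have A: "A \<in> sets mu" by simp
  then have AB [measurable]: "A \<in> sets borel" and AU: "A \<subseteq> dom_U" by (auto simp: sets_mu_iff)
  have AxU [measurable]: "A \<times> UNIV \<in> sets L2" by (intro pair_measureI) auto
  have eq: "fst -` A \<inter> space hat_mu = A \<times> UNIV \<inter> hat_U" by auto
  have inn: "(\<integral>\<^sup>+ w. ennreal (1 / cmod (z - w) ^ 4) \<partial>restrict_space lborel (Vstar k l)) = (\<integral>\<^sup>+ w. indicator (Vstar k l) w * kap z w \<partial>lborel)" for z k l
    unfolding kap_def by (subst nn_integral_restrict_space) (auto simp: mult.commute)
  have "emeasure (distr hat_mu mu fst) A = emeasure hat_mu (A \<times> UNIV \<inter> hat_U)"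
    unfolding emeasure_distr[OF fst_measurable A] eq ..
  also have "\<dots> = C0 * emeasure kappa (A \<times> UNIV \<inter> hat_U)"
    using hat_U_measurable AxU by (intro emeasure_hat_mu) auto
  also have "emeasure kappa (A \<times> UNIV \<inter> hat_U) = (\<integral>\<^sup>+p. kp p * indicator (A \<times> UNIV \<inter> hat_U) p \<partial>L2)"
    unfolding kappa_def by (rule emeasure_density) (use hat_U_measurable AxU in auto)
  also have "\<dots> = (\<integral>\<^sup>+z. \<integral>\<^sup>+w. kp (z, w) * indicator (A \<times> UNIV \<inter> hat_U) (z, w) \<partial>lborel \<partial>lborel)"
    by (rule lborel.nn_integral_fst[symmetric]) measurable
  also have "\<dots> = (\<integral>\<^sup>+z. indicator A z * (\<Sum>k\<in>{1..6::nat}. \<Sum>l\<in>{1..6::nat}. indicator (V k l) z * (\<integral>\<^sup>+ w. indicator (Vstar k l) w * kap z w \<partial>lborel)) \<partial>lborel)"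
  proof (rule nn_integral_cong_AE, rule AE_mp[OF AE_not_in[OF bad_null]], rule AE_I2, rule impI)
    fix z assume z: "z \<notin> bad"
    have "(\<integral>\<^sup>+w. kp (z, w) * indicator (A \<times> UNIV \<inter> hat_U) (z, w) \<partial>lborel)
      = (\<integral>\<^sup>+w. indicator A z * (\<Sum>k\<in>{1..6::nat}. \<Sum>l\<in>{1..6::nat}. indicator (V k l) z * (indicator (Vstar k l) w * kap z w)) \<partial>lborel)"
    proof (rule nn_integral_cong)
      fix w
      have "indicator (A \<times> UNIV \<inter> hat_U) (z, w) = (indicator A z * indicator hat_U (z, w) :: ennreal)" by (auto split: split_indicator)
      then have "kp (z, w) * indicator (A \<times> UNIV \<inter> hat_U) (z, w) = indicator A z * (indicator hat_U (z, w) * kap z w)"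
        by (simp add: ac_simps)
      also have "indicator hat_U (z, w) * kap z w = (\<Sum>k\<in>{1..6::nat}. \<Sum>l\<in>{1..6::nat}. indicator (V k l) z * (indicator (Vstar k l) w * kap z w))"
        unfolding hat_U_indicator[OF z] sum_distrib_right mult.assoc ..
      finally show "kp (z, w) * indicator (A \<times> UNIV \<inter> hat_U) (z, w)
        = indicator A z * (\<Sum>k\<in>{1..6::nat}. \<Sum>l\<in>{1..6::nat}. indicator (V k l) z * (indicator (Vstar k l) w * kap z w))" .
    qed
    also have "\<dots> = indicator A z * (\<Sum>k\<in>{1..6::nat}. \<Sum>l\<in>{1..6::nat}. indicator (V k l) z * (\<integral>\<^sup>+ w. indicator (Vstar k l) w * kap z w \<partial>lborel))"
    proof -
      have "(\<integral>\<^sup>+w. (\<Sum>k\<in>{1..6::nat}. \<Sum>l\<in>{1..6::nat}. indicator (V k l) z * (indicator (Vstar k l) w * kap z w)) \<partial>lborel)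
        = (\<Sum>k\<in>{1..6::nat}. \<integral>\<^sup>+w. (\<Sum>l\<in>{1..6::nat}. indicator (V k l) z * (indicator (Vstar k l) w * kap z w)) \<partial>lborel)"
        by (rule nn_integral_sum) measurable
      also have "\<dots> = (\<Sum>k\<in>{1..6::nat}. \<Sum>l\<in>{1..6::nat}. \<integral>\<^sup>+w. indicator (V k l) z * (indicator (Vstar k l) w * kap z w) \<partial>lborel)"
        by (rule sum.cong[OF refl], rule nn_integral_sum) measurable
      also have "\<dots> = (\<Sum>k\<in>{1..6::nat}. \<Sum>l\<in>{1..6::nat}. indicator (V k l) z * (\<integral>\<^sup>+w. indicator (Vstar k l) w * kap z w \<partial>lborel))"
        by (rule sum.cong[OF refl], rule sum.cong[OF refl], rule nn_integral_cmult) measurable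
      finally have eq: "(\<integral>\<^sup>+w. (\<Sum>k\<in>{1..6::nat}. \<Sum>l\<in>{1..6::nat}. indicator (V k l) z * (indicator (Vstar k l) w * kap z w)) \<partial>lborel)
        = (\<Sum>k\<in>{1..6::nat}. \<Sum>l\<in>{1..6::nat}. indicator (V k l) z * (\<integral>\<^sup>+w. indicator (Vstar k l) w * kap z w \<partial>lborel))" .
      have "(\<integral>\<^sup>+w. indicator A z * (\<Sum>k\<in>{1..6::nat}. \<Sum>l\<in>{1..6::nat}. indicator (V k l) z * (indicator (Vstar k l) w * kap z w)) \<partial>lborel)
        = indicator A z * (\<integral>\<^sup>+w. (\<Sum>k\<in>{1..6::nat}. \<Sum>l\<in>{1..6::nat}. indicator (V k l) z * (indicator (Vstar k l) w * kap z w)) \<partial>lborel)"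
        by (rule nn_integral_cmult) measurable
      then show ?thesis unfolding eq .
    qed
    finally show "(\<integral>\<^sup>+w. kp (z, w) * indicator (A \<times> UNIV \<inter> hat_U) (z, w) \<partial>lborel)
      = indicator A z * (\<Sum>k\<in>{1..6::nat}. \<Sum>l\<in>{1..6::nat}. indicator (V k l) z * (\<integral>\<^sup>+ w. indicator (Vstar k l) w * kap z w \<partial>lborel))" .
  qed
  also have "C0 * \<dots> = (\<integral>\<^sup>+z. C0 * (indicator A z * (\<Sum>k\<in>{1..6::nat}. \<Sum>l\<in>{1..6::nat}. indicator (V k l) z * (\<integral>\<^sup>+ w. indicator (Vstar k l) w * kap z w \<partial>lborel))) \<partial>lborel)"
    by (rule nn_integral_cmult[symmetric]) measurable
  also have "\<dots> = (\<integral>\<^sup>+z. dens_h z * indicator A z * indicator dom_U z \<partial>lborel)"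
  proof (rule nn_integral_cong)
    fix z
    have d: "dens_h z = C0 * (\<Sum>k\<in>{1..6::nat}. \<Sum>l\<in>{1..6::nat}. indicator (V k l) z * (\<integral>\<^sup>+ w. indicator (Vstar k l) w * kap z w \<partial>lborel))"
      unfolding dens_h_def inn sum_distrib_left by (simp only: mult.left_commute)
    have i: "indicator A z * indicator dom_U z = (indicator A z :: ennreal)" using AU by (auto split: split_indicator)
    show "C0 * (indicator A z * (\<Sum>k\<in>{1..6::nat}. \<Sum>l\<in>{1..6::nat}. indicator (V k l) z * (\<integral>\<^sup>+ w. indicator (Vstar k l) w * kap z w \<partial>lborel))) = dens_h z * indicator A z * indicator dom_U z"
      unfolding d mult.assoc i by (simp only: ac_simps)
  qed
  also have "\<dots> = (\<integral>\<^sup>+z. dens_h z * indicator A z \<partial>restrict_space lborel dom_U)"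
    by (rule nn_integral_restrict_space[symmetric]) simp
  also have "\<dots> = emeasure mu A"
    unfolding mu_def using A dens_h_measurable
    by (subst emeasure_density) (auto intro!: measurable_restrict_space1 simp: mu_def)
  finally show "emeasure (distr hat_mu mu fst) A = emeasure mu A" .
qed simp

lemma prob_mu: "prob_space mu"
  using prob_space.prob_space_distr[OF prob_hat_mu fst_measurable] by (simp add: distr_fst)

text \<open>Invariance is read off on \<open>Xset\<close>, where \<open>fst\<close> intertwines
  \<open>hat_T\<close> and \<open>map_T\<close> without exceptions.\<close>

lemma distr_map_T: "distr mu mu map_T = mu"
proof (rule measure_eqI)
  fix A assume "A \<in> sets (distr mu mu map_T)"
  then have A: "A \<in> sets mu" by simp
  have TA: "map_T -` A \<inter> space mu \<in> sets mu" by (rule measurable_sets[OF map_T_measurable A])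
  have emu: "emeasure mu B = emeasure MX (fst -` B \<inter> Xset)" if B: "B \<in> sets mu" for B
  proof -
    have fB: "fst -` B \<inter> space hat_mu \<in> sets hat_mu" by (rule measurable_sets[OF fst_measurable B])
    have e: "fst -` B \<inter> Xset = (fst -` B \<inter> space hat_mu) \<inter> Xset" using Xset_hat_U by auto
    have "emeasure mu B = emeasure hat_mu (fst -` B \<inter> space hat_mu)"
      using emeasure_distr[OF fst_measurable B] by (simp add: distr_fst)
    also have "\<dots> = emeasure hat_mu (fst -` B \<inter> Xset)"
      by (rule emeasure_eq_AE) (use AE_Xset fB Xset_sets in \<open>auto simp: e elim!: eventually_mono\<close>)
    also have "\<dots> = emeasure MX (fst -` B \<inter> Xset)"
      by (rule emeasure_restrict_space[symmetric]) (use Xset_sets in \<open>auto simp: Int_absorb2[OF Xset_hat_U]\<close>)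
    finally show ?thesis .
  qed
  have fA: "fst -` A \<inter> Xset \<in> sets MX"
  proof -
    have "fst -` A \<inter> Xset = (fst -` A \<inter> space hat_mu) \<inter> Xset" using Xset_hat_U by auto
    moreover have "fst -` A \<inter> space hat_mu \<in> sets hat_mu" by (rule measurable_sets[OF fst_measurable A])
    ultimately show ?thesis using Xset_L2 by (auto simp: sets_MX_iff sets_hat_mu_iff)
  qed
  have "emeasure (distr mu mu map_T) A = emeasure mu (map_T -` A \<inter> space mu)"
    by (rule emeasure_distr[OF map_T_measurable A])
  also have "\<dots> = emeasure MX (fst -` (map_T -` A \<inter> space mu) \<inter> Xset)" by (rule emu[OF TA])
  also have "fst -` (map_T -` A \<inter> space mu) \<inter> Xset = hat_T -` (fst -` A \<inter> Xset) \<inter> space MX"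
  proof (intro equalityI subsetI)
    fix p assume "p \<in> fst -` (map_T -` A \<inter> space mu) \<inter> Xset"
    then show "p \<in> hat_T -` (fst -` A \<inter> Xset) \<inter> space MX" using fst_hat_T[of p] hat_T_Xset[of p] by simp
  next
    fix p assume "p \<in> hat_T -` (fst -` A \<inter> Xset) \<inter> space MX"
    then show "p \<in> fst -` (map_T -` A \<inter> space mu) \<inter> Xset"
      using fst_hat_T[of p] Xset_hexagon[of p] subsetD[OF hexagon_dom_U, of "fst p"] by simp
  qed
  also have "emeasure MX \<dots> = emeasure (distr MX MX hat_T) (fst -` A \<inter> Xset)"
    by (rule emeasure_distr[OF hat_T_MX fA, symmetric])
  also have "\<dots> = emeasure mu A" unfolding distr_hat_T by (rule emu[OF A, symmetric])
  finally show "emeasure (distr mu mu map_T) A = emeasure mu A" .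
qed simp

section \<open>Minimality\<close>

text \<open>The six units of the Eisenstein integers, which are the vertices of the hexagon.\<close>

definition unit6 :: "complex set" where
  "unit6 = {q. (\<exists>m n::int. al q = of_int m \<and> be q = of_int n) \<and> sq q = 1}"

lemma unit6I:
  assumes "al q = of_int m" "be q = of_int n" "m * m - m * n + n * n = 1"
  shows "q \<in> unit6"
proof -
  have "sq q = of_int (m * m - m * n + n * n)" unfolding sq_albe assms(1,2) by (simp add: power2_eq_square)
  then show ?thesis using assms by (auto simp: unit6_def)
qed

lemma unit6_norm: "q \<in> unit6 \<Longrightarrow> cmod q = 1"
proof -
  assume "q \<in> unit6"
  then have "(cmod q)\<^sup>2 = 1\<^sup>2" by (simp add: unit6_def)
  then show "cmod q = 1" by (rule power2_eq_imp_eq) auto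
qed

lemma unit6_zeta: "q \<in> unit6 \<Longrightarrow> zeta * q \<in> unit6"
  unfolding unit6_def mem_Collect_eq albe_zeta_mult
  by (metis mult.left_neutral norm_mult of_int_diff zeta_norm)

lemma unit6_zeta_power: "q \<in> unit6 \<Longrightarrow> zeta ^ k * q \<in> unit6"
  by (induction k) (simp_all add: mult.assoc unit6_zeta)

lemma unit6_inverse: assumes "q \<in> unit6" shows "1 / q \<in> unit6"
proof -
  have "1 / q = cnj q" using complex_div_cnj[of 1 q] unit6_norm[OF assms] by simp
  moreover from assms obtain m n :: int where "al q = of_int m" "be q = of_int n" by (auto simp: unit6_def)
  then have "al (cnj q) = of_int (m - n)" "be (cnj q) = of_int (- n)" by simp_all
  moreover have "sq (cnj q) = 1" using assms by (simp add: unit6_def)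
  ultimately show ?thesis unfolding unit6_def by (simp only: mem_Collect_eq) blast
qed

lemma unit6_close:
  assumes "q \<in> unit6" "q' \<in> unit6" "cmod (q - q') < 1"
  shows "q = q'"
proof -
  from assms obtain m n m' n' :: int where "al q = m" "be q = n" "al q' = m'" "be q' = n'" by (auto simp: unit6_def)
  then have e: "al (q - q') = of_int (m - m')" "be (q - q') = of_int (n - n')" by simp_all
  define N where "N = (m - m')\<^sup>2 - (m - m') * (n - n') + (n - n')\<^sup>2"
  have N: "sq (q - q') = of_int N" unfolding sq_albe e N_def by simp
  have "sq (q - q') < 1" using assms(3) by (simp add: power_less_one_iff)
  then have "N < 1" unfolding N by simp
  moreover have "0 \<le> sq (q - q')" by simp
  then have "0 \<le> N" unfolding N by simp
  ultimately have "N = 0" by simp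
  then show ?thesis using N by simp
qed

text \<open>The unit circles about \<open>0\<close> and \<open>eta\<close> cross at \<open>1\<close>
  and \<open>zeta\<close>. Subtracting their equations puts \<open>u\<close> near the common chord
  \<open>al = 1\<close>; then \<open>b * (b - 1)\<close> is of order \<open>\<epsilon>\<close>, so
  \<open>b\<close> is near 0 or 1.\<close>

lemma near_vertex_eta:
  assumes e: "0 < \<epsilon>" "\<epsilon> \<le> 1 / 100" and u: "1 - \<epsilon> < sq u" "sq u < 1" and ud: "1 < sq (u - eta)" "sq (u - eta) < 1 + \<epsilon>"
  shows "cmod (u - 1) \<le> 20 * \<epsilon> \<or> cmod (u - zeta) \<le> 20 * \<epsilon>"
proof -
  define a b where "a = al u - 1" and "b = be u"
  have s: "sq u = 1 + 2 * a + a\<^sup>2 - b - a * b + b\<^sup>2"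
    unfolding sq_albe a_def b_def by (simp add: power2_eq_square algebra_simps)
  have "sq (u - eta) = sq u - 3 * al u + 3" using sq_diff_nbr[OF nbrs_named(1), of u] by (simp add: ev_named)
  then have a: "- \<epsilon> < a" "a < 0" using u ud e by (auto simp: a_def)
  have "3 * b\<^sup>2 \<le> 4 * sq u"
  proof -
    have "0 \<le> (2 * al u - be u)\<^sup>2" by simp
    then show ?thesis unfolding sq_albe b_def by (simp add: power2_eq_square algebra_simps)
  qed
  then have "b\<^sup>2 < 2\<^sup>2" using u by simp
  then have b2: "\<bar>b\<bar> < 2" using power_less_imp_less_base[of "\<bar>b\<bar>" 2 2] by simp
  have bb: "b * (b - 1) = (sq u - 1) - a * (2 + a - b)" unfolding s by (simp add: power2_eq_square algebra_simps)
  have "\<bar>a * (2 + a - b)\<bar> \<le> \<epsilon> * 4" unfolding abs_mult using a b2 e by (intro mult_mono) auto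
  then have bb': "\<bar>b * (b - 1)\<bar> \<le> 5 * \<epsilon>" unfolding bb using u by auto
  \<comment> \<open>The three terms contribute at most 1, 10 and 100 times the square of
    \<open>\<epsilon>\<close>, well below 400.\<close>
  have small: "a\<^sup>2 - a * c + c\<^sup>2 \<le> (20 * \<epsilon>)\<^sup>2" if "\<bar>c\<bar> \<le> 10 * \<epsilon>" for c
  proof -
    have "a * a \<le> \<epsilon> * \<epsilon>" using mult_mono[of "\<bar>a\<bar>" \<epsilon> "\<bar>a\<bar>" \<epsilon>] a e by simp
    moreover have "\<bar>a * c\<bar> \<le> \<epsilon> * (10 * \<epsilon>)" unfolding abs_mult using a e that by (intro mult_mono) auto
    moreover have "c * c \<le> (10 * \<epsilon>) * (10 * \<epsilon>)" using mult_mono[of "\<bar>c\<bar>" "10 * \<epsilon>" "\<bar>c\<bar>" "10 * \<epsilon>"] that e by simp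
    moreover have "0 \<le> \<epsilon> * \<epsilon>" by simp
    ultimately show ?thesis by (simp add: power2_eq_square abs_le_iff)
  qed
  show ?thesis
  proof (cases "b \<le> 1 / 2")
    case True
    have "\<bar>b\<bar> * (1 / 2) \<le> \<bar>b\<bar> * \<bar>b - 1\<bar>" using True by (intro mult_left_mono) auto
    then have "\<bar>b\<bar> \<le> 10 * \<epsilon>" using bb' by (simp add: abs_mult)
    from small[OF this] have "sq (u - 1) \<le> (20 * \<epsilon>)\<^sup>2" unfolding sq_albe by (simp add: a_def b_def)
    then have "cmod (u - 1) \<le> 20 * \<epsilon>" by (rule power2_le_imp_le) (use e in simp)
    then show ?thesis ..
  next
    case False
    have "1 / 2 * \<bar>b - 1\<bar> \<le> \<bar>b\<bar> * \<bar>b - 1\<bar>" using False by (intro mult_right_mono) auto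
    then have "\<bar>b - 1\<bar> \<le> 10 * \<epsilon>" using bb' by (simp add: abs_mult)
    from small[OF this] have "sq (u - zeta) \<le> (20 * \<epsilon>)\<^sup>2" unfolding sq_albe by (simp add: a_def b_def)
    then have "cmod (u - zeta) \<le> 20 * \<epsilon>" by (rule power2_le_imp_le) (use e in simp)
    then show ?thesis ..
  qed
qed

text \<open>The size bounds make \<open>d\<close> a neighbour. The vertex \<open>q\<close> then
  belongs to the side shared by the hexagons about \<open>0\<close> and \<open>d\<close>, so
  \<open>q - d\<close> is again a vertex; this is what lets a vertex be followed along an
  orbit.\<close>

lemma near_vertex:
  assumes d: "d \<in> ideal_J" and e: "0 < \<epsilon>" "\<epsilon> \<le> 1 / 100" and u: "1 - \<epsilon> < sq u" "sq u < 1" and ud: "1 < sq (u - d)" "sq (u - d) < 1 + \<epsilon>"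
  shows "\<exists>q\<in>unit6. q - d \<in> unit6 \<and> cmod (u - q) \<le> 20 * \<epsilon>"
proof -
  have "cmod u < 1" using u by (simp add: power_less_one_iff)
  moreover have "cmod (u - d) < 11 / 10"
  proof (rule power_less_imp_less_base[of _ 2])
    show "sq (u - d) < (11 / 10)\<^sup>2" using ud e by (simp add: power2_eq_square)
  qed simp
  ultimately have "cmod d < 21 / 10" using norm_triangle_ineq4[of u "u - d"] by simp
  then have "sq d < (21 / 10)\<^sup>2" by (intro power_strict_mono) auto
  then have "sq d < 6" by (simp add: power2_eq_square)
  moreover have "d \<noteq> 0" using u ud by auto
  ultimately have "d \<in> nbrs" using ideal_J_small[OF d] by blast
  then obtain k where k: "d = zeta ^ k * eta" using nbrs_rotate by blast
  define u' where "u' = u / zeta ^ k"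
  have uu: "u = zeta ^ k * u'" by (simp add: u'_def)
  have s: "sq u = sq u'" "sq (u - d) = sq (u' - eta)"
    unfolding uu k right_diff_distrib[symmetric] by (simp_all only: cmod_zeta_power)
  have units: "1 \<in> unit6" "zeta \<in> unit6" "1 - eta \<in> unit6" "zeta - eta \<in> unit6"
    using unit6I[of 1 1 0] unit6I[of zeta 1 1] unit6I[of "1 - eta" "-1" "-1"] unit6I[of "zeta - eta" "-1" 0]
    by simp_all
  have "cmod (u' - 1) \<le> 20 * \<epsilon> \<or> cmod (u' - zeta) \<le> 20 * \<epsilon>"
    by (rule near_vertex_eta[OF e]) (use u ud in \<open>simp_all only: s\<close>)
  then obtain q where q: "q \<in> unit6" "q - eta \<in> unit6" "cmod (u' - q) \<le> 20 * \<epsilon>" using units by blast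
  have "zeta ^ k * q - d = zeta ^ k * (q - eta)" "u - zeta ^ k * q = zeta ^ k * (u' - q)"
    by (simp_all add: k uu right_diff_distrib)
  then show ?thesis
    using unit6_zeta_power[OF q(1), of k] unit6_zeta_power[OF q(2), of k] q(3)
    by (intro bexI[of _ "zeta ^ k * q"]) auto
qed

text \<open>If the product stayed bounded, the \<open>W k\<close> would approach the vertices of the hexagon;
  but the distance to the vertex is expanded by the factor \<open>cmod (W (Suc k)) > 1\<close> at each step.\<close>

lemma prod_unbounded:
  fixes W D :: "nat \<Rightarrow> complex"
  assumes W1: "\<And>k. 1 < cmod (W k)" and D: "\<And>k. D k \<in> ideal_J" and step: "\<And>k. W k = 1 / W (Suc k) - D k"
  shows "\<exists>m. C < (\<Prod>k=1..m. cmod (W k))"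
proof (rule ccontr)
  assume "\<not> (\<exists>m. C < (\<Prod>k=1..m. cmod (W k)))"
  then have bd: "(\<Prod>k=1..m. cmod (W k)) \<le> C" for m by (meson not_le)
  define P where "P m = (\<Prod>k=1..m. cmod (W k))" for m
  have PS: "P (Suc m) = P m * cmod (W (Suc m))" for m by (simp add: P_def)
  have P1: "1 \<le> P m" for m unfolding P_def by (rule prod_ge_1) (use W1 less_imp_le in blast)
  \<comment> \<open>A bounded increasing sequence converges, here to a nonzero limit, so its
    successive quotients \<open>cmod (W (Suc m))\<close> tend to 1.\<close>
  have "incseq P"
    by (rule incseq_SucI) (use PS P1 W1 in \<open>metis mult.right_neutral mult_left_mono less_imp_le order_trans zero_le_one\<close>)
  then obtain L where L: "P \<longlonglongrightarrow> L" "\<And>i. P i \<le> L"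
    using incseq_convergent[of P C] bd by (auto simp: P_def)
  have L1: "L \<noteq> 0" using L(2)[of 0] P1[of 0] by linarith
  have "(\<lambda>m. P (Suc m) / P m) \<longlonglongrightarrow> L / L"
    using L(1) L1 by (intro tendsto_divide LIMSEQ_Suc)
  moreover have "P (Suc m) / P m = cmod (W (Suc m))" for m
  proof -
    have "P m \<noteq> 0" using P1[of m] by linarith
    then show ?thesis by (simp add: PS)
  qed
  ultimately have "(\<lambda>m. cmod (W (Suc m))) \<longlonglongrightarrow> 1" using L1 by simp
  then have "(\<lambda>m. cmod (W m)) \<longlonglongrightarrow> 1" by (rule LIMSEQ_imp_Suc)
  then have "(\<lambda>m. sq (W m)) \<longlonglongrightarrow> 1\<^sup>2" by (intro tendsto_power)
  then have lim: "(\<lambda>m. sq (W m)) \<longlonglongrightarrow> 1" by simp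
  have W2: "1 < sq (W k)" for k using W1[of k] norm_less_iff(2)[of 1 "W k"] by simp
  have W0: "W k \<noteq> 0" for k using W1[of k] by auto
  have near: "\<exists>q\<in>unit6. q - D k \<in> unit6 \<and> cmod (1 / W (Suc k) - q) \<le> 20 * \<epsilon>"
    if "0 < \<epsilon>" "\<epsilon> \<le> 1 / 100" "sq (W k) < 1 + \<epsilon>" "sq (W (Suc k)) < 1 + \<epsilon>" for \<epsilon> k
  proof (rule near_vertex[OF D that(1,2)])
    have s: "sq (1 / W (Suc k)) = 1 / sq (W (Suc k))" by (simp add: norm_divide power_divide)
    have inv1: "1 / t < 1" if "1 < t" for t :: real using that by simp
    show "sq (1 / W (Suc k)) < 1" unfolding s by (rule inv1[OF W2])
    have "(1 - \<epsilon>) * sq (W (Suc k)) < (1 - \<epsilon>) * (1 + \<epsilon>)" using that by (intro mult_strict_left_mono) auto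
    also have "\<dots> \<le> 1" by (simp add: algebra_simps)
    finally show "1 - \<epsilon> < sq (1 / W (Suc k))" unfolding s
      using less_trans[OF zero_less_one W2[of "Suc k"]] by (simp only: pos_less_divide_eq)
    show "1 < sq (1 / W (Suc k) - D k)" "sq (1 / W (Suc k) - D k) < 1 + \<epsilon>"
      unfolding step[symmetric] using W2 that by auto
  qed
  obtain K where K: "\<And>k. K \<le> k \<Longrightarrow> sq (W k) < 1 + 1 / 100"
    using order_tendstoD(2)[OF lim, of "1 + 1/100"] by (auto simp: eventually_sequentially)
  \<comment> \<open>For \<open>\<epsilon> = 1 / 100\<close> the tolerance
    \<open>20 * \<epsilon>\<close> is 1/5, small enough to identify vertices by
    \<open>unit6_close\<close>.\<close>
  have "\<exists>q. q \<in> unit6 \<and> q - D k \<in> unit6 \<and> cmod (1 / W (Suc k) - q) \<le> 1 / 5" if "K \<le> k" for k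
    using near[of "1/100" k] K[of k] K[of "Suc k"] that by auto
  then obtain q where q: "\<And>k. K \<le> k \<Longrightarrow> q k \<in> unit6" "\<And>k. K \<le> k \<Longrightarrow> q k - D k \<in> unit6"
    "\<And>k. K \<le> k \<Longrightarrow> cmod (1 / W (Suc k) - q k) \<le> 1 / 5" by metis
  define r where "r k = cmod (1 / W (Suc k) - q k)" for k
  have W11: "cmod (W k) < 11 / 10" if "K \<le> k" for k
  proof (rule power_less_imp_less_base[of _ 2])
    show "sq (W k) < (11 / 10)\<^sup>2" using K[OF that] by (simp add: power2_eq_square)
  qed simp
  have rS: "r (Suc k) = r k * cmod (W (Suc k))" if k: "K \<le> k" for k
  proof -
    have q0: "q k \<noteq> 0" "cmod (q k) = 1" using unit6_norm[OF q(1)[OF k]] by auto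
    have "W (Suc k) - 1 / q k = - (1 / W (Suc k) - q k) * W (Suc k) / q k"
      using W0[of "Suc k"] q0 by (simp add: field_simps)
    then have d1: "cmod (W (Suc k) - 1 / q k) = r k * cmod (W (Suc k))"
      using q0 by (simp only: norm_mult norm_divide norm_minus_cancel r_def div_by_1)
    have "W (Suc k) - (q (Suc k) - D (Suc k)) = 1 / W (Suc (Suc k)) - q (Suc k)"
      using step[of "Suc k"] by simp
    then have d2: "cmod (W (Suc k) - (q (Suc k) - D (Suc k))) = r (Suc k)" by (simp only: r_def)
    have "r k * cmod (W (Suc k)) \<le> 1 / 5 * (11 / 10)"
      using q(3)[OF k] W11[of "Suc k"] k by (intro mult_mono) (auto simp: r_def)
    moreover have "r (Suc k) \<le> 1 / 5" using q(3)[of "Suc k"] k by (simp add: r_def)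
    moreover have eq: "1 / q k - (q (Suc k) - D (Suc k)) = (W (Suc k) - (q (Suc k) - D (Suc k))) - (W (Suc k) - 1 / q k)"
      by simp
    ultimately have "cmod (1 / q k - (q (Suc k) - D (Suc k))) < 1"
      unfolding eq using norm_triangle_ineq4[of "W (Suc k) - (q (Suc k) - D (Suc k))" "W (Suc k) - 1 / q k"] d1 d2 by linarith
    \<comment> \<open>Both units are near \<open>W (Suc k)\<close>, and
      \<open>1/5 * 11/10 + 1/5 < 1\<close>: the vertex selected at one step is carried exactly to
      the one selected at the next.\<close>
    then have "1 / q k = q (Suc k) - D (Suc k)"
      by (intro unit6_close unit6_inverse q) (use k in auto)
    then show ?thesis using d1 d2 by simp
  qed
  have r0: "0 < r k" if "K \<le> k" for k
  proof -
    have "1 / W (Suc k) \<noteq> q k"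
    proof
      assume "1 / W (Suc k) = q k"
      then have "cmod (1 / W (Suc k)) = 1" using unit6_norm[OF q(1)[OF that]] by simp
      then show False using W1[of "Suc k"] by (simp add: norm_divide)
    qed
    then show ?thesis by (simp add: r_def)
  qed
  have rK: "r K \<le> r (K + j)" for j
  proof (induction j)
    case (Suc j)
    have "r (K + j) * 1 \<le> r (K + j) * cmod (W (Suc (K + j)))"
      using W1[of "Suc (K + j)"] r0[of "K + j"] by (intro mult_left_mono) auto
    then show ?case using Suc rS[of "K + j"] by simp
  qed simp
  \<comment> \<open>Makes \<open>20 * \<epsilon>\<close> at most half of \<open>r K\<close>,
    although \<open>r\<close> never decreases from \<open>K\<close> on.\<close>
  define \<epsilon> where "\<epsilon> = min (1 / 100) (r K / 40)"
  have e: "0 < \<epsilon>" "\<epsilon> \<le> 1 / 100" "20 * \<epsilon> < r K" using r0[of K] by (auto simp: \<epsilon>_def)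
  obtain K' where K': "\<And>k. K' \<le> k \<Longrightarrow> sq (W k) < 1 + \<epsilon>"
    using order_tendstoD(2)[OF lim, of "1 + \<epsilon>"] e by (auto simp: eventually_sequentially)
  define k where "k = K + K'"
  obtain q' where q': "q' \<in> unit6" "cmod (1 / W (Suc k) - q') \<le> 20 * \<epsilon>"
    using near[OF e(1,2), of k] K'[of k] K'[of "Suc k"] by (auto simp: k_def)
  have kK: "K \<le> k" by (simp add: k_def)
  have "cmod (q' - q k) < 1"
    using norm_triangle_ineq4[of "1 / W (Suc k) - q k" "1 / W (Suc k) - q'"] q(3)[OF kK] q'(2) e by simp
  then have "q' = q k" by (intro unit6_close q'(1) q(1) kK)
  then have "r k \<le> 20 * \<epsilon>" using q'(2) by (simp add: r_def)
  then show False using rK[of K'] e by (simp add: k_def)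
qed

text \<open>One step back multiplies the difference by \<open>A (Suc j) * B (Suc j)\<close> in
  modulus; only the first factor is kept. The last difference is one of two numbers of modulus at
  most 1, whence the 2.\<close>

lemma continued_fraction_bound:
  fixes A B :: "nat \<Rightarrow> complex"
  assumes A: "\<And>k. 1 < cmod (A k)" and B: "\<And>k. 1 < cmod (B k)"
    and diff: "\<And>k. k \<le> m \<Longrightarrow> A k - B k = 1 / A (Suc k) - 1 / B (Suc k)"
  shows "cmod (A 0 - B 0) * (\<Prod>k=1..m. cmod (A k)) \<le> 2"
proof -
  have *: "cmod (A 0 - B 0) * (\<Prod>k=1..j. cmod (A k)) \<le> cmod (A j - B j)" if "j \<le> m" for j
    using that
  proof (induction j)
    case (Suc j)
    have nz: "A (Suc j) \<noteq> 0" "B (Suc j) \<noteq> 0" using A[of "Suc j"] B[of "Suc j"] by auto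
    have "A j - B j = (B (Suc j) - A (Suc j)) / (A (Suc j) * B (Suc j))"
      using diff[of j] Suc.prems nz by (simp add: field_simps)
    then have "cmod (A j - B j) * cmod (A (Suc j)) * cmod (B (Suc j)) = cmod (A (Suc j) - B (Suc j))"
      using nz by (simp add: norm_divide norm_mult norm_minus_commute)
    moreover have "cmod (A j - B j) * cmod (A (Suc j)) * 1 \<le> cmod (A j - B j) * cmod (A (Suc j)) * cmod (B (Suc j))"
      using B[of "Suc j"] by (intro mult_left_mono) auto
    ultimately have le: "cmod (A j - B j) * cmod (A (Suc j)) \<le> cmod (A (Suc j) - B (Suc j))" by simp
    have "cmod (A 0 - B 0) * (\<Prod>k=1..j. cmod (A k)) * cmod (A (Suc j)) \<le> cmod (A j - B j) * cmod (A (Suc j))"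
      using Suc by (intro mult_right_mono) auto
    then show ?case using le by (simp add: mult.assoc)
  qed simp
  have i: "cmod (1 / A (Suc m)) \<le> 1" "cmod (1 / B (Suc m)) \<le> 1"
  proof -
    have inv1: "1 / t \<le> 1" if "1 < t" for t :: real using that by simp
    show "cmod (1 / A (Suc m)) \<le> 1" "cmod (1 / B (Suc m)) \<le> 1"
      unfolding norm_divide norm_one by (rule inv1[OF A], rule inv1[OF B])
  qed
  have "cmod (A m - B m) \<le> cmod (1 / A (Suc m)) + cmod (1 / B (Suc m))"
    unfolding diff[OF order_refl] by (rule norm_triangle_ineq4)
  then show ?thesis using *[of m] i by simp
qed

section \<open>Recovering the second coordinate from the past digits\<close>

abbreviation inv_T :: "complex \<times> complex \<Rightarrow> complex \<times> complex" where "inv_T \<equiv> the_inv_into Xset hat_T"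

definition past :: "nat \<Rightarrow> complex \<times> complex \<Rightarrow> complex \<times> complex" where "past n = inv_T ^^ n"

text \<open>The index is shifted because the digit belongs to the source of a step:
  \<open>dig n x\<close> is subtracted on the way from \<open>past (Suc n) x\<close> to
  \<open>past n x\<close>.\<close>

definition dig :: "nat \<Rightarrow> complex \<times> complex \<Rightarrow> complex" where "dig n x = b1 (fst (past (Suc n) x))"

definition code :: "nat \<Rightarrow> complex \<times> complex \<Rightarrow> complex list" where "code n x = map (\<lambda>k. dig k x) [0..<n]"

text \<open>A sample point with prescribed recent digits; its second coordinate plays the part of a
  convergent. There are only countably many codes, so an arbitrary choice does not endanger
  measurability.\<close>

definition rep :: "nat \<Rightarrow> complex list \<Rightarrow> complex \<times> complex" where
  "rep n l = (SOME y. y \<in> Xset \<and> code n y = l)"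

lemma inv_T_Xset: "x \<in> Xset \<Longrightarrow> inv_T x \<in> Xset"
  using bij_betw_the_inv_into[OF bij_hat_T] by (auto simp: bij_betw_def)

lemma inv_T_hat_T: "x \<in> Xset \<Longrightarrow> inv_T (hat_T x) = x"
  using bij_hat_T by (simp add: bij_betw_def the_inv_into_f_f)

lemma hat_T_inv_T: "x \<in> Xset \<Longrightarrow> hat_T (inv_T x) = x"
  using bij_hat_T by (simp add: bij_betw_def f_the_inv_into_f)

lemma past_Xset: "x \<in> Xset \<Longrightarrow> past n x \<in> Xset"
  unfolding past_def by (induction n) (simp_all add: inv_T_Xset)

lemma hat_T_past: "x \<in> Xset \<Longrightarrow> hat_T (past (Suc n) x) = past n x"
  using past_Xset[of x n] by (simp add: past_def hat_T_inv_T)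

lemma hat_T_power: "x \<in> Xset \<Longrightarrow> (hat_T ^^ n) x \<in> Xset"
  by (induction n) (simp_all add: hat_T_Xset)

lemma past_hat_T_power: "x \<in> Xset \<Longrightarrow> past n ((hat_T ^^ n) x) = x"
proof (induction n arbitrary: x)
  case (Suc n)
  have "past (Suc n) ((hat_T ^^ Suc n) x) = inv_T (past n ((hat_T ^^ n) (hat_T x)))"
    by (simp add: past_def funpow_swap1)
  also have "\<dots> = x" using Suc hat_T_Xset[OF Suc.prems] by (simp add: inv_T_hat_T)
  finally show ?case .
qed (simp add: past_def)

lemma hat_T_power_past: "x \<in> Xset \<Longrightarrow> (hat_T ^^ n) (past n x) = x"
proof (induction n)
  case (Suc n)
  have "(hat_T ^^ Suc n) (past (Suc n) x) = (hat_T ^^ n) (hat_T (past (Suc n) x))" by (simp add: funpow_swap1)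
  then show ?case using Suc by (simp add: hat_T_past)
qed (simp add: past_def)

lemma image_hat_T_power:
  assumes "B \<subseteq> Xset"
  shows "(hat_T ^^ n) ` B = {x \<in> Xset. past n x \<in> B}"
proof (intro equalityI subsetI)
  fix x assume "x \<in> (hat_T ^^ n) ` B"
  then show "x \<in> {x \<in> Xset. past n x \<in> B}" using assms past_hat_T_power hat_T_power by auto
next
  fix x assume "x \<in> {x \<in> Xset. past n x \<in> B}"
  then show "x \<in> (hat_T ^^ n) ` B" using hat_T_power_past[of x n] by (metis (mono_tags) image_eqI mem_Collect_eq)
qed

lemma snd_past_step: "x \<in> Xset \<Longrightarrow> snd (past n x) = 1 / snd (past (Suc n) x) - dig n x"
  using hat_T_past[of x n] by (cases "past (Suc n) x") (auto simp: hat_T_def dig_def dest: arg_cong[of _ _ snd])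

lemma Xset_snd: "x \<in> Xset \<Longrightarrow> 1 < cmod (snd x)"
  using norm_less_iff(2)[of 1 "snd x"] by (simp add: Xset_def stair_def)

definition gens :: "(complex \<times> complex) set set" where
  "gens = {(hat_T ^^ n) ` (fst -` C \<inter> Xset) | n C. C \<in> sets mu}"

definition Msig :: "(complex \<times> complex) measure" where "Msig = sigma Xset gens"

lemma gens_Pow: "gens \<subseteq> Pow Xset"
  using hat_T_power by (auto simp: gens_def)

lemma space_Msig [simp]: "space Msig = Xset" and sets_Msig: "sets Msig = sigma_sets Xset gens"
  using gens_Pow by (simp_all add: Msig_def)

lemma fst_past_dom_U: "x \<in> Xset \<Longrightarrow> fst (past n x) \<in> dom_U"
  using Xset_hexagon[OF past_Xset] hexagon_dom_U by blast

text \<open>On \<open>Xset\<close> the powers of \<open>hat_T\<close> are inverted by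
  \<open>past n\<close>, so the images in \<open>gens\<close> are preimages under these very
  functions.\<close>

lemma fst_past_measurable: "(\<lambda>x. fst (past n x)) \<in> borel_measurable Msig"
proof (rule measurableI)
  fix D :: "complex set" assume D: "D \<in> sets borel"
  have "(\<lambda>x. fst (past n x)) -` D \<inter> space Msig = (hat_T ^^ n) ` (fst -` (D \<inter> dom_U) \<inter> Xset)"
  proof -
    have "(hat_T ^^ n) ` (fst -` (D \<inter> dom_U) \<inter> Xset) = {x \<in> Xset. past n x \<in> fst -` (D \<inter> dom_U) \<inter> Xset}"
      by (rule image_hat_T_power) simp
    also have "\<dots> = (\<lambda>x. fst (past n x)) -` D \<inter> space Msig"
      using past_Xset fst_past_dom_U by auto
    finally show ?thesis ..
  qed
  also have "\<dots> \<in> gens"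
    unfolding gens_def using D dom_U_measurable
    by (intro CollectI exI[of _ n] exI[of _ "D \<inter> dom_U"] conjI refl) (simp add: sets_mu_iff)
  finally show "(\<lambda>x. fst (past n x)) -` D \<inter> space Msig \<in> sets Msig" by (auto simp: sets_Msig)
qed simp

lemma dig_measurable [measurable]: "dig n \<in> borel_measurable Msig"
  unfolding dig_def[abs_def] by (rule measurable_compose[OF fst_past_measurable b1_measurable])

lemma code_sets: "{x \<in> space Msig. code n x = l} \<in> sets Msig"
proof (cases "length l = n")
  case True
  then have "{x \<in> space Msig. code n x = l} = {x \<in> space Msig. \<forall>k\<in>{..<n}. dig k x = l ! k}"
    by (auto simp: code_def list_eq_iff_nth_eq)
  also have "\<dots> \<in> sets Msig" by measurable
  finally show ?thesis .
next
  case False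
  then have "{x \<in> space Msig. code n x = l} = {}" by (auto simp: code_def)
  then show ?thesis by (simp only: sets.empty_sets)
qed

text \<open>The function factors through \<open>code n\<close>, whose values are lists over the
  countable ideal.\<close>

lemma approx_measurable: "(\<lambda>x. snd (rep n (code n x))) \<in> borel_measurable Msig"
proof (rule measurableI)
  fix D :: "complex set"
  have "(\<lambda>x. snd (rep n (code n x))) -` D \<inter> space Msig
    = (\<Union>l\<in>lists ideal_J \<inter> {l. snd (rep n l) \<in> D}. {x \<in> space Msig. code n x = l})"
    using b1_J by (auto simp: code_def dig_def)
  also have "\<dots> \<in> sets Msig"
    by (rule sets.countable_UN''[OF countable_Int1[OF countable_lists[OF countable_ideal_J]]]) (rule code_sets)
  finally show "(\<lambda>x. snd (rep n (code n x))) -` D \<inter> space Msig \<in> sets Msig" .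
qed simp

text \<open>Two points with the same recent digits have second coordinates within 2 divided by a
  product of the \<open>cmod (W k)\<close>. This product is formed along the past of
  \<open>x\<close> alone, so the estimate is uniform in the representative.\<close>

lemma approx_tendsto:
  assumes x: "x \<in> Xset"
  shows "(\<lambda>n. snd (rep n (code n x))) \<longlonglongrightarrow> snd x"
proof (rule LIMSEQ_I)
  fix e :: real assume e: "0 < e"
  define W where "W k = snd (past k x)" for k
  have W1: "1 < cmod (W k)" for k unfolding W_def by (rule Xset_snd[OF past_Xset[OF x]])
  have "\<exists>m. 2 / e < (\<Prod>k=1..m. cmod (W k))"
  proof (rule prod_unbounded[of W "\<lambda>k. dig k x"])
    show "W k = 1 / W (Suc k) - dig k x" for k unfolding W_def by (rule snd_past_step[OF x])
  qed (use b1_J in \<open>simp_all only: W1 dig_def\<close>)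
  then obtain M where M: "2 / e < (\<Prod>k=1..M. cmod (W k))" by blast
  have "norm (snd (rep n (code n x)) - snd x) < e" if n: "Suc M \<le> n" for n
  proof -
    \<comment> \<open>Agreement of \<open>n = Suc m\<close> digits covers the indices 0 to
      \<open>m\<close>, all that the bound with product up to \<open>m\<close> consumes.\<close>
    obtain m where m: "n = Suc m" "M \<le> m" using n by (cases n) auto
    define y where "y = rep n (code n x)"
    have y: "y \<in> Xset" "code n y = code n x"
      unfolding y_def rep_def using someI[of "\<lambda>y. y \<in> Xset \<and> code n y = code n x" x] x by auto
    define B where "B k = snd (past k y)" for k
    have B1: "1 < cmod (B k)" for k unfolding B_def by (rule Xset_snd[OF past_Xset[OF y(1)]])
    have dd: "dig k x = dig k y" if "k \<le> m" for k
    proof -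
      have "code n y ! k = code n x ! k" using y(2) by simp
      then show ?thesis using that by (simp add: code_def m nth_append split: if_splits)
    qed
    have "cmod (W 0 - B 0) * (\<Prod>k=1..m. cmod (W k)) \<le> 2"
    proof (rule continued_fraction_bound[OF W1 B1])
      fix k assume "k \<le> m"
      then show "W k - B k = 1 / W (Suc k) - 1 / B (Suc k)"
        using snd_past_step[OF x, of k] snd_past_step[OF y(1), of k] dd[of k] by (simp add: W_def B_def)
    qed
    note bound = this
    have "(\<Prod>k=1..M. cmod (W k)) \<le> (\<Prod>k=1..m. cmod (W k))"
      by (rule prod_mono2) (use m(2) W1[THEN less_imp_le] in auto)
    then have P: "2 / e < (\<Prod>k=1..m. cmod (W k))" using M by linarith
    have "cmod (W 0 - B 0) < e"
    proof (cases "W 0 = B 0")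
      case False
      have "cmod (W 0 - B 0) * (2 / e) < cmod (W 0 - B 0) * (\<Prod>k=1..m. cmod (W k))"
        using P False by (intro mult_strict_left_mono) auto
      then have "cmod (W 0 - B 0) * (2 / e) < 2" using bound by linarith
      then show ?thesis using e by (simp add: field_simps)
    qed (use e in simp)
    then show ?thesis by (simp add: W_def B_def past_def y_def norm_minus_commute)
  qed
  then show "\<exists>no. \<forall>n\<ge>no. norm (snd (rep n (code n x)) - snd x) < e" by blast
qed

lemma snd_measurable_Msig: "snd \<in> borel_measurable Msig"
  by (rule borel_measurable_LIMSEQ_metric[where f = "\<lambda>n x. snd (rep n (code n x))"])
    (simp_all only: approx_measurable approx_tendsto space_Msig)

text \<open>\<open>fst\<close> is measurable for the generated sets by the case
  \<open>n = 0\<close>, and \<open>snd\<close> as a limit of functions of past digits; together they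
  recover every Borel set on \<open>Xset\<close>.\<close>

lemma generates:
  assumes "A \<in> sets L2"
  shows "A \<inter> Xset \<in> sigma_sets Xset gens"
proof -
  have "fst \<in> borel_measurable Msig" using fst_past_measurable[of 0] by (simp add: past_def)
  then have "(\<lambda>x. (fst x, snd x)) \<in> Msig \<rightarrow>\<^sub>M borel \<Otimes>\<^sub>M borel"
    using snd_measurable_Msig by (rule measurable_Pair)
  then have "(\<lambda>x. (fst x, snd x)) -` A \<inter> space Msig \<in> sets Msig"
    by (rule measurable_sets) (use assms in \<open>simp only: sets_L2\<close>)
  then show ?thesis by (simp add: sets_Msig)
qed

theorem theorem3:
  shows "natural_extension mu map_T hat_mu hat_T fst"
  unfolding natural_extension_def
proof (intro conjI bexI[of _ Xset])
  show "\<forall>A\<in>sets hat_mu. \<exists>B\<in>sigma_sets Xset {(hat_T ^^ n) ` (fst -` C \<inter> Xset) |n C. C \<in> sets mu}.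
    (A - B) \<union> (B - A) \<in> null_sets hat_mu"
  proof
    fix A assume A: "A \<in> sets hat_mu"
    then have "A \<in> sets L2" by (simp only: sets_hat_mu_iff)
    then have "A \<inter> Xset \<in> sigma_sets Xset {(hat_T ^^ n) ` (fst -` C \<inter> Xset) |n C. C \<in> sets mu}"
      using generates unfolding gens_def by blast
    moreover have "A - Xset \<in> null_sets hat_mu"
      using A Xset_sets AE_Xset by (subst AE_iff_null_sets) (auto elim!: eventually_mono)
    then have "(A - A \<inter> Xset) \<union> (A \<inter> Xset - A) \<in> null_sets hat_mu"
      by (rule back_subst[of "\<lambda>N. N \<in> null_sets hat_mu"]) blast
    ultimately show "\<exists>B\<in>sigma_sets Xset {(hat_T ^^ n) ` (fst -` C \<inter> Xset) |n C. C \<in> sets mu}.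
      (A - B) \<union> (B - A) \<in> null_sets hat_mu" by blast
  qed
qed (use prob_mu map_T_measurable distr_map_T prob_hat_mu fst_measurable distr_fst AE_Xset bij_hat_T
  hat_T_MX inv_hat_T_MX distr_hat_T fst_hat_T Xset_sets in \<open>blast\<close>)+

end
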